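(* The candidate surface branched covers of degree $d$ inducing a candidate 2-orbifold cover $S(2,4,4)\dashrightarrow S(2,4,4)$ are the following, with $\widetilde\Sigma=\Sigma=S$ and $k\geq 1$: \begin{enumerate} \item $d=4k+1$, partitions $(2^{2k},1),(4^k,1),(4^k,1)$; \item $d=4k+2$, partitions $(2^{2k+1}),(4^k,2),(4^k,1,1)$; \item $d=4k+4$, partitions $(2^{2k+2}),(4^{k+1}),(4^k,2,1,1)$; \end{enumerate} and they are realizable if and only if, respectively: \begin{enumerate} \item $d=x^2+y^2$ for some $x,y\in\mathbb{N}$ of different parity; \item $d=2(x^2+y^2)$ for some $x,y\in\mathbb{N}$ of different parity; \item $d=4(x^2+y^2)$ for some $x,y\in\mathbb{N}$. \end{enumerate}
   Context: $\mathbb{N}$ denotes the non-negative integers and $S$ the 2-sphere. A partition of $d$ is a finite unordered list (multiset) of positive integers with sum $d$; $\ell(\Pi)$ is the number of entries of $\Pi$; $(a^m,b,\ldots)$ means that $a$ is repeated $m$ times. For closed connected orientable surfaces $\widetilde\Sigma,\Sigma$, a branched cover $f:\widetilde\Sigma\to\Sigma$ is a map locally modelled on $(\mathbb{C},0)\to(\mathbb{C},0)$, $z\mapsto z^k$ with $k\geq 1$; $k$ is the local degree at the source point, and a point of $\Sigma$ having a preimage with local degree $>1$ is a branching point. The degree $d$ of $f$ is the degree of the genuine cover obtained by removing the branching points and their preimages; the local degrees at the preimages of a branching point form a partition of $d$. A candidate surface branched cover consists of closed connected orientable surfaces $\widetilde\Sigma,\Sigma$ (up to homeomorphism), integers $d\geq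 2$ and $n\geq 1$, and an unordered collection (repetitions allowed) $\Pi_1,\ldots,\Pi_n$ of partitions of $d$, each with at least one entry $>1$, satisfying the Riemann-Hurwitz condition $\chi(\widetilde\Sigma)-\sum_i\ell(\Pi_i)=d\,(\chi(\Sigma)-n)$. It is realizable if there is a degree-$d$ branched cover $f:\widetilde\Sigma\to\Sigma$ with $n$ branching points whose associated partitions of local degrees are $\Pi_1,\ldots,\Pi_n$. A 2-orbifold $\Sigma(p_1,\ldots,p_n)$ is a closed connected orientable surface $\Sigma$ with $n$ cone points of orders $p_i\geq 2$. With $\Pi_i=(d_{ij})_j$, set $p_i=\mathrm{lcm}_j\, d_{ij}$ and $p_{ij}=p_i/d_{ij}$. The induced candidate 2-orbifold cover is $\widetilde X\dashrightarrow X$ with $X=\Sigma(p_1,\ldots,p_n)$ and $\widetilde X=\widetilde\Sigma((p_{ij})_{i,j})$, where orders equal to $1$ are dropped. *)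

theory Defs
  imports
    "HOL-Complex_Analysis.Complex_Analysis"
    "HOL-Homology.Homology"
    "HOL-Library.Multiset"
begin

section \<open>Closed connected orientable surfaces\<close>

definition surface_chart :: "'a topology \<Rightarrow> 'a set \<Rightarrow> ('a \<Rightarrow> complex) \<Rightarrow> bool" where
  "surface_chart X U \<phi> \<longleftrightarrow>
     openin X U \<and> open (\<phi> ` U) \<and>
     homeomorphic_map (subtopology X U) (top_of_set (\<phi> ` U)) \<phi>"

text \<open>A homeomorphism \<open>h\<close> between open subsets of the plane preserves the orientation if it has
  local degree 1 at every point, that is, if the image of a small positively oriented circle
  around \<open>p\<close> winds once around \<open>h p\<close>. (The winding number does not depend on the
  radius, as long as the closed disc stays inside the domain \<open>W\<close> of \<open>h\<close>.)\<close>

definition orientation_preserving_on :: "complex set \<Rightarrow> (complex \<Rightarrow> complex) \<Rightarrow> bool" where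
  "orientation_preserving_on W h \<longleftrightarrow>
     (\<forall>p r. 0 < r \<and> cball p r \<subseteq> W \<longrightarrow> winding_number (h \<circ> circlepath p r) (h p) = 1)"

definition oriented_atlas :: "'a topology \<Rightarrow> ('a set \<times> ('a \<Rightarrow> complex)) set \<Rightarrow> bool" where
  "oriented_atlas X \<A> \<longleftrightarrow>
     (\<forall>(U, \<phi>) \<in> \<A>. surface_chart X U \<phi>) \<and>
     (\<Union>(U, \<phi>) \<in> \<A>. U) = topspace X \<and>
     (\<forall>(U, \<phi>) \<in> \<A>. \<forall>(V, \<psi>) \<in> \<A>.
        orientation_preserving_on (\<phi> ` (U \<inter> V)) (\<psi> \<circ> inv_into U \<phi>))"

text \<open>Charts take values in open subsets of the plane, so there is no boundary; being locally
  Euclidean is part of the existence of an atlas.\<close>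

definition closed_orientable_surface :: "'a topology \<Rightarrow> bool" where
  "closed_orientable_surface X \<longleftrightarrow>
     topspace X \<noteq> {} \<and> Hausdorff_space X \<and> second_countable X \<and>
     compact_space X \<and> connected_space X \<and> (\<exists>\<A>. oriented_atlas X \<A>)"

abbreviation S2 :: "(nat \<Rightarrow> real) topology" where
  "S2 \<equiv> nsphere 2"


section \<open>Euler characteristic\<close>

definition int_independent :: "('a, 'b) monoid_scheme \<Rightarrow> 'a set \<Rightarrow> bool" where
  "int_independent G B \<longleftrightarrow>
     finite B \<and> B \<subseteq> carrier G \<and>
     (\<forall>c :: 'a \<Rightarrow> int.
        finprod G (\<lambda>b. b [^]\<^bsub>G\<^esub> c b) B = \<one>\<^bsub>G\<^esub> \<longrightarrow> (\<forall>b\<in>B. c b = 0))"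

text \<open>The rank of an abelian group. It is meaningful only when the sizes of the independent sets
  are bounded, as for the homology groups of a compact surface.\<close>

definition abelian_rank :: "('a, 'b) monoid_scheme \<Rightarrow> nat" where
  "abelian_rank G = (GREATEST n. \<exists>B. int_independent G B \<and> card B = n)"

definition betti :: "nat \<Rightarrow> 'a topology \<Rightarrow> nat" where
  "betti i X = abelian_rank (homology_group (int i) X)"

definition euler_char :: "'a topology \<Rightarrow> int" where
  "euler_char X = (\<Sum>i | betti i X \<noteq> 0. (- 1) ^ i * int (betti i X))"


section \<open>Branched covers\<close>

text \<open>\<open>f\<close> looks near \<open>x\<close> like the germ at 0 of \<open>z \<mapsto> z ^ k\<close>.\<close>

definition locally_power :: "'a topology \<Rightarrow> 'b topology \<Rightarrow> ('a \<Rightarrow> 'b) \<Rightarrow> 'a \<Rightarrow> nat \<Rightarrow> bool" where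
  "locally_power E B f x k \<longleftrightarrow> 1 \<le> k \<and>
     (\<exists>U \<phi> V \<psi>. surface_chart E U \<phi> \<and> x \<in> U \<and> \<phi> x = 0 \<and>
                surface_chart B V \<psi> \<and> f x \<in> V \<and> \<psi> (f x) = 0 \<and>
                f ` U \<subseteq> V \<and> (\<forall>u\<in>U. \<psi> (f u) = \<phi> u ^ k))"

definition branched_cover :: "'a topology \<Rightarrow> 'b topology \<Rightarrow> ('a \<Rightarrow> 'b) \<Rightarrow> bool" where
  "branched_cover E B f \<longleftrightarrow>
     closed_orientable_surface E \<and> closed_orientable_surface B \<and> continuous_map E B f \<and>
     (\<forall>x\<in>topspace E. \<exists>k. locally_power E B f x k)"

text \<open>The exponent is unique: it is the number of preimages close to \<open>x\<close> of a point
  close to, but different from, \<open>f x\<close>.\<close>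

definition local_degree :: "'a topology \<Rightarrow> 'b topology \<Rightarrow> ('a \<Rightarrow> 'b) \<Rightarrow> 'a \<Rightarrow> nat" where
  "local_degree E B f x = (THE k. locally_power E B f x k)"

definition fibre :: "'a topology \<Rightarrow> ('a \<Rightarrow> 'b) \<Rightarrow> 'b \<Rightarrow> 'a set" where
  "fibre E f y = {x \<in> topspace E. f x = y}"

definition branching_points :: "'a topology \<Rightarrow> 'b topology \<Rightarrow> ('a \<Rightarrow> 'b) \<Rightarrow> 'b set" where
  "branching_points E B f = {y \<in> topspace B. \<exists>x\<in>fibre E f y. 1 < local_degree E B f x}"

text \<open>The degree is the number of sheets of the genuine cover over the complement of the
  branching points.\<close>

definition has_degree :: "'a topology \<Rightarrow> 'b topology \<Rightarrow> ('a \<Rightarrow> 'b) \<Rightarrow> nat \<Rightarrow> bool" where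
  "has_degree E B f d \<longleftrightarrow>
     (\<forall>y \<in> topspace B - branching_points E B f. finite (fibre E f y) \<and> card (fibre E f y) = d)"

definition local_degrees :: "'a topology \<Rightarrow> 'b topology \<Rightarrow> ('a \<Rightarrow> 'b) \<Rightarrow> 'b \<Rightarrow> nat multiset" where
  "local_degrees E B f y = image_mset (local_degree E B f) (mset_set (fibre E f y))"


section \<open>Candidate surface branched covers\<close>

definition is_partition :: "nat \<Rightarrow> nat multiset \<Rightarrow> bool" where
  "is_partition d p \<longleftrightarrow> (\<forall>a\<in>#p. 0 < a) \<and> sum_mset p = d"

text \<open>A candidate is given by its two surfaces, the degree and the multiset of its partitions;
  the number \<open>n\<close> of partitions is the size of the latter.\<close>

definition candidate_branched_cover ::
    "'a topology \<Rightarrow> 'b topology \<Rightarrow> nat \<Rightarrow> nat multiset multiset \<Rightarrow> bool" where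
  "candidate_branched_cover E B d P \<longleftrightarrow>
     closed_orientable_surface E \<and> closed_orientable_surface B \<and>
     2 \<le> d \<and> 1 \<le> size P \<and>
     (\<forall>p\<in>#P. is_partition d p \<and> (\<exists>a\<in>#p. 1 < a)) \<and>
     euler_char E - (\<Sum>p\<in>#P. int (size p)) = int d * (euler_char B - int (size P))"

definition realizable ::
    "'a topology \<Rightarrow> 'b topology \<Rightarrow> nat \<Rightarrow> nat multiset multiset \<Rightarrow> bool" where
  "realizable E B d P \<longleftrightarrow>
     (\<exists>f. branched_cover E B f \<and> has_degree E B f d \<and>
          finite (branching_points E B f) \<and> card (branching_points E B f) = size P \<and>
          image_mset (local_degrees E B f) (mset_set (branching_points E B f)) = P)"


section \<open>Induced candidate 2-orbifold covers\<close>

text \<open>A 2-orbifold, up to homeomorphism: a surface with the multiset of the orders of its cone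
  points.\<close>

type_synonym 'a orbifold = "'a topology \<times> nat multiset"

definition orbifold_iso :: "'a orbifold \<Rightarrow> 'b orbifold \<Rightarrow> bool" where
  "orbifold_iso X Y \<longleftrightarrow> fst X homeomorphic_space fst Y \<and> snd X = snd Y"

definition part_lcm :: "nat multiset \<Rightarrow> nat" where
  "part_lcm p = Lcm (set_mset p)"

definition induced_base_orbifold :: "'b topology \<Rightarrow> nat multiset multiset \<Rightarrow> 'b orbifold" where
  "induced_base_orbifold B P = (B, image_mset part_lcm P)"

definition induced_cover_orbifold :: "'a topology \<Rightarrow> nat multiset multiset \<Rightarrow> 'a orbifold" where
  "induced_cover_orbifold E P =
     (E, filter_mset (\<lambda>q. q \<noteq> 1) (\<Sum>p\<in>#P. image_mset (\<lambda>a. part_lcm p div a) p))"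

definition induces_orbifold_cover ::
    "'a topology \<Rightarrow> 'b topology \<Rightarrow> nat multiset multiset \<Rightarrow> 'c orbifold \<Rightarrow> 'd orbifold \<Rightarrow> bool" where
  "induces_orbifold_cover E B P Y X \<longleftrightarrow>
     orbifold_iso (induced_cover_orbifold E P) Y \<and> orbifold_iso (induced_base_orbifold B P) X"

end

theory Submission
  imports Defs
begin

text \<open>The Euclidean orbifold \<open>S(2,4,4)\<close> is the quotient of \<open>\<complex>\<close> by \<open>\<Gamma> = \<int>[\<i>] \<rtimes> \<langle>\<i>\<rangle>\<close>; an explicit \<open>\<Gamma>\<close>-invariant
  map from \<open>\<complex>\<close> onto a convex surface in \<open>\<real>\<^sup>3\<close> realizes it on the sphere. Multiplication by \<open>x + \<i> y\<close>
  normalizes \<open>\<Gamma>\<close> and descends to a branched cover of degree \<open>x\<^sup>2 + y\<^sup>2\<close>, whose local degrees are quotients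
  of orders of stabilizers. Conversely, put the branching points of a given cover at \<open>0\<close>, \<open>1\<close>, \<open>\<infinity>\<close>.
  The cover restricts to a covering of \<open>\<complex> - {0, 1}\<close>, and crossing the three components of
  \<open>\<real> - {0, 1}\<close> makes \<open>\<Gamma>\<close> act transitively on a fibre. In every case an order-4 branching point has
  an unramified preimage, so that some rotation of order 4 fixes a point of the fibre. The
  translations stabilizing it then form an ideal of \<open>\<int>[\<i>]\<close>, and \<open>d\<close> is its index, i.e. a norm. All
  three conditions amount to \<open>d\<close> being a sum of two squares.\<close>

section \<open>Partitions with the prescribed orders\<close>

text \<open>An unramified preimage matters for the following reason. Near a preimage of local degree
  1, a small loop around a branching point lifts to a closed loop; so the monodromy of that loop, a
  rotation of order 4, fixes a point of the fibre. This fixed point is what makes the stabilizing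
  lattice invariant under multiplication by \<open>\<i>\<close>. The relations of the action come
  from all local degrees over the three points: they divide 4, 4 and 2, so the orders of the three
  monodromies do as well. Since the source is a sphere too, deleting a preimage of infinity from it
  turns the cover into a map between open subsets of the plane, where the lifting theorems for
  covering spaces apply. In the construction the three shapes need not be prescribed: the parities
  of \<open>x\<close> and \<open>y\<close> decide which cone points collide, while the residue of
  \<open>d\<close> modulo 4 determines the shape. The conditions on parity and the factors 2 and 4
  come from this residue and from \<open>(x + y)^2 + (x - y)^2 = 2 * (x^2 + y^2)\<close>.\<close>

lemma filter_replicate_mset:
  "filter_mset P (replicate_mset n a) = (if P a then replicate_mset n a else {#})"
  by (induction n) auto

lemma mset_eq_replicates_2:
  assumes "\<forall>a\<in>#p. a = 2 \<or> a = (1::nat)"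
  shows "p = replicate_mset (count p 2) 2 + replicate_mset (count p 1) 1"
proof (intro multiset_eqI)
  fix a show "count p a = count (replicate_mset (count p 2) 2 + replicate_mset (count p 1) 1) a"
    by (cases "a \<in># p") (use assms in \<open>auto simp: not_in_iff\<close>)
qed

lemma mset_eq_replicates_4:
  assumes "\<forall>a\<in>#p. a = 4 \<or> a = 2 \<or> a = (1::nat)"
  shows "p = replicate_mset (count p 4) 4 + replicate_mset (count p 2) 2 + replicate_mset (count p 1) 1"
proof (intro multiset_eqI)
  fix a show "count p a = count (replicate_mset (count p 4) 4 + replicate_mset (count p 2) 2 + replicate_mset (count p 1) 1) a"
    by (cases "a \<in># p") (use assms in \<open>auto simp: not_in_iff\<close>)
qed

lemma part_lcm_2:
  assumes p: "is_partition d p" and l: "part_lcm p = 2"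
  obtains a b where "p = replicate_mset a 2 + replicate_mset b 1" "d = 2 * a + b"
    "filter_mset (\<lambda>q. q \<noteq> 1) (image_mset (\<lambda>a. part_lcm p div a) p) = replicate_mset b 2"
proof -
  have "a = 2 \<or> a = 1" if "a \<in># p" for a
  proof -
    have "a dvd 2" using that l unfolding part_lcm_def by (metis dvd_Lcm)
    then show ?thesis by (metis prime_nat_iff two_is_prime_nat)
  qed
  then have eq: "p = replicate_mset (count p 2) 2 + replicate_mset (count p 1) 1"
    by (intro mset_eq_replicates_2) auto
  have d: "d = 2 * count p 2 + count p 1"
    using p arg_cong [OF eq, of sum_mset] unfolding is_partition_def by simp
  have "filter_mset (\<lambda>q. q \<noteq> 1) (image_mset (\<lambda>a. part_lcm p div a) p) = replicate_mset (count p 1) 2"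
    unfolding l by (subst eq) (simp add: filter_replicate_mset)
  with eq d that show ?thesis by blast
qed

text \<open>The parts divide 4, so they are 4, 2 or 1 and leave the quotients 1, 2 or 4: a part 2
  yields a cone point of order 2 in the cover and a part 1 yields one of order 4. If the part 4 were
  missing, the lcm would divide 2.\<close>

lemma part_lcm_4:
  assumes p: "is_partition d p" and l: "part_lcm p = 4"
  obtains a b c where "p = replicate_mset a 4 + replicate_mset b 2 + replicate_mset c 1" "d = 4 * a + 2 * b + c" "1 \<le> a"
    "filter_mset (\<lambda>q. q \<noteq> 1) (image_mset (\<lambda>a. part_lcm p div a) p) = replicate_mset b 2 + replicate_mset c 4"
proof -
  have 1: "a = 4 \<or> a = 2 \<or> a = 1" if "a \<in># p" for a
  proof -
    have "a dvd 4" using that l unfolding part_lcm_def by (metis dvd_Lcm)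
    then have "a \<le> 4" "a dvd 4" by (auto intro: dvd_imp_le)
    then show ?thesis by (cases "a = 0"; cases "a = 3") auto
  qed
  then have eq: "p = replicate_mset (count p 4) 4 + replicate_mset (count p 2) 2 + replicate_mset (count p 1) 1"
    by (intro mset_eq_replicates_4) auto
  have d: "d = 4 * count p 4 + 2 * count p 2 + count p 1"
    using p arg_cong [OF eq, of sum_mset] unfolding is_partition_def by simp
  have f: "filter_mset (\<lambda>q. q \<noteq> 1) (image_mset (\<lambda>a. part_lcm p div a) p) = replicate_mset (count p 2) 2 + replicate_mset (count p 1) 4"
    unfolding l by (subst eq) (simp add: filter_replicate_mset)
  have "4 \<in># p"
  proof (rule ccontr)
    assume "4 \<notin># p"
    then have "Lcm (set_mset p) dvd 2"
      using 1 by (intro Lcm_least) fastforce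
    with l show False unfolding part_lcm_def by auto
  qed
  then have "1 \<le> count p 4" by (simp add: Suc_le_eq)
  with eq d f that show ?thesis by blast
qed

lemma image_mset_eq_triple:
  assumes "image_mset f P = {#a, b, c#}"
  obtains p q r where "P = {#p, q, r#}" "f p = a" "f q = b" "f r = c"
proof -
  obtain p P1 where 1: "P = add_mset p P1" "f p = a" "image_mset f P1 = {#b, c#}"
    using msed_map_invR [OF assms] by blast
  obtain q P2 where 2: "P1 = add_mset q P2" "f q = b" "image_mset f P2 = {#c#}"
    using msed_map_invR [OF 1(3)] by blast
  obtain r P3 where 3: "P2 = add_mset r P3" "f r = c" "image_mset f P3 = {#}"
    using msed_map_invR [OF 2(3)] by blast
  then show ?thesis using 1 2 that by simp
qed

text \<open>The three alternatives of the theorem, kept together because both directions of the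
  realizability criterion treat them by one argument.\<close>

definition cand_shape :: "nat \<Rightarrow> nat \<Rightarrow> nat multiset multiset \<Rightarrow> bool" where
  "cand_shape k d P \<longleftrightarrow> d = 4 * k + 1 \<and>
             P = {# replicate_mset (2 * k) 2 + {#1#},
                    replicate_mset k 4 + {#1#},
                    replicate_mset k 4 + {#1#} #} \<or>
           d = 4 * k + 2 \<and>
             P = {# replicate_mset (2 * k + 1) 2,
                    replicate_mset k 4 + {#2#},
                    replicate_mset k 4 + {#1, 1#} #} \<or>
           d = 4 * k + 4 \<and>
             P = {# replicate_mset (2 * k + 2) 2,
                    replicate_mset (k + 1) 4,
                    replicate_mset k 4 + {#2, 1, 1#} #}"

text \<open>The cover has exactly one cone point of order 2 and two of order 4. This fixes how many
  parts differ from the generic 2, 4, 4, and the equality of the three sums with \<open>d\<close>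
  settles the rest.\<close>

lemma shape_if_induced_orders:
  assumes part: "\<forall>p\<in>#P. is_partition d p"
    and base: "image_mset part_lcm P = {#2, 4, 4#}"
    and cover: "filter_mset (\<lambda>q. q \<noteq> 1) (\<Sum>p\<in>#P. image_mset (\<lambda>a. part_lcm p div a) p) = {#2, 4, 4#}"
  shows "\<exists>k\<ge>1. cand_shape k d P"
proof -
  obtain p1 p2 p3 where P: "P = {#p1, p2, p3#}" and l: "part_lcm p1 = 2" "part_lcm p2 = 4" "part_lcm p3 = 4"
    using image_mset_eq_triple [OF base] by blast
  obtain a b where 1: "p1 = replicate_mset a 2 + replicate_mset b 1" "d = 2 * a + b"
    "filter_mset (\<lambda>q. q \<noteq> 1) (image_mset (\<lambda>a. part_lcm p1 div a) p1) = replicate_mset b 2"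
    using part_lcm_2 [of d p1] part P l by auto
  obtain k m n where 2: "p2 = replicate_mset k 4 + replicate_mset m 2 + replicate_mset n 1" "d = 4 * k + 2 * m + n" "1 \<le> k"
    "filter_mset (\<lambda>q. q \<noteq> 1) (image_mset (\<lambda>a. part_lcm p2 div a) p2) = replicate_mset m 2 + replicate_mset n 4"
    using part_lcm_4 [of d p2] part P l by auto
  obtain k' m' n' where 3: "p3 = replicate_mset k' 4 + replicate_mset m' 2 + replicate_mset n' 1" "d = 4 * k' + 2 * m' + n'" "1 \<le> k'"
    "filter_mset (\<lambda>q. q \<noteq> 1) (image_mset (\<lambda>a. part_lcm p3 div a) p3) = replicate_mset m' 2 + replicate_mset n' 4"
    using part_lcm_4 [of d p3] part P l by auto
  have sum: "replicate_mset b 2 + (replicate_mset m 2 + replicate_mset n 4) + (replicate_mset m' 2 + replicate_mset n' 4) = {#2, 4, 4::nat#}"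
    using cover unfolding P using 1(3) 2(4) 3(4) by (simp add: add.assoc)
  have e: "b + m + m' = 1" "n + n' = 2"
    using arg_cong [OF sum, of "\<lambda>M. count M 2"] arg_cong [OF sum, of "\<lambda>M. count M 4"] by auto
  have eqs: "2 * a + b = 4 * k + 2 * m + n" "4 * k + 2 * m + n = 4 * k' + 2 * m' + n'"
    using 1(2) 2(2) 3(2) by simp_all
  \<comment> \<open>Each of the three sums is \<open>d\<close>; modulo 2 they reduce to
    \<open>b\<close>, \<open>n\<close> and \<open>n'\<close>.\<close>
  have par: "even b \<longleftrightarrow> even n" "even n \<longleftrightarrow> even n'"
    using arg_cong [OF eqs(1), of even] arg_cong [OF eqs(2), of even] by simp_all
  have bm: "b = 1 \<and> m = 0 \<and> m' = 0 \<or> b = 0 \<and> m = 1 \<and> m' = 0 \<or> b = 0 \<and> m = 0 \<and> m' = 1"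
    using e(1) by linarith
  have n: "n = 0 \<and> n' = 2 \<or> n = 1 \<and> n' = 1 \<or> n = 2 \<and> n' = 0"
    using e(2) by linarith
  \<comment> \<open>\<open>B1\<close> and \<open>B2\<close>, like \<open>C1\<close> and
    \<open>C2\<close>, differ by exchanging the two partitions with lcm 4. In the third shape these
    contain different numbers of fours; the parameter of the shape is the smaller number, so
    \<open>C2\<close> uses \<open>k'\<close>.\<close>
  consider
      (A) "b = 1" "m = 0" "m' = 0" "n = 1" "n' = 1" "k' = k" "a = 2 * k"
    | (B1) "b = 0" "m = 1" "m' = 0" "n = 0" "n' = 2" "k' = k" "a = 2 * k + 1"
    | (B2) "b = 0" "m = 0" "m' = 1" "n = 2" "n' = 0" "k' = k" "a = 2 * k + 1"
    | (C1) "b = 0" "m = 1" "m' = 0" "n = 2" "n' = 0" "k' = k + 1" "a = 2 * k + 2"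
    | (C2) "b = 0" "m = 0" "m' = 1" "n = 0" "n' = 2" "k = k' + 1" "a = 2 * k' + 2"
  proof (cases "b = 1")
    case True
    then have "m = 0" "m' = 0" "n = 1" "n' = 1" using bm n par by auto
    then show ?thesis using True eqs A by simp
  next
    case False
    then have b: "b = 0" and n': "n = 0 \<and> n' = 2 \<or> n = 2 \<and> n' = 0" using bm n par by auto
    show ?thesis
    proof (cases "m = 1"; cases "n = 0")
      assume "m = 1" "n = 0"
      moreover from this have "m' = 0" "n' = 2" using bm n' by auto
      ultimately show ?thesis using b eqs B1 by simp
    next
      assume "m = 1" "n \<noteq> 0"
      moreover from this have "m' = 0" "n' = 0" "n = 2" using bm n' by auto
      ultimately show ?thesis using b eqs C1 by simp
    next
      assume "m \<noteq> 1" "n = 0"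
      moreover from this have "m = 0" "m' = 1" "n' = 2" using b bm n' by auto
      ultimately show ?thesis using b eqs C2 by simp
    next
      assume "m \<noteq> 1" "n \<noteq> 0"
      moreover from this have "m = 0" "m' = 1" "n' = 0" "n = 2" using b bm n' by auto
      ultimately show ?thesis using b eqs B2 by simp
    qed
  qed
  then show ?thesis
  proof cases
    case A
    then have "cand_shape k d P" unfolding P cand_shape_def 1(1) 2(1) 3(1) using 2(2) by simp
    with 2(3) show ?thesis by blast
  next
    case B1
    then have "cand_shape k d P" unfolding P cand_shape_def 1(1) 2(1) 3(1) using 2(2) by (simp add: numeral_2_eq_2)
    with 2(3) show ?thesis by blast
  next
    case B2
    then have "cand_shape k d P" unfolding P cand_shape_def 1(1) 2(1) 3(1) using 2(2)
      by (simp add: numeral_2_eq_2 add_mset_commute)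
    with 2(3) show ?thesis by blast
  next
    case C1
    then have "cand_shape k d P" unfolding P cand_shape_def 1(1) 2(1) 3(1) using 2(2)
      by (simp add: numeral_2_eq_2 add_mset_commute)
    with 2(3) show ?thesis by blast
  next
    case C2
    then have "cand_shape k' d P" unfolding P cand_shape_def 1(1) 2(1) 3(1) using 3(2)
      by (simp add: numeral_2_eq_2 add_mset_commute)
    with 3(3) show ?thesis by blast
  qed
qed

text \<open>The last fact is the Riemann-Hurwitz condition in disguise: for two spheres and three
  branching points it reads \<open>2 - (d + 2) = d * (2 - 3)\<close>.\<close>

lemma shape_induced_orders:
  assumes "1 \<le> k" "cand_shape k d P"
  shows "\<forall>p\<in>#P. is_partition d p \<and> (\<exists>a\<in>#p. 1 < a)"
    and "image_mset part_lcm P = {#2, 4, 4#}"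
    and "filter_mset (\<lambda>q. q \<noteq> 1) (\<Sum>p\<in>#P. image_mset (\<lambda>a. part_lcm p div a) p) = {#2, 4, 4#}"
    and "2 \<le> d" "size P = 3" "(\<Sum>p\<in>#P. size p) = d + 2"
proof -
  show "\<forall>p\<in>#P. is_partition d p \<and> (\<exists>a\<in>#p. 1 < a)"
    using assms unfolding cand_shape_def is_partition_def
    by auto
  have Lcm4: "Lcm A = 4" if "4 \<in> A" "A \<subseteq> {4, 2, 1}" for A :: "nat set"
    by (rule Lcm_eqI) (use that in \<open>auto simp: subset_iff\<close>)
  have Lcm2: "Lcm A = 2" if "2 \<in> A" "A \<subseteq> {2, 1}" for A :: "nat set"
    by (rule Lcm_eqI) (use that in \<open>auto simp: subset_iff\<close>)
  have l: "part_lcm (replicate_mset (2 * k) 2 + M) = 2" if "set_mset M \<subseteq> {2, 1}" for M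
    unfolding part_lcm_def by (rule Lcm2) (use that assms(1) in auto)
  have l': "part_lcm (replicate_mset k 4 + M) = 4" if "set_mset M \<subseteq> {4, 2, 1}" for M
    unfolding part_lcm_def by (rule Lcm4) (use that assms(1) in auto)
  \<comment> \<open>Each partition is rewritten as many equal parts plus a few exceptional ones. As
    \<open>k \<ge> 1\<close>, the repeated part is present, so \<open>l\<close> and
    \<open>l'\<close> give the lcm.\<close>
  consider "P = {# replicate_mset (2 * k) 2 + {#1#}, replicate_mset k 4 + {#1#}, replicate_mset k 4 + {#1#} #}"
    | "P = {# replicate_mset (2 * k) 2 + {#2#}, replicate_mset k 4 + {#2#}, replicate_mset k 4 + {#1, 1#} #}"
    | "P = {# replicate_mset (2 * k) 2 + {#2, 2#}, replicate_mset k 4 + {#4#}, replicate_mset k 4 + {#2, 1, 1#} #}"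
    using assms(2) unfolding cand_shape_def by (auto simp: numeral_2_eq_2)
  then have "image_mset part_lcm P = {#2, 4, 4#} \<and>
    filter_mset (\<lambda>q. q \<noteq> 1) (\<Sum>p\<in>#P. image_mset (\<lambda>a. part_lcm p div a) p) = {#2, 4, 4#}"
    by cases (simp_all del: union_mset_add_mset_right add: l l' filter_replicate_mset)
  then show "image_mset part_lcm P = {#2, 4, 4#}"
    "filter_mset (\<lambda>q. q \<noteq> 1) (\<Sum>p\<in>#P. image_mset (\<lambda>a. part_lcm p div a) p) = {#2, 4, 4#}"
    by auto
  show "2 \<le> d" "size P = 3" "(\<Sum>p\<in>#P. size p) = d + 2"
    using assms unfolding cand_shape_def by auto
qed

section \<open>The 2-sphere and its charts\<close>

text \<open>Stated for every three-dimensional space: \<open>complex \<times> real\<close> suits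
  stereographic projection, and \<open>real \<times> real \<times> real\<close> suits the convex
  body used later.\<close>

lemma S2_homeomorphic_sphere_gen:
  assumes "DIM('a :: euclidean_space) = 3"
  shows "S2 homeomorphic_space top_of_set (sphere (0 :: 'a) 1)"
proof -
  have "card (Basis :: 'a set) = 3" using assms by simp
  then obtain f :: "(nat \<Rightarrow> real) \<Rightarrow> 'a" and g
    where "homeomorphic_maps (nsphere (3 - 1)) (top_of_set (sphere 0 1 \<inter> span Basis)) f g"
    using homeomorphic_maps_nsphere_euclidean_sphere
      [OF independent_Basis orthogonal_Basis] norm_Basis by (metis zero_neq_numeral)
  then show ?thesis
    unfolding homeomorphic_space_def by (auto simp: span_Basis)
qed

lemma S2_homeomorphic_sphere: "S2 homeomorphic_space top_of_set (sphere (0 :: complex \<times> real) 1)"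
  by (rule S2_homeomorphic_sphere_gen) simp

lemma surface_chart_compose:
  assumes "homeomorphic_maps E Y f g" "surface_chart Y U \<phi>"
  shows "surface_chart E (g ` U) (\<phi> \<circ> f)"
proof -
  have U: "openin Y U" "U \<subseteq> topspace Y" using assms openin_subset by (auto simp: surface_chart_def)
  have fg: "f (g y) = y" if "y \<in> topspace Y" for y
    using assms that by (simp add: homeomorphic_maps_def)
  have f: "homeomorphic_map E Y f" and g: "homeomorphic_map Y E g"
    using assms homeomorphic_maps_map by blast+
  have o: "openin E (g ` U)" using U homeomorphic_map_openness [OF g] by blast
  have gU: "g ` U \<subseteq> topspace E" using o openin_subset by blast
  have im: "(\<phi> \<circ> f) ` g ` U = \<phi> ` U"
    using U fg by (force simp: image_comp)
  have "homeomorphic_map (subtopology E (g ` U)) (subtopology Y U) f"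
  proof (rule homeomorphic_map_subtopologies [OF f])
    show "f ` (topspace E \<inter> g ` U) = topspace Y \<inter> U"
      using U gU fg by (auto simp: subset_iff Int_absorb1 image_image)
  qed
  then have "homeomorphic_map (subtopology E (g ` U)) (top_of_set (\<phi> ` U)) (\<phi> \<circ> f)"
    using assms(2) homeomorphic_map_compose unfolding surface_chart_def by blast
  with o im show ?thesis
    using assms(2) unfolding surface_chart_def by simp
qed

text \<open>The winding number involves \<open>h\<close> only on a circle and at its centre, and
  both lie in the closed disc inside \<open>W\<close>. This lets transition maps, which contain
  \<open>inv_into\<close>, be replaced by formulas.\<close>

lemma orientation_preserving_on_cong:
  assumes "\<And>w. w \<in> W \<Longrightarrow> h w = h' w"
  shows "orientation_preserving_on W h \<longleftrightarrow> orientation_preserving_on W h'"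
proof -
  have "winding_number (h \<circ> circlepath p r) (h p) = winding_number (h' \<circ> circlepath p r) (h' p)"
    if "0 < r" "cball p r \<subseteq> W" for p r
  proof -
    have "h (circlepath p r t) = h' (circlepath p r t)" for t
    proof (rule assms)
      have "dist p (circlepath p r t) = r"
        using that by (simp add: circlepath dist_norm norm_mult)
      then show "circlepath p r t \<in> W" using that by auto
    qed
    moreover have "h p = h' p" using that by (intro assms) auto
    ultimately show ?thesis by (simp add: o_def)
  qed
  then show ?thesis unfolding orientation_preserving_on_def by (simp cong: imp_cong conj_cong)
qed

text \<open>Pulling charts back along \<open>f\<close> does not change the transition maps, since
  \<open>f\<close> cancels in
  \<open>(\<psi> \<circ> f) \<circ> (\<phi> \<circ> f)^-1\<close>.\<close>

lemma oriented_atlas_compose: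
  assumes hom: "homeomorphic_maps E Y f g" and A: "oriented_atlas Y \<A>"
  shows "oriented_atlas E ((\<lambda>(U, \<phi>). (g ` U, \<phi> \<circ> f)) ` \<A>)"
proof -
  have fg: "f (g y) = y" if "y \<in> topspace Y" for y
    using hom that by (simp add: homeomorphic_maps_def)
  have gim: "g ` topspace Y = topspace E"
    using hom by (metis homeomorphic_imp_surjective_map homeomorphic_maps_map)
  have ch: "surface_chart Y U \<phi>" if "(U, \<phi>) \<in> \<A>" for U \<phi>
    using A that by (auto simp: oriented_atlas_def)
  have sub: "U \<subseteq> topspace Y" if "(U, \<phi>) \<in> \<A>" for U \<phi>
    using ch [OF that] openin_subset by (auto simp: surface_chart_def)
  have 1: "surface_chart E (g ` U) (\<phi> \<circ> f)" if "(U, \<phi>) \<in> \<A>" for U \<phi>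
    using ch [OF that] hom surface_chart_compose by blast
  have "(\<Union>(U, \<phi>) \<in> \<A>. U) = topspace Y" using A by (simp add: oriented_atlas_def)
  moreover have "(\<Union>(U, \<phi>) \<in> \<A>. g ` U) = g ` (\<Union>(U, \<phi>) \<in> \<A>. U)"
    by (simp add: case_prod_unfold image_UN)
  ultimately have 2: "(\<Union>(U, \<phi>) \<in> \<A>. g ` U) = topspace E"
    unfolding gim [symmetric] by simp
  have 3: "orientation_preserving_on ((\<phi> \<circ> f) ` (g ` U \<inter> g ` V)) ((\<psi> \<circ> f) \<circ> inv_into (g ` U) (\<phi> \<circ> f))"
    if UV: "(U, \<phi>) \<in> \<A>" "(V, \<psi>) \<in> \<A>" for U \<phi> V \<psi>
  proof -
    have inj: "inj_on \<phi> U"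
      using ch [OF UV(1)] sub [OF UV(1)] homeomorphic_imp_injective_map unfolding surface_chart_def
      by (metis inf.absorb_iff2 topspace_subtopology)
    have "inj_on (\<phi> \<circ> f) (g ` U)"
      using inj fg sub [OF UV(1)] by (auto simp: inj_on_def subset_iff)
    then have iv: "inv_into (g ` U) (\<phi> \<circ> f) (\<phi> u) = g u" if "u \<in> U" for u
      using that fg sub [OF UV(1)] inv_into_f_eq [of "\<phi> \<circ> f" "g ` U" "g u"] by (auto simp: subset_iff)
    have "g ` U \<inter> g ` V = g ` (U \<inter> V)"
      using inj_on_image_Int [of g "topspace Y" U V] sub [OF UV(1)] sub [OF UV(2)] fg by (metis inj_on_inverseI)
    moreover have "f ` g ` (U \<inter> V) = U \<inter> V"
      using fg sub [OF UV(1)] by (force simp: image_image subset_iff)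
    ultimately have im: "(\<phi> \<circ> f) ` (g ` U \<inter> g ` V) = \<phi> ` (U \<inter> V)"
      by (metis image_comp)
    have "orientation_preserving_on (\<phi> ` (U \<inter> V)) (\<psi> \<circ> inv_into U \<phi>)"
      using A UV by (fastforce simp: oriented_atlas_def)
    then show ?thesis
      unfolding im
    proof (rule orientation_preserving_on_cong [THEN iffD1, rotated])
      fix w assume "w \<in> \<phi> ` (U \<inter> V)"
      then obtain u where "u \<in> U" "w = \<phi> u" by auto
      then show "(\<psi> \<circ> inv_into U \<phi>) w = ((\<psi> \<circ> f) \<circ> inv_into (g ` U) (\<phi> \<circ> f)) w"
        using iv fg sub [OF UV(1)] inj by auto
    qed
  qed
  show ?thesis
    unfolding oriented_atlas_def using 1 2 3 by (auto simp: case_prod_unfold)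
qed

lemma homeomorphic_second_countable:
  assumes "E homeomorphic_space Y" "second_countable Y"
  shows "second_countable E"
  using assms by (metis homeomorphic_eq_everything_map homeomorphic_map_maps homeomorphic_space_def
      homeomorphic_space_sym second_countable_open_map_image)

lemma closed_orientable_surface_homeomorphic:
  assumes "E homeomorphic_space Y" "closed_orientable_surface Y"
  shows "closed_orientable_surface E"
proof -
  obtain f g where "homeomorphic_maps E Y f g" using assms by (auto simp: homeomorphic_space_def)
  then show ?thesis
    using assms(2) oriented_atlas_compose [of E Y f g] homeomorphic_second_countable [OF assms(1)]
      homeomorphic_Hausdorff_space [OF assms(1)] homeomorphic_compact_space [OF assms(1)]
      homeomorphic_connected_space [OF assms(1)] homeomorphic_empty_space [OF assms(1)]
    unfolding closed_orientable_surface_def by (auto simp: null_topspace_iff_trivial)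
qed

text \<open>Substituting \<open>inverse\<close> in the winding integral turns the integrand into
  \<open>1 / (w - p) - 1 / w\<close>. The first term contributes \<open>2 * pi * \<i>\<close>, the
  second nothing because the disc avoids 0.\<close>

lemma winding_number_inverse_circlepath:
  assumes r: "0 < r" and 0: "0 \<notin> cball p r"
  shows "winding_number (inverse \<circ> circlepath p r) (inverse p) = 1"
proof -
  have p0: "p \<noteq> 0" and nz: "norm p > r" using assms by (auto simp: not_le)
  have im: "path_image (circlepath p r) = sphere p r" using r by simp
  have ne: "w \<noteq> 0" "w \<noteq> p" if "w \<in> sphere p r" for w using that nz r by auto
  have an: "inverse analytic_on (- {0 :: complex})"
    by (auto intro!: analytic_intros simp: analytic_on_open)
  have sub: "path_image (circlepath p r) \<subseteq> - {0}" unfolding im using ne by blast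
  have vp: "valid_path (inverse \<circ> circlepath p r)"
    by (rule valid_path_compose_analytic [OF _ an sub]) auto
  have "inverse p \<notin> path_image (inverse \<circ> circlepath p r)"
    unfolding path_image_compose im using ne by force
  then have "winding_number (inverse \<circ> circlepath p r) (inverse p) =
      1 / (2 * pi * \<i>) * contour_integral (inverse \<circ> circlepath p r) (\<lambda>w. 1 / (w - inverse p))"
    using vp winding_number_valid_path by blast
  also have "contour_integral (inverse \<circ> circlepath p r) (\<lambda>w. 1 / (w - inverse p)) =
      contour_integral (circlepath p r) (\<lambda>w. deriv inverse w * (1 / (inverse w - inverse p)))"
    by (rule contour_integral_comp_analyticW [OF an _ sub]) auto
  also have "\<dots> = contour_integral (circlepath p r) (\<lambda>w. 1 / (w - p) - 1 / w)"
  proof (rule contour_integral_eq)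
    fix w assume "w \<in> path_image (circlepath p r)"
    then have w: "w \<noteq> 0" "w \<noteq> p" using ne im by metis+
    have "deriv inverse w = - (inverse w ^ 2)"
      using w by (intro DERIV_imp_deriv) (auto intro!: derivative_eq_intros simp: power2_eq_square)
    then show "deriv inverse w * (1 / (inverse w - inverse p)) = 1 / (w - p) - 1 / w"
      using w p0 by (simp add: field_simps power2_eq_square) 
  qed
  also have "\<dots> = 2 * pi * \<i>"
  proof (rule contour_integral_unique)
    have 1: "((\<lambda>w. 1 / (w - p)) has_contour_integral (2 * pi * \<i>)) (circlepath p r)"
      using Cauchy_integral_circlepath_simple [of "\<lambda>_. 1" p r p] r by simp
    have 2: "((\<lambda>w. 1 / w) has_contour_integral 0) (circlepath p r)"
    proof (rule Cauchy_theorem_convex_simple)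
      show "(\<lambda>w. 1 / w) holomorphic_on cball p r"
        using 0 by (auto intro!: holomorphic_intros)
    qed (use r im in auto)
    show "((\<lambda>w. 1 / (w - p) - 1 / w) has_contour_integral (2 * pi * \<i>)) (circlepath p r)"
      using has_contour_integral_diff [OF 1 2] by simp
  qed
  finally show ?thesis by (simp add: o_def)
qed

definition stereo :: "complex \<times> real \<Rightarrow> complex" where
  "stereo x = fst x / of_real (1 - snd x)"

definition stereo_inv :: "complex \<Rightarrow> complex \<times> real" where
  "stereo_inv w = (2 * w / of_real ((norm w)\<^sup>2 + 1), ((norm w)\<^sup>2 - 1) / ((norm w)\<^sup>2 + 1))"

text \<open>Not the antipodal map but a half turn about the real axis. It exchanges the poles; the
  conjugation makes the transition between the two stereographic charts \<open>inverse\<close>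
  rather than the orientation-reversing \<open>1 / cnj w\<close>.\<close>

definition antipode_cnj :: "complex \<times> real \<Rightarrow> complex \<times> real" where
  "antipode_cnj x = (cnj (fst x), - snd x)"

lemma mem_unit_sphere: "(z, t) \<in> sphere (0 :: complex \<times> real) 1 \<longleftrightarrow> (norm z)\<^sup>2 + t\<^sup>2 = 1"
  by (simp add: norm_Pair)

lemma stereo_homeomorphism:
  "homeomorphism (sphere 0 1 - {(0, 1)}) UNIV stereo stereo_inv"
proof -
  have t1: "snd x \<noteq> 1" if "x \<in> sphere 0 1 - {(0, 1)}" for x :: "complex \<times> real"
    using that by (cases x) (auto simp: norm_Pair)
  have pos: "(norm w)\<^sup>2 + 1 \<noteq> 0" for w :: complex
    by (smt (verit) zero_le_power2)
  have posc: "(of_real (norm w))\<^sup>2 + 1 \<noteq> (0 :: complex)" for w :: complex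
    using pos [of w] by (metis of_real_1 of_real_add of_real_eq_0_iff of_real_power)
  have 1: "continuous_on (sphere 0 1 - {(0, 1)}) stereo"
    unfolding stereo_def using t1 by (intro continuous_intros) (auto simp: of_real_eq_1_iff)
  have 2: "continuous_on UNIV stereo_inv"
    unfolding stereo_inv_def using pos posc by (intro continuous_intros) auto
  have 3: "stereo_inv w \<in> sphere 0 1 - {(0, 1)}" for w
  proof -
    have "norm (2 * w / of_real ((norm w)\<^sup>2 + 1)) = 2 * norm w / \<bar>(norm w)\<^sup>2 + 1\<bar>"
      unfolding norm_divide norm_of_real by (simp add: norm_mult)
    then have n: "norm (2 * w / of_real ((norm w)\<^sup>2 + 1)) = 2 * norm w / ((norm w)\<^sup>2 + 1)" by simp
    have "(2 * norm w / ((norm w)\<^sup>2 + 1))\<^sup>2 + (((norm w)\<^sup>2 - 1) / ((norm w)\<^sup>2 + 1))\<^sup>2 = 1"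
      using pos [of w] by (simp add: divide_simps) (simp add: algebra_simps power2_eq_square)
    then have "stereo_inv w \<in> sphere 0 1"
      unfolding stereo_inv_def mem_unit_sphere n .
    moreover have "stereo_inv w \<noteq> (0, 1)"
      using pos [of w] by (simp add: stereo_inv_def)
    ultimately show ?thesis by blast
  qed
  have 4: "stereo_inv (stereo x) = x" if x: "x \<in> sphere 0 1 - {(0, 1)}" for x
  proof -
    obtain z t where zt: "x = (z, t)" by (cases x)
    have t: "t \<noteq> 1" using t1 [OF x] zt by simp
    have "x \<in> sphere 0 1" using x by blast
    then have z: "(norm z)\<^sup>2 = 1 - t\<^sup>2" unfolding zt mem_unit_sphere by simp
    have st: "stereo x = z / of_real (1 - t)" by (simp add: stereo_def zt)
    have "(norm (stereo x))\<^sup>2 = (1 - t\<^sup>2) / (1 - t)\<^sup>2"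
      unfolding st norm_divide norm_of_real by (simp add: z power_divide)
    also have "\<dots> = (1 + t) / (1 - t)"
      using t by (simp add: divide_simps) (simp add: algebra_simps power2_eq_square)
    finally have n: "(norm (stereo x))\<^sup>2 = (1 + t) / (1 - t)" .
    have n1: "(norm (stereo x))\<^sup>2 + 1 = 2 / (1 - t)" and n2: "(norm (stereo x))\<^sup>2 - 1 = 2 * t / (1 - t)"
      unfolding n using t by (simp_all add: field_simps)
    have "of_real (1 - t) \<noteq> (0 :: complex)" using t by (simp only: of_real_eq_0_iff)
    then have "2 * stereo x / of_real (2 / (1 - t)) = z" unfolding st by (simp add: field_simps)
    moreover have "(2 * t / (1 - t)) / (2 / (1 - t)) = t" using t by simp
    ultimately show ?thesis
      unfolding stereo_inv_def n1 n2 by (simp add: zt)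
  qed
  have 5: "stereo (stereo_inv w) = w" for w
  proof -
    have "1 - ((norm w)\<^sup>2 - 1) / ((norm w)\<^sup>2 + 1) = 2 / ((norm w)\<^sup>2 + 1)"
      using pos [of w] by (simp add: divide_simps)
    then show ?thesis
      unfolding stereo_def stereo_inv_def fst_conv snd_conv using posc [of w] by simp
  qed
  show ?thesis
  proof (rule homeomorphismI [OF 1 2])
    show "stereo_inv ` UNIV \<subseteq> sphere 0 1 - {(0, 1)}" using 3 by (rule image_subsetI)
  qed (rule subset_UNIV 4 5; assumption?)+
qed

lemma surface_chart_top_of_set:
  assumes h: "homeomorphism U T \<phi> g" and T: "open T" and U: "openin (top_of_set S) U"
  shows "surface_chart (top_of_set S) U \<phi>"
proof -
  have im: "\<phi> ` U = T" using h unfolding homeomorphism_def by (elim conjE)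
  have "U \<subseteq> S" using openin_subset [OF U] by simp
  then have sub: "subtopology (top_of_set S) U = top_of_set U"
    unfolding subtopology_subtopology by (simp only: Int_absorb1)
  have "homeomorphic_maps (top_of_set U) (top_of_set T) \<phi> g"
    unfolding homeomorphic_maps_iff_homeomorphism by (rule h)
  then have "homeomorphic_map (top_of_set U) (top_of_set T) \<phi>"
    by (rule homeomorphic_maps_imp_map)
  with T U show ?thesis unfolding surface_chart_def im sub by (intro conjI)
qed

text \<open>On the sphere \<open>z * cnj z = 1 - t^2 = (1 + t) * (1 - t)\<close>, so the coordinates
  \<open>z / (1 - t)\<close> and \<open>cnj z / (1 + t)\<close> are inverse to each other.\<close>

lemma stereo_antipode_cnj:
  assumes "x \<in> sphere 0 1" "x \<noteq> (0, 1)" "x \<noteq> (0, -1)"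
  shows "stereo (antipode_cnj x) = inverse (stereo x)" "stereo x \<noteq> 0"
proof -
  obtain z t where zt: "x = (z, t)" by (cases x)
  have z: "(norm z)\<^sup>2 = 1 - t\<^sup>2" using assms(1) unfolding zt mem_unit_sphere by simp
  have t: "t \<noteq> 1" "t \<noteq> -1"
    using z assms zt by (auto simp: power2_eq_1_iff)
  then have "t\<^sup>2 \<noteq> 1" by (simp add: power2_eq_1_iff)
  then have z0: "z \<noteq> 0" using z by auto
  have "z * cnj z = of_real (1 - t\<^sup>2)" using z by (metis complex_norm_square of_real_power)
  also have "\<dots> = of_real (1 + t) * of_real (1 - t)"
    by (simp add: power2_eq_square algebra_simps flip: of_real_mult)
  finally have e: "z * cnj z = of_real (1 + t) * of_real (1 - t)" .
  have "of_real (1 + t) \<noteq> (0::complex)" "of_real (1 - t) \<noteq> (0::complex)"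
    using t by (auto simp only: of_real_eq_0_iff)
  with e z0 show "stereo (antipode_cnj x) = inverse (stereo x)" "stereo x \<noteq> 0"
    unfolding stereo_def antipode_cnj_def zt fst_conv snd_conv minus_minus diff_minus_eq_add
    by (simp_all add: divide_simps mult.commute del: of_real_add of_real_diff)
qed

lemma second_countable_euclidean:
  "second_countable (euclidean :: 'a :: second_countable_topology topology)"
proof -
  obtain \<B> :: "'a set set" where B: "countable \<B>" "topological_basis \<B>"
    using ex_countable_basis by blast
  have "\<exists>V\<in>\<B>. x \<in> V \<and> V \<subseteq> U" if "open U" "x \<in> U" for U x
    using topological_basisE [OF B(2) that] by metis
  then show ?thesis
    unfolding second_countable_def using B topological_basis_open by (intro exI [of _ \<B>]) auto
qed

lemma closed_orientable_surface_unit_sphere: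
  "closed_orientable_surface (top_of_set (sphere (0 :: complex \<times> real) 1))"
proof -
  let ?S = "sphere (0 :: complex \<times> real) 1"
  let ?N = "?S - {(0, 1)}" and ?P = "?S - {(0, -1)}"
  let ?A = "{(?N, stereo), (?P, stereo \<circ> antipode_cnj)}"
  have oN: "openin (top_of_set ?S) ?N" and oP: "openin (top_of_set ?S) ?P"
    by (auto simp: openin_delete)
  have "homeomorphism ?P ?N antipode_cnj antipode_cnj"
    by (rule homeomorphismI) (auto simp: antipode_cnj_def norm_Pair intro!: continuous_intros)
  then have hP: "homeomorphism ?P UNIV (stereo \<circ> antipode_cnj) (antipode_cnj \<circ> stereo_inv)"
    using stereo_homeomorphism homeomorphism_compose by blast
  have charts: "surface_chart (top_of_set ?S) ?N stereo" "surface_chart (top_of_set ?S) ?P (stereo \<circ> antipode_cnj)"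
    using surface_chart_top_of_set [OF stereo_homeomorphism open_UNIV oN]
      surface_chart_top_of_set [OF hP open_UNIV oP] by simp_all
  have cover: "(\<Union>(U, \<phi>) \<in> ?A. U) = topspace (top_of_set ?S)" by auto
  have injN: "inj_on stereo ?N" and injP: "inj_on (stereo \<circ> antipode_cnj) ?P"
    using homeomorphism_apply1 [OF stereo_homeomorphism] homeomorphism_apply1 [OF hP]
    by (blast intro: inj_on_inverseI)+
  \<comment> \<open>An atlas also compares each chart with itself, where the transition is the
    identity on the image of the chart.\<close>
  have id: "orientation_preserving_on W (\<phi> \<circ> inv_into U \<phi>)" if "W \<subseteq> \<phi> ` U" for W and U :: "(complex \<times> real) set" and \<phi>
  proof -
    have "orientation_preserving_on W (\<lambda>w. w)"
      unfolding orientation_preserving_on_def by (simp add: o_def winding_number_circlepath_centre)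
    moreover have "w = (\<phi> \<circ> inv_into U \<phi>) w" if "w \<in> W" for w
      using f_inv_into_f [of w \<phi> U] that \<open>W \<subseteq> \<phi> ` U\<close> by (metis comp_apply subsetD)
    ultimately show ?thesis
      using orientation_preserving_on_cong [of W "\<lambda>w. w" "\<phi> \<circ> inv_into U \<phi>"] by blast
  qed
  have inv: "orientation_preserving_on W inverse" if "0 \<notin> W" for W
    unfolding orientation_preserving_on_def using that winding_number_inverse_circlepath by blast
  have NP: "orientation_preserving_on (stereo ` (?N \<inter> ?P)) ((stereo \<circ> antipode_cnj) \<circ> inv_into ?N stereo)"
  proof (rule orientation_preserving_on_cong [of _ inverse, THEN iffD1])
    show "orientation_preserving_on (stereo ` (?N \<inter> ?P)) inverse"
    proof (rule inv)
      show "0 \<notin> stereo ` (?N \<inter> ?P)" 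
      proof
        assume "0 \<in> stereo ` (?N \<inter> ?P)"
        then show False
        proof (rule imageE)
          fix x assume "0 = stereo x" "x \<in> ?N \<inter> ?P"
          then show False using stereo_antipode_cnj(2) [of x] by simp
        qed
      qed
    qed
    fix w assume "w \<in> stereo ` (?N \<inter> ?P)"
    then obtain x where x: "x \<in> ?N" "x \<in> ?P" "w = stereo x" by blast
    then show "inverse w = ((stereo \<circ> antipode_cnj) \<circ> inv_into ?N stereo) w"
      using stereo_antipode_cnj(1) [of x] inv_into_f_f [OF injN x(1)] by auto
  qed
  have PN: "orientation_preserving_on ((stereo \<circ> antipode_cnj) ` (?P \<inter> ?N)) (stereo \<circ> inv_into ?P (stereo \<circ> antipode_cnj))"
  proof (rule orientation_preserving_on_cong [of _ inverse, THEN iffD1])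
    show "orientation_preserving_on ((stereo \<circ> antipode_cnj) ` (?P \<inter> ?N)) inverse"
    proof (rule inv)
      show "0 \<notin> (stereo \<circ> antipode_cnj) ` (?P \<inter> ?N)" 
      proof
        assume "0 \<in> (stereo \<circ> antipode_cnj) ` (?P \<inter> ?N)"
        then show False
        proof (rule imageE)
          fix x assume "0 = (stereo \<circ> antipode_cnj) x" "x \<in> ?P \<inter> ?N"
          then show False using stereo_antipode_cnj [of x] by simp
        qed
      qed
    qed
    fix w assume "w \<in> (stereo \<circ> antipode_cnj) ` (?P \<inter> ?N)"
    then obtain x where x: "x \<in> ?N" "x \<in> ?P" "w = (stereo \<circ> antipode_cnj) x" by blast
    then show "inverse w = (stereo \<circ> inv_into ?P (stereo \<circ> antipode_cnj)) w"
      using stereo_antipode_cnj(1) [of x] inv_into_f_f [OF injP x(2)] by auto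
  qed
  have "oriented_atlas (top_of_set ?S) ?A"
    unfolding oriented_atlas_def using charts cover NP PN
    by (simp add: id)
  moreover have "connected ?S" by (rule connected_sphere) simp
  moreover have "second_countable (top_of_set ?S)"
    by (rule second_countable_subtopology [OF second_countable_euclidean])
  moreover have "Hausdorff_space (top_of_set ?S)"
    by (simp add: Hausdorff_space_subtopology)
  moreover have "(0, 1) \<in> ?S" by simp
  ultimately show ?thesis
    unfolding closed_orientable_surface_def
    by (auto simp: connected_space_subtopology compact_space_subtopology)
qed

lemma closed_orientable_surface_if_S2:
  "E homeomorphic_space S2 \<Longrightarrow> closed_orientable_surface E"
  by (meson S2_homeomorphic_sphere closed_orientable_surface_homeomorphic
      closed_orientable_surface_unit_sphere homeomorphic_space_trans)

section \<open>The Euler characteristic of the sphere\<close>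

lemma int_independentD:
  "int_independent G B \<Longrightarrow> finprod G (\<lambda>b. b [^]\<^bsub>G\<^esub> (c b :: int)) B = \<one>\<^bsub>G\<^esub> \<Longrightarrow> b \<in> B \<Longrightarrow> c b = 0"
  by (simp add: int_independent_def)

text \<open>Two distinct elements \<open>a\<close>, \<open>b\<close> satisfy the relation with
  exponents \<open>h b\<close> and \<open>- h a\<close>. Independence makes both exponents zero, and
  then \<open>a\<close> and \<open>b\<close> have the same image under the injective
  \<open>h\<close>.\<close>

lemma int_independent_card_le_1:
  assumes G: "comm_group G" and h: "h \<in> iso G integer_group" and B: "int_independent G B"
  shows "card B \<le> 1"
proof (rule ccontr)
  interpret comm_group G by fact
  assume "\<not> card B \<le> 1"
  then obtain a b where ab: "a \<in> B" "b \<in> B" "a \<noteq> b"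
    by (metis B card_le_Suc0_iff_eq One_nat_def int_independent_def)
  have B': "finite B" "B \<subseteq> carrier G" using B by (auto simp: int_independent_def)
  have hom: "h \<in> hom G integer_group" and inj: "inj_on h (carrier G)"
    using h by (auto simp: iso_def bij_betw_def)
  interpret gh: group_hom G integer_group h
    by (simp add: group_hom_def group_hom_axioms_def hom is_group)
  have hpow: "h (x [^]\<^bsub>G\<^esub> (n::int)) = n * h x" if "x \<in> carrier G" for x n
    using gh.hom_int_pow [OF that] by simp
  define c where "c x = (if x = a then h b else if x = b then - h a else 0)" for x
  have car: "a \<in> carrier G" "b \<in> carrier G" using ab B' by auto
  have "finprod G (\<lambda>x. x [^]\<^bsub>G\<^esub> c x) B = finprod G (\<lambda>x. x [^]\<^bsub>G\<^esub> c x) {a, b}"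
    by (rule finprod_mono_neutral_cong_right) (use ab B' in \<open>auto simp: c_def\<close>)
  also have "\<dots> = a [^]\<^bsub>G\<^esub> h b \<otimes>\<^bsub>G\<^esub> b [^]\<^bsub>G\<^esub> (- h a)"
    using car ab by (simp add: c_def)
  also have "\<dots> = \<one>\<^bsub>G\<^esub>"
  proof (rule inj_onD [OF inj])
    show "h (a [^]\<^bsub>G\<^esub> h b \<otimes>\<^bsub>G\<^esub> b [^]\<^bsub>G\<^esub> (- h a)) = h \<one>\<^bsub>G\<^esub>"
      using car by (simp add: hpow del: int_pow_neg)
  qed (use car in auto)
  finally have "\<forall>x\<in>B. c x = 0"
    using B by (simp add: int_independent_def)
  then have "h a = 0" "h b = 0" using ab unfolding c_def by fastforce+
  then show False using inj_onD [OF inj] car ab by auto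
qed

lemma abelian_rank_iso_integer_group:
  assumes G: "comm_group G" and iso: "G \<cong> integer_group"
  shows "abelian_rank G = 1"
proof -
  interpret comm_group G by fact
  obtain h where h: "h \<in> iso G integer_group" using iso by (auto simp: is_iso_def)
  then have hom: "h \<in> hom G integer_group" and bij: "bij_betw h (carrier G) UNIV"
    by (auto simp: iso_def)
  interpret gh: group_hom G integer_group h
    by (simp add: group_hom_def group_hom_axioms_def hom is_group)
  obtain g where g: "g \<in> carrier G" "h g = 1"
    using bij by (metis UNIV_I bij_betw_iff_bijections)
  have "c g = 0" if "g [^]\<^bsub>G\<^esub> c g = \<one>\<^bsub>G\<^esub>" for c :: "'a \<Rightarrow> int"
    using gh.hom_int_pow [OF g(1), of "c g"] that g by simp
  then have "int_independent G {g}"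
    using g by (simp add: int_independent_def)
  then show ?thesis
    unfolding abelian_rank_def
    by (intro Greatest_equality) (use int_independent_card_le_1 [OF G h] in \<open>auto intro!: exI [of _ "{g}"]\<close>)
qed

text \<open>The identity alone is already dependent, its first power being trivial. So only the
  empty set is independent.\<close>

lemma abelian_rank_trivial_group:
  assumes "trivial_group G"
  shows "abelian_rank G = 0"
proof -
  have G: "group G" "carrier G = {\<one>\<^bsub>G\<^esub>}" using assms by (auto simp: trivial_group_def)
  then interpret group G by simp
  have "B = {}" if "int_independent G B" for B
  proof -
    have B: "B \<subseteq> {\<one>\<^bsub>G\<^esub>}" using that G by (simp add: int_independent_def)
    have "\<one>\<^bsub>G\<^esub> \<notin> B"
    proof
      assume "\<one>\<^bsub>G\<^esub> \<in> B"
      then have B1: "B = {\<one>\<^bsub>G\<^esub>}" using B by auto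
      have "comm_group G"
        by (rule group_comm_groupI) (simp add: G(2))
      then interpret comm_group G .
      show False
      proof -
        have "finprod G (\<lambda>b. b [^]\<^bsub>G\<^esub> (1 :: int)) B = \<one>\<^bsub>G\<^esub>" unfolding B1 by simp
        then have "(1 :: int) = 0"
          by (rule int_independentD [OF that, of "\<lambda>_. 1"]) fact
        then show False by simp
      qed
    qed
    with B show ?thesis by auto
  qed
  then show ?thesis
    unfolding abelian_rank_def
    by (intro Greatest_equality exI [of _ "{}"]) (simp_all add: int_independent_def, metis card.empty le_refl)
qed

lemma euler_char_sphere:
  assumes "E homeomorphic_space S2"
  shows "euler_char E = 2"
proof -
  have hom: "homology_group p E \<cong> homology_group p S2" for p
    by (rule homeomorphic_space_imp_isomorphic_homology_groups [OF assms])
  have pc: "path_connected_space S2"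
    using homeomorphic_path_connected_space [OF S2_homeomorphic_sphere] path_connected_sphere [of "0 :: complex \<times> real" 1]
    by (simp add: path_connected_space_euclidean_subtopology)
  have "homology_group 0 S2 \<cong> integer_group"
    using pc by (intro isomorphic_integer_zeroth_homology_group) auto
  then have 0: "betti 0 E = 1"
    unfolding betti_def
    using hom [of 0] by (intro abelian_rank_iso_integer_group abelian_homology_group) (auto intro: iso_trans)
  have "homology_group 2 S2 \<cong> integer_group"
    using reduced_homology_group_nsphere(1) [of 2] by (simp add: un_reduced_homology_group)
  then have 2: "betti 2 E = 1"
    unfolding betti_def
    using hom [of 2] by (intro abelian_rank_iso_integer_group abelian_homology_group) (auto intro: iso_trans)
  have n: "betti i E = 0" if "i \<noteq> 0" "i \<noteq> 2" for i
  proof -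
    have "trivial_group (homology_group (int i) S2)"
      using reduced_homology_group_nsphere(2) [of "int i" 2] that by (simp add: un_reduced_homology_group)
    then have "trivial_group (homology_group (int i) E)"
      using hom [of "int i"] by (metis group_relative_homology_group isomorphic_group_triviality)
    then show ?thesis unfolding betti_def by (rule abelian_rank_trivial_group)
  qed
  have "betti i E \<noteq> 0 \<longleftrightarrow> i = 0 \<or> i = 2" for i
    using 0 2 n by (cases "i = 0"; cases "i = 2") simp_all
  then have "{i. betti i E \<noteq> 0} = {0, 2}" by (simp add: set_eq_iff)
  then show ?thesis unfolding euler_char_def using 0 2 by simp
qed

section \<open>Ideals of the Gaussian integers\<close>

text \<open>Elements of \<open>int \<times> int\<close> are Gaussian integers; \<open>gauss_rot\<close> is multiplication by \<open>\<i>\<close>.\<close>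

definition gauss_rot :: "int \<times> int \<Rightarrow> int \<times> int" where
  "gauss_rot p = (- snd p, fst p)"

text \<open>The principal ideal of \<open>x + y \<i>\<close>: the pairs are the products
  \<open>(m + n \<i>) * (x + y \<i>)\<close>.\<close>

definition gauss_ideal :: "int \<Rightarrow> int \<Rightarrow> (int \<times> int) set" where
  "gauss_ideal x y = {(m * x - n * y, m * y + n * x) | m n. True}"

definition lattice :: "(int \<times> int) set \<Rightarrow> bool" where
  "lattice L \<longleftrightarrow> 0 \<in> L \<and> (\<forall>p\<in>L. \<forall>q\<in>L. p - q \<in> L)"

lemma lattice_uminus: "lattice L \<Longrightarrow> p \<in> L \<Longrightarrow> - p \<in> L"
  unfolding lattice_def by (metis diff_0)

lemma lattice_diff: "lattice L \<Longrightarrow> p \<in> L \<Longrightarrow> q \<in> L \<Longrightarrow> p - q \<in> L"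
  unfolding lattice_def by blast

lemma lattice_add: "lattice L \<Longrightarrow> p \<in> L \<Longrightarrow> q \<in> L \<Longrightarrow> p + q \<in> L"
  using lattice_diff [of L p "- q"] lattice_uminus by simp

lemma lattice_mult:
  assumes L: "lattice L" and p: "p \<in> L"
  shows "(k * fst p, k * snd p) \<in> L"
proof -
  have nat: "(int n * fst p, int n * snd p) \<in> L" for n
  proof (induction n)
    case 0 then show ?case using L by (simp add: lattice_def zero_prod_def)
  next
    case (Suc n)
    have "(int (Suc n) * fst p, int (Suc n) * snd p) = p + (int n * fst p, int n * snd p)"
      by (cases p) (simp add: algebra_simps)
    then show ?case using lattice_add [OF L p Suc] by simp
  qed
  show ?thesis
  proof (cases "k \<ge> 0")
    case True
    then show ?thesis using nat [of "nat k"] by simp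
  next
    case False
    then show ?thesis using lattice_uminus [OF L nat [of "nat (- k)"]] by simp
  qed
qed

lemma gauss_ideal_eq: "q \<in> gauss_ideal x y \<longleftrightarrow> (\<exists>m n. q = (m * x - n * y, m * y + n * x))"
  by (auto simp: gauss_ideal_def)

lemma lattice_gauss_ideal: "lattice (gauss_ideal x y)"
  unfolding lattice_def
proof (intro conjI ballI)
  show "0 \<in> gauss_ideal x y" unfolding gauss_ideal_eq by (intro exI [of _ 0]) (simp add: zero_prod_def)
  fix p q assume "p \<in> gauss_ideal x y" "q \<in> gauss_ideal x y"
  then obtain m n m' n' where "p = (m * x - n * y, m * y + n * x)" "q = (m' * x - n' * y, m' * y + n' * x)"
    unfolding gauss_ideal_eq by blast
  then show "p - q \<in> gauss_ideal x y"
    unfolding gauss_ideal_eq by (rule_tac exI [of _ "m - m'"], rule_tac exI [of _ "n - n'"]) (simp add: algebra_simps)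
qed

text \<open>The Hermite normal form: a basis \<open>(a, 0), (b, c)\<close> of the lattice.\<close>

lemma lattice_normal_form:
  assumes L: "lattice L" and m: "(m, 0) \<in> L" "m > 0" and n: "(n', n) \<in> L" "n > 0"
  obtains a b c :: int where "a > 0" "c > 0" "\<And>p. p \<in> L \<longleftrightarrow> (\<exists>s t. p = (s * a + t * b, t * c))"
proof -
  define A where "A = {k :: nat. k > 0 \<and> (int k, 0) \<in> L}"
  define C where "C = {k :: nat. k > 0 \<and> (\<exists>l. (l, int k) \<in> L)}"
  have "nat m \<in> A" "nat n \<in> C" using m n by (auto simp: A_def C_def)
  define a where "a = (LEAST k. k \<in> A)"
  define c where "c = (LEAST k. k \<in> C)"
  have aA: "a \<in> A" unfolding a_def by (rule LeastI) (rule \<open>nat m \<in> A\<close>)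
  have cC: "c \<in> C" unfolding c_def by (rule LeastI) (rule \<open>nat n \<in> C\<close>)
  obtain b where b: "(b, int c) \<in> L" using cC by (auto simp: C_def)
  have a0: "a > 0" "(int a, 0) \<in> L" and c0: "c > 0" using aA cC by (auto simp: A_def C_def)
  have amin: "a dvd k" if k: "(int k, 0) \<in> L" for k
  proof -
    have "(int k, 0) - (int (k div a) * int a, 0) \<in> L"
      using lattice_mult [OF L a0(2), of "int (k div a)"] by (intro lattice_diff [OF L k]) simp
    moreover have "int k - int (k div a) * int a = int (k mod a)"
      by (metis add_diff_cancel_left' div_mult_mod_eq of_nat_add of_nat_mult)
    ultimately have "(int (k mod a), 0) \<in> L" by simp
    then have "k mod a = 0"
      using not_less_Least [of "k mod a" "\<lambda>k. k \<in> A"] mod_less_divisor [OF a0(1), of k] unfolding a_def [symmetric]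
      by (auto simp: A_def)
    then show ?thesis by auto
  qed
  have cmin: "int c dvd k" if k: "(l, k) \<in> L" for k l
  proof -
    define r where "r = k mod int c"
    have r: "0 \<le> r" "r < int c" using c0 by (auto simp: r_def)
    have "(l, k) - ((k div int c) * b, (k div int c) * int c) \<in> L"
      using lattice_mult [OF L b, of "k div int c"] by (intro lattice_diff [OF L k]) simp
    moreover have "k - (k div int c) * int c = r" unfolding r_def
      by (metis add_diff_cancel_left' div_mult_mod_eq)
    ultimately have "(l - (k div int c) * b, int (nat r)) \<in> L" using r by simp
    moreover have "nat r < c" using r by linarith
    ultimately have "\<not> nat r > 0"
      using not_less_Least [of "nat r" "\<lambda>k. k \<in> C"] r unfolding c_def [symmetric] by (auto simp: C_def)
    then have "r = 0" using r by simp
    then show ?thesis by (auto simp: r_def)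
  qed
  have amin': "int a dvd k" if k: "(k, 0) \<in> L" for k
  proof (cases "k \<ge> 0")
    case True
    then show ?thesis using amin [of "nat k"] k by (metis int_dvd_int_iff nat_0_le)
  next
    case False
    then have "(int (nat (- k)), 0) \<in> L" using lattice_uminus [OF L k] by simp
    then have "int a dvd - k" using amin [of "nat (- k)"] False by (metis int_dvd_int_iff nat_0_le neg_0_le_iff_le linear)
    then show ?thesis by simp
  qed
  have "p \<in> L \<longleftrightarrow> (\<exists>s t. p = (s * int a + t * b, t * int c))" for p
  proof
    assume p: "p \<in> L"
    then obtain t where t: "snd p = int c * t" using cmin [of "fst p" "snd p"] by auto
    have "p - (t * b, t * int c) \<in> L"
      using lattice_mult [OF L b, of t] by (intro lattice_diff [OF L p]) simp
    then have "(fst p - t * b, 0) \<in> L" using t by (cases p) (simp add: mult.commute)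
    then obtain s where "fst p - t * b = int a * s" using amin' by blast
    with t have "p = (s * int a + t * b, t * int c)" by (cases p) (simp add: algebra_simps)
    then show "\<exists>s t. p = (s * int a + t * b, t * int c)" by blast
  next
    assume "\<exists>s t. p = (s * int a + t * b, t * int c)"
    then obtain s t where p: "p = (s * int a, 0) + (t * b, t * int c)" by auto
    show "p \<in> L"
      unfolding p using lattice_mult [OF L a0(2), of s] lattice_mult [OF L b, of t]
      by (intro lattice_add [OF L]) simp_all
  qed
  then show ?thesis using a0 c0 that [of "int a" "int c" b] by simp
qed

text \<open>The function \<open>f\<close> stands for any realization of the quotient by
  \<open>L\<close>; below it is the orbit of a point under translations, or a set of points of a
  torus. Every coset meets the box \<open>{0..<a} \<times> {0..<c}\<close> exactly once.\<close>

lemma card_lattice_cosets: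
  fixes a b c :: int and f :: "int \<times> int \<Rightarrow> 'f"
  assumes ac: "a > 0" "c > 0" and L: "\<And>p. p \<in> L \<longleftrightarrow> (\<exists>s t. p = (s * a + t * b, t * c))"
    and f: "\<And>p q. f p = f q \<longleftrightarrow> p - q \<in> L"
  shows "finite (range f)" "int (card (range f)) = a * c"
proof -
  let ?R = "{0..<a} \<times> {0..<c}"
  have inj: "inj_on f ?R"
  proof (intro inj_onI)
    fix p q assume pq: "p \<in> ?R" "q \<in> ?R" "f p = f q"
    then obtain s t where st: "fst p - fst q = s * a + t * b" "snd p - snd q = t * c"
      using f L by (metis fst_conv fst_diff snd_conv snd_diff)
    have "\<bar>t * c\<bar> < c" using pq st(2) [symmetric] by (auto simp: mem_Times_iff)
    then have "t = 0" using ac by (auto simp: abs_mult)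
    moreover have "\<bar>s * a\<bar> < a" using pq st(1) [symmetric] calculation by (auto simp: mem_Times_iff)
    then have "s = 0" using ac by (auto simp: abs_mult)
    ultimately show "p = q" using st by (simp add: prod_eq_iff)
  qed
  have "range f = f ` ?R"
  proof (intro equalityI subsetI)
    fix y assume "y \<in> range f"
    then obtain p where y: "y = f p" by auto
    \<comment> \<open>The second coordinate is reduced first, by a multiple of
      \<open>(b, c)\<close>; a multiple of \<open>(a, 0)\<close> then corrects the first one without
      disturbing it.\<close>
    define t where "t = snd p div c"
    define u where "u = fst p - t * b"
    define q where "q = (u mod a, snd p mod c)"
    have "p - q = ((u div a) * a + t * b, t * c)"
      unfolding q_def u_def t_def by (cases p) (simp add: minus_mod_eq_div_mult [symmetric])
    then have "f p = f q" using f L by blast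
    moreover have "q \<in> ?R" using ac by (simp add: q_def)
    ultimately show "y \<in> f ` ?R" using y by auto
  qed auto
  then show "finite (range f)" "int (card (range f)) = a * c"
    using card_image [OF inj] ac by (simp_all add: card_cartesian_product)
qed

text \<open>Both sides are determinants of bases of one lattice, \<open>(a, 0), (b, c)\<close> and
  \<open>(x, y), (- y, x)\<close>. Expressing each basis in the other shows that the determinants
  divide each other, and both are nonnegative.\<close>

lemma gauss_ideal_determinant:
  assumes ac: "a > 0" "c > 0" and L: "\<And>p. p \<in> gauss_ideal x y \<longleftrightarrow> (\<exists>s t. p = (s * a + t * b, t * c))"
  shows "a * c = x\<^sup>2 + y\<^sup>2"
proof -
  have "(a, 0) \<in> gauss_ideal x y" "(b, c) \<in> gauss_ideal x y"
    unfolding L by (rule exI [of _ 1], rule exI [of _ 0], simp) (rule exI [of _ 0], rule exI [of _ 1], simp)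
  then obtain m n m' n' where 1: "a = m * x - n * y" "0 = m * y + n * x" "b = m' * x - n' * y" "c = m' * y + n' * x"
    unfolding gauss_ideal_eq by auto
  have "a * c - 0 * b = (m * n' - n * m') * (x\<^sup>2 + y\<^sup>2)"
    by (subst 1(2), subst 1(1), subst 1(3), subst 1(4)) (simp add: algebra_simps power2_eq_square)
  then have d1: "x\<^sup>2 + y\<^sup>2 dvd a * c" by simp
  have "(x, y) \<in> gauss_ideal x y" "(- y, x) \<in> gauss_ideal x y"
    unfolding gauss_ideal_eq by (rule exI [of _ 1], rule exI [of _ 0], simp) (rule exI [of _ 0], rule exI [of _ 1], simp)
  then obtain s t s' t' where 2: "x = s * a + t * b" "y = t * c" "- y = s' * a + t' * b" "x = t' * c"
    unfolding L prod.inject by blast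
  have "x\<^sup>2 + y\<^sup>2 = x * x - (- y) * y" by (simp add: power2_eq_square)
  also have "\<dots> = (s * a + t * b) * (t' * c) - (s' * a + t' * b) * (t * c)"
    using 2 by metis
  also have "\<dots> = (s * t' - t * s') * (a * c)" by (simp add: algebra_simps)
  finally have d2: "a * c dvd x\<^sup>2 + y\<^sup>2" by simp
  show ?thesis using d1 d2 ac zdvd_antisym_nonneg by (metis mult_nonneg_nonneg order_less_imp_le sum_power2_ge_zero)
qed

text \<open>The norm \<open>N = x^2 + y^2\<close> and its multiple \<open>N \<i>\<close> lie in the
  ideal because \<open>N = (x - y \<i>) * (x + y \<i>)\<close>. So the ideal has full rank and a
  normal form.\<close>

theorem card_gauss_ideal_cosets:
  fixes f :: "int \<times> int \<Rightarrow> 'f"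
  assumes xy: "(x, y) \<noteq> (0, 0)" and f: "\<And>p q. f p = f q \<longleftrightarrow> p - q \<in> gauss_ideal x y"
  shows "finite (range f)" "int (card (range f)) = x\<^sup>2 + y\<^sup>2"
proof -
  have N: "x\<^sup>2 + y\<^sup>2 > 0" using xy by (simp add: sum_power2_gt_zero_iff)
  have "(x\<^sup>2 + y\<^sup>2, 0) \<in> gauss_ideal x y" "(0, x\<^sup>2 + y\<^sup>2) \<in> gauss_ideal x y"
    unfolding gauss_ideal_eq
    by (rule exI [of _ x], rule exI [of _ "- y"], simp add: power2_eq_square)
      (rule exI [of _ y], rule exI [of _ x], simp add: power2_eq_square)
  from lattice_normal_form [OF lattice_gauss_ideal this(1) N this(2) N] obtain a b c
    where abc: "a > 0" "c > 0" "\<And>p. p \<in> gauss_ideal x y \<longleftrightarrow> (\<exists>s t. p = (s * a + t * b, t * c))" by metis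
  show "finite (range f)" "int (card (range f)) = x\<^sup>2 + y\<^sup>2"
    using card_lattice_cosets [OF abc f] gauss_ideal_determinant [OF abc] by simp_all
qed

text \<open>Invariance under multiplication by \<open>\<i>\<close> makes \<open>L\<close> an ideal,
  and Euclidean division applies: a nonzero element of least norm divides all others, since rounding
  leaves a remainder of at most half its norm.\<close>

lemma rotation_invariant_lattice_principal:
  assumes L: "lattice L" and J: "\<And>p. p \<in> L \<Longrightarrow> gauss_rot p \<in> L" and p0: "p0 \<in> L" "p0 \<noteq> 0"
  obtains x y where "(x, y) \<noteq> (0, 0)" "L = gauss_ideal x y"
proof -
  define N where "N p = nat ((fst p)\<^sup>2 + (snd p)\<^sup>2)" for p :: "int \<times> int"
  have "\<exists>p. p \<in> L \<and> p \<noteq> 0" using p0 by blast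
  then obtain l where l: "l \<in> L" "l \<noteq> 0" and min: "\<And>p. p \<in> L \<Longrightarrow> p \<noteq> 0 \<Longrightarrow> N l \<le> N p"
    using ex_has_least_nat [of "\<lambda>p. p \<in> L \<and> p \<noteq> 0" p0 N] p0 by blast
  obtain x y where xy: "l = (x, y)" by (cases l)
  have xy0: "(x, y) \<noteq> (0, 0)" using l xy by (simp add: zero_prod_def)
  define D where "D = x\<^sup>2 + y\<^sup>2"
  have D: "D > 0" using xy0 by (simp add: D_def sum_power2_gt_zero_iff)
  have sub: "gauss_ideal x y \<subseteq> L"
  proof
    fix p assume "p \<in> gauss_ideal x y"
    then obtain m n where "p = (m * x, m * y) + (n * (- y), n * x)" by (auto simp: gauss_ideal_eq)
    then show "p \<in> L"
      using lattice_add [OF L, of "(m * x, m * y)" "(n * (- y), n * x)"]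
        lattice_mult [OF L l(1), of m] lattice_mult [OF L J [OF l(1)], of n]
      by (simp add: xy gauss_rot_def)
  qed
  have "p \<in> gauss_ideal x y" if p: "p \<in> L" for p
  proof -
    obtain u v where uv: "p = (u, v)" by (cases p)
    \<comment> \<open>the coordinates of \<open>p\<close> in the basis \<open>l, \<i> l\<close> are \<open>A / D\<close> and \<open>B / D\<close>; round them\<close>
    define A where "A = u * x + v * y"
    define B where "B = v * x - u * y"
    define m where "m = (2 * A + D) div (2 * D)"
    define n where "n = (2 * B + D) div (2 * D)"
    have round: "\<bar>2 * (A - ((2 * A + D) div (2 * D)) * D)\<bar> \<le> D" for A
    proof -
      have "2 * A + D = ((2 * A + D) div (2 * D)) * (2 * D) + (2 * A + D) mod (2 * D)"
        by (rule div_mult_mod_eq [symmetric])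
      moreover have "0 \<le> (2 * A + D) mod (2 * D)" "(2 * A + D) mod (2 * D) < 2 * D" using D by simp_all
      ultimately show ?thesis by (simp add: abs_le_iff algebra_simps)
    qed
    define q where "q = p - (m * x - n * y, m * y + n * x)"
    have mn: "(m * x - n * y, m * y + n * x) \<in> gauss_ideal x y" by (auto simp: gauss_ideal_eq)
    then have qL: "q \<in> L" unfolding q_def using sub lattice_diff [OF L p] by blast
    have "q = 0"
    proof (rule ccontr)
      assume "q \<noteq> 0"
      then have "N l \<le> N q" by (rule min [OF qL])
      then have ge: "D \<le> (fst q)\<^sup>2 + (snd q)\<^sup>2" by (simp add: N_def xy D_def nat_le_eq_zle sum_power2_ge_zero)
      \<comment> \<open>Multiplicativity of the norm: the right side is the norm of \<open>q\<close>
        times the conjugate of \<open>l\<close>.\<close>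
      have "D * ((fst q)\<^sup>2 + (snd q)\<^sup>2) = (A - m * D)\<^sup>2 + (B - n * D)\<^sup>2"
        unfolding q_def uv A_def B_def D_def by (simp add: algebra_simps power2_eq_square)
      moreover have "(2 * (A - m * D))\<^sup>2 \<le> D\<^sup>2" "(2 * (B - n * D))\<^sup>2 \<le> D\<^sup>2"
        using round [of A] round [of B] D unfolding m_def n_def by (metis abs_le_square_iff abs_of_pos)+
      ultimately have "2 * (D * ((fst q)\<^sup>2 + (snd q)\<^sup>2)) \<le> D * D"
        by (simp add: power2_eq_square algebra_simps)
      then have "2 * ((fst q)\<^sup>2 + (snd q)\<^sup>2) \<le> D"
        using D by (metis mult.left_commute mult_le_cancel_left_pos)
      moreover obtain S where "S = (fst q)\<^sup>2 + (snd q)\<^sup>2" by blast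
      ultimately show False using ge D by simp
    qed
    then show ?thesis using mn by (simp add: q_def)
  qed
  with sub have "L = gauss_ideal x y" by blast
  with xy0 show ?thesis by (rule that)
qed

section \<open>Integer powers of bijections and finite actions of the triangle group\<close>

definition zpow :: "('f \<Rightarrow> 'f) \<Rightarrow> ('f \<Rightarrow> 'f) \<Rightarrow> int \<Rightarrow> 'f \<Rightarrow> 'f" where
  "zpow u u' k = (if k \<ge> 0 then u ^^ nat k else u' ^^ nat (- k))"

lemma zpow_0: "zpow u u' 0 x = x"
  by (simp add: zpow_def)

lemma zpow_plus1:
  assumes "\<And>x. u (u' x) = x"
  shows "zpow u u' (k + 1) x = u (zpow u u' k x)"
proof (cases "k \<ge> 0")
  case True
  then show ?thesis by (simp add: zpow_def nat_add_distrib)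
next
  case False
  then obtain m where m: "nat (- k) = Suc m" by (cases "nat (- k)") auto
  then have "nat (- (k + 1)) = m" "k + 1 \<ge> 0 \<longleftrightarrow> m = 0" using False by linarith+
  then show ?thesis using False m assms by (cases "m = 0") (simp_all add: zpow_def)
qed

lemma zpow_minus1:
  assumes "\<And>x. u (u' x) = x" "\<And>x. u' (u x) = x"
  shows "zpow u u' (k - 1) x = u' (zpow u u' k x)"
  using zpow_plus1 [of u u' "k - 1" x] assms by simp

lemma zpow_add:
  assumes "\<And>x. u (u' x) = x" "\<And>x. u' (u x) = x"
  shows "zpow u u' (j + k) x = zpow u u' j (zpow u u' k x)"
proof (induction j rule: int_induct [where k = 0])
  case base then show ?case by (simp add: zpow_0)
next
  case (step1 i)
  have "zpow u u' (i + 1 + k) x = zpow u u' ((i + k) + 1) x" by (simp add: algebra_simps)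
  then show ?case using step1 zpow_plus1 [of u u'] assms by metis
next
  case (step2 i)
  have "zpow u u' (i - 1 + k) x = zpow u u' ((i + k) - 1) x" by (simp add: algebra_simps)
  then show ?case using step2 zpow_minus1 [of u u'] assms by metis
qed

lemma zpow_uminus: "zpow u' u k x = zpow u u' (- k) x"
  by (cases "k = 0") (auto simp: zpow_def)

text \<open>Negative powers are covered because \<open>\<alpha>\<close> then intertwines the
  inverses as well. With \<open>u = v\<close> this says that a map commuting with \<open>u\<close>
  commutes with its powers.\<close>

lemma zpow_conjugate:
  assumes "\<And>x. u (u' x) = x" "\<And>x. u' (u x) = x" "\<And>x. v (v' x) = x" "\<And>x. v' (v x) = x"
    and a: "\<And>x. \<alpha> (u x) = v (\<alpha> x)"
  shows "\<alpha> (zpow u u' k x) = zpow v v' k (\<alpha> x)"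
proof (induction k rule: int_induct [where k = 0])
  case base then show ?case by (simp add: zpow_0)
next
  case (step1 i)
  then show ?case using zpow_plus1 [of u u'] zpow_plus1 [of v v'] assms by metis
next
  case (step2 i)
  have "\<alpha> (u' y) = v' (\<alpha> y)" for y using assms by metis
  then show ?case using step2 zpow_minus1 [of u u'] zpow_minus1 [of v v'] assms by metis
qed

text \<open>The relations make \<open>u = \<alpha> \<beta>\<^sup>-\<^sup>1\<close> and \<open>v = \<alpha>\<^sup>-\<^sup>1 \<beta>\<close> commute, with \<open>\<alpha> u \<alpha>\<^sup>-\<^sup>1 = v\<close> and
  \<open>\<alpha> v \<alpha>\<^sup>-\<^sup>1 = u\<^sup>-\<^sup>1\<close>: together with \<open>\<alpha>\<close> they generate a quotient of \<open>\<int>[\<i>] \<rtimes> \<langle>\<i>\<rangle>\<close>. As \<open>\<alpha>\<close> fixes \<open>x0\<close>, the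
  translations act transitively, and their stabilizer of \<open>x0\<close> is an ideal of \<open>\<int>[\<i>]\<close>.\<close>

theorem triangle_action_card_sum_two_squares:
  fixes \<alpha> \<beta> :: "'f \<Rightarrow> 'f"
  assumes bij: "bij \<alpha>" "bij \<beta>" and a4: "\<And>x. \<alpha> (\<alpha> (\<alpha> (\<alpha> x))) = x" and b4: "\<And>x. \<beta> (\<beta> (\<beta> (\<beta> x))) = x"
    and ab2: "\<And>x. \<alpha> (\<beta> (\<alpha> (\<beta> x))) = x"
    and F: "finite F" "card F = d" "x0 \<in> F" "\<alpha> x0 = x0"
    and inv: "\<And>x. x \<in> F \<Longrightarrow> \<alpha> x \<in> F" "\<And>x. x \<in> F \<Longrightarrow> \<beta> x \<in> F"
    and trans: "\<And>O'. O' \<subseteq> F \<Longrightarrow> O' \<noteq> {} \<Longrightarrow> (\<And>x. x \<in> O' \<Longrightarrow> \<alpha> x \<in> O') \<Longrightarrow> (\<And>x. x \<in> O' \<Longrightarrow> \<beta> x \<in> O') \<Longrightarrow> O' = F"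
  shows "\<exists>x y :: nat. d = x\<^sup>2 + y\<^sup>2"
proof -
  define a' where "a' x = \<alpha> (\<alpha> (\<alpha> x))" for x
  define b' where "b' x = \<beta> (\<beta> (\<beta> x))" for x
  have aa': "\<alpha> (a' x) = x" "a' (\<alpha> x) = x" and bb': "\<beta> (b' x) = x" "b' (\<beta> x) = x" for x
    by (simp_all add: a'_def b'_def a4 b4)
  have ab': "\<alpha> (\<beta> x) = b' (a' x)" "\<beta> (\<alpha> x) = a' (b' x)" for x
    by (metis ab2 aa' bb')+
  define u where "u x = \<alpha> (b' x)" for x
  define v where "v x = a' (\<beta> x)" for x
  define u' where "u' x = \<beta> (a' x)" for x
  define v' where "v' x = b' (\<alpha> x)" for x
  have uu': "u (u' x) = x" "u' (u x) = x" and vv': "v (v' x) = x" "v' (v x) = x" for x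
    by (simp_all add: u_def u'_def v_def v'_def aa' bb')
  have a'a': "a' (a' x) = \<alpha> (\<alpha> x)" and b'b': "b' (b' x) = \<beta> (\<beta> x)" for x
    by (simp_all add: a'_def b'_def a4 b4)
  \<comment> \<open>Both sides are \<open>\<alpha>^2 \<beta>^2\<close>, because
    \<open>\<beta>^-1 \<alpha>^-1 = \<alpha> \<beta>\<close>,
    \<open>\<beta> \<alpha> = \<alpha>^-1 \<beta>^-1\<close>,
    \<open>\<alpha>^2 = \<alpha>^-2\<close> and \<open>\<beta>^2 = \<beta>^-2\<close>.\<close>
  have uv: "u (v x) = v (u x)" for x
    by (simp add: u_def v_def ab' a'a' b'b' flip: ab'(1))
  have au: "\<alpha> (u x) = v (\<alpha> x)" for x
    by (simp add: u_def v_def ab'(2) a'a')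
  have av: "\<alpha> (v x) = u' (\<alpha> x)" for x
    by (simp add: v_def u'_def aa')
  \<comment> \<open>The translation by the Gaussian integer \<open>p\<close>: \<open>u\<close> plays
    the translation by 1 and \<open>v\<close> the one by \<open>\<i>\<close>.\<close>
  define T where "T p x = zpow u u' (fst p) (zpow v v' (snd p) x)" for p x
  have comm: "zpow u u' j (zpow v v' k x) = zpow v v' k (zpow u u' j x)" for j k x
  proof -
    have "v (zpow u u' j y) = zpow u u' j (v y)" for y
      by (rule zpow_conjugate [of u u' u u' v, OF uu' uu']) (simp add: uv)
    then show ?thesis
      by (intro zpow_conjugate [of v v' v v' "zpow u u' j", OF vv' vv']) simp
  qed
  have Tadd: "T (p + q) x = T p (T q x)" for p q x
    using zpow_add [of u u', OF uu'] zpow_add [of v v', OF vv'] comm by (simp add: T_def)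
  have T0: "T 0 x = x" for x by (simp add: T_def zpow_0)
  have aT: "\<alpha> (T p x) = T (gauss_rot p) (\<alpha> x)" for p x
  proof -
    have "\<alpha> (T p x) = zpow v v' (fst p) (\<alpha> (zpow v v' (snd p) x))"
      unfolding T_def by (rule zpow_conjugate [of u u' v v' \<alpha>, OF uu' vv']) (rule au)
    moreover have "\<alpha> (zpow v v' (snd p) x) = zpow u' u (snd p) (\<alpha> x)"
      by (rule zpow_conjugate [of v v' u' u \<alpha>, OF vv' uu'(2) uu'(1)]) (rule av)
    ultimately show ?thesis by (simp add: zpow_uminus [of u' u] T_def gauss_rot_def comm)
  qed
  define L where "L = {p. T p x0 = x0}"
  define f where "f p = T p x0" for p
  have lat: "lattice L"
    unfolding lattice_def
  proof (intro conjI ballI)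
    show "0 \<in> L" by (simp add: L_def T0)
    fix p q assume "p \<in> L" "q \<in> L"
    then have "T (p - q) (T q x0) = x0" "T q x0 = x0" unfolding L_def Tadd [symmetric] by simp_all
    then show "p - q \<in> L" by (simp add: L_def)
  qed
  have fL: "f p = f q \<longleftrightarrow> p - q \<in> L" for p q
  proof
    assume "f p = f q"
    then have "T (- q) (T p x0) = T (- q) (T q x0)" by (simp add: f_def)
    then show "p - q \<in> L" unfolding L_def Tadd [symmetric] by (simp add: T0)
  next
    assume "p - q \<in> L"
    then have "T q (T (p - q) x0) = T q x0" by (simp add: L_def)
    then show "f p = f q" unfolding f_def Tadd [symmetric] by simp
  qed
  have rot: "gauss_rot p \<in> L" if "p \<in> L" for p
    using that aT [of p x0] F by (simp add: L_def)
  have closed: "u x \<in> F" "u' x \<in> F" "v x \<in> F" "v' x \<in> F" if "x \<in> F" for x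
    using that inv by (simp_all add: u_def u'_def v_def v'_def a'_def b'_def)
  have zF: "zpow w w' k x \<in> F" if "x \<in> F" "\<And>x. x \<in> F \<Longrightarrow> w x \<in> F" "\<And>x. x \<in> F \<Longrightarrow> w' x \<in> F" for w w' k x
  proof -
    have "(g ^^ n) x \<in> F" if "\<And>x. x \<in> F \<Longrightarrow> g x \<in> F" for g and n :: nat
      using that \<open>x \<in> F\<close> by (induction n) auto
    then show ?thesis using that by (simp add: zpow_def)
  qed
  have "f p \<in> F" for p
    unfolding f_def T_def using closed F by (intro zF) auto
  moreover have "\<alpha> (f p) = f (gauss_rot p)" for p
    using aT F by (simp add: f_def)
  \<comment> \<open>As \<open>\<beta> = u^-1 \<alpha>\<close>, it acts on the orbit like the affine
    map \<open>p \<mapsto> \<i> p - 1\<close>. Hence the orbit under translations is closed under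
    both generators and is all of \<open>F\<close>.\<close>
  moreover have "\<beta> (f p) = f ((- 1, 0) + gauss_rot p)" for p
  proof -
    have "\<beta> (f p) = u' (\<alpha> (f p))" by (simp add: u'_def aa')
    moreover have "\<dots> = T (- 1, 0) (T (gauss_rot p) x0)"
      using aT F by (simp add: f_def T_def zpow_def)
    ultimately show ?thesis by (simp add: f_def Tadd)
  qed
  ultimately have ran: "range f = F"
    by (intro trans) auto
  \<comment> \<open>A finite orbit of an infinite group of translations has a nontrivial
    stabilizer.\<close>
  obtain p0 where "p0 \<in> L" "p0 \<noteq> 0"
  proof -
    have "infinite (UNIV :: (int \<times> int) set)" by (simp add: finite_prod)
    then have "\<not> inj f" using ran F finite_imageD by metis
    then obtain p q where "f p = f q" "p \<noteq> q" by (auto simp: inj_def)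
    then show ?thesis using that [of "p - q"] fL by simp
  qed
  then obtain x y where xy: "(x, y) \<noteq> (0, 0)" "L = gauss_ideal x y"
    using rotation_invariant_lattice_principal [OF lat rot] by metis
  have "int (card (range f)) = x\<^sup>2 + y\<^sup>2"
    by (rule card_gauss_ideal_cosets [OF xy(1)]) (simp add: fL xy(2))
  then have "int d = int ((nat \<bar>x\<bar>)\<^sup>2 + (nat \<bar>y\<bar>)\<^sup>2)" using ran F by simp
  then show ?thesis using of_nat_eq_iff by blast
qed

section \<open>Local degrees in charts\<close>

lemma surface_chart_subset: "surface_chart X U \<phi> \<Longrightarrow> U \<subseteq> topspace X"
  unfolding surface_chart_def using openin_subset by blast

lemma surface_chart_inj_on:
  assumes "surface_chart X U \<phi>" shows "inj_on \<phi> U"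
proof -
  have "inj_on \<phi> (topspace (subtopology X U))"
    using assms homeomorphic_imp_injective_map unfolding surface_chart_def by blast
  then show ?thesis using surface_chart_subset [OF assms] by (simp add: inf_absorb2)
qed

lemma surface_chart_open_preimage:
  assumes c: "surface_chart X U \<phi>" and T: "open T"
  shows "openin X {u \<in> U. \<phi> u \<in> T}"
proof -
  have U: "openin X U" using c by (simp add: surface_chart_def)
  have "continuous_map (subtopology X U) (top_of_set (\<phi> ` U)) \<phi>"
    using c homeomorphic_imp_continuous_map unfolding surface_chart_def by blast
  then have "continuous_map (subtopology X U) euclidean \<phi>"
    by (simp add: continuous_map_in_subtopology)
  then have "openin (subtopology X U) {u \<in> topspace (subtopology X U). \<phi> u \<in> T}"
    by (rule openin_continuous_map_preimage) (simp add: T)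
  then show ?thesis
    using U surface_chart_subset [OF c] by (simp add: inf_absorb2 openin_open_subtopology)
qed

lemma surface_chart_open_image:
  assumes c: "surface_chart X U \<phi>" and W: "openin X W" "W \<subseteq> U"
  shows "open (\<phi> ` W)"
proof -
  have "open_map (subtopology X U) (top_of_set (\<phi> ` U)) \<phi>"
    using c homeomorphic_imp_open_map unfolding surface_chart_def by blast
  then have "openin (top_of_set (\<phi> ` U)) (\<phi> ` W)"
    using W by (simp add: open_map_def openin_subset_topspace_eq openin_subtopology) (metis inf.absorb1)
  then show ?thesis using c unfolding surface_chart_def by (meson openin_open_trans)
qed

lemma surface_chart_continuous_inverse:
  assumes c: "surface_chart X U \<phi>"
  shows "continuous_map (top_of_set (\<phi> ` U)) X (inv_into U \<phi>)"
proof -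
  obtain g where g: "homeomorphic_maps (subtopology X U) (top_of_set (\<phi> ` U)) \<phi> g"
    using c unfolding surface_chart_def homeomorphic_map_maps by blast
  have "inv_into U \<phi> z = g z" if "z \<in> \<phi> ` U" for z
  proof -
    have "\<phi> (g z) = z" "g z \<in> U"
      using g that unfolding homeomorphic_maps_def by (auto simp: continuous_map_def Pi_iff)
    then show ?thesis by (metis inv_into_f_f surface_chart_inj_on [OF c])
  qed
  moreover have "continuous_map (top_of_set (\<phi> ` U)) X g"
    using g unfolding homeomorphic_maps_def by (metis continuous_map_in_subtopology)
  ultimately show ?thesis by (metis (no_types, lifting) continuous_map_eq topspace_euclidean_subtopology)
qed

text \<open>In charts, the points of \<open>U\<close> over \<open>y\<close> inject into the
  \<open>k\<close>-th roots of the nonzero number \<open>\<psi> y\<close>. Together with the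
  converse bound this characterizes \<open>k\<close> without reference to charts.\<close>

lemma locally_power_preimages_le:
  assumes "locally_power E B f x k"
  obtains N where "openin E N" "x \<in> N" "\<forall>y. y \<noteq> f x \<longrightarrow> finite {u \<in> N. f u = y} \<and> card {u \<in> N. f u = y} \<le> k"
proof -
  obtain U \<phi> V \<psi> where k: "1 \<le> k" and c: "surface_chart E U \<phi>" "x \<in> U" "\<phi> x = 0"
      and d: "surface_chart B V \<psi>" "f x \<in> V" "\<psi> (f x) = 0" "f ` U \<subseteq> V" and p: "\<And>u. u \<in> U \<Longrightarrow> \<psi> (f u) = \<phi> u ^ k"
    using assms unfolding locally_power_def by blast
  have "finite {u \<in> U. f u = y} \<and> card {u \<in> U. f u = y} \<le> k" if y: "y \<noteq> f x" for y
  proof (cases "y \<in> V")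
    case True
    then have "\<psi> y \<noteq> 0" using inj_onD [OF surface_chart_inj_on [OF d(1)]] d y by metis
    then have R: "card {z. z ^ k = \<psi> y} = k" using k by (intro card_nth_roots) auto
    then have fin: "finite {z. z ^ k = \<psi> y}" using k card.infinite by fastforce
    have sub: "\<phi> ` {u \<in> U. f u = y} \<subseteq> {z. z ^ k = \<psi> y}" using p by auto
    have "inj_on \<phi> {u \<in> U. f u = y}" using surface_chart_inj_on [OF c(1)] by (rule inj_on_subset) auto
    from inj_on_finite [OF this sub fin] card_inj_on_le [OF this sub fin] show ?thesis using R by simp
  next
    case False
    then have "{u \<in> U. f u = y} = {}" using d by auto
    then show ?thesis by (simp only: finite.emptyI card.empty) simp
  qed
  moreover have "openin E U" using c by (simp add: surface_chart_def)
  ultimately show ?thesis using c that by blast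
qed

text \<open>Every neighbourhood of \<open>x\<close> contains points for all \<open>k\<close> roots
  of a sufficiently small nonzero value. The conclusion is an implication because
  \<open>card\<close> of an infinite set is 0.\<close>

lemma locally_power_preimages_ge:
  assumes "locally_power E B f x k" and N: "openin E N" "x \<in> N"
  obtains y where "y \<noteq> f x" "finite {u \<in> N. f u = y} \<longrightarrow> k \<le> card {u \<in> N. f u = y}"
proof -
  obtain U \<phi> V \<psi> where k: "1 \<le> k" and c: "surface_chart E U \<phi>" "x \<in> U" "\<phi> x = 0"
      and d: "surface_chart B V \<psi>" "f x \<in> V" "\<psi> (f x) = 0" "f ` U \<subseteq> V" and p: "\<And>u. u \<in> U \<Longrightarrow> \<psi> (f u) = \<phi> u ^ k"
    using assms unfolding locally_power_def by blast
  have "openin E (U \<inter> N)" using c N by (simp add: surface_chart_def openin_Int)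
  then have "open (\<phi> ` (U \<inter> N))" using surface_chart_open_image [OF c(1)] by simp
  moreover have "0 \<in> \<phi> ` (U \<inter> N)" using c N by (metis IntI imageI)
  ultimately obtain r where r: "r > 0" "ball 0 r \<subseteq> \<phi> ` (U \<inter> N)" by (meson openE)
  have "open (\<psi> ` V)" using d by (simp add: surface_chart_def)
  moreover have "0 \<in> \<psi> ` V" using d by (metis imageI)
  ultimately obtain s where s: "s > 0" "ball 0 s \<subseteq> \<psi> ` V" by (meson openE)
  \<comment> \<open>Smaller than \<open>r ^ k\<close>, so that all its roots lie in the disc of
    radius \<open>r\<close>, and smaller than \<open>s\<close>, so that it is the coordinate of a
    point of \<open>V\<close>.\<close>
  define w :: complex where "w = of_real (min (r ^ k) s / 2)"
  have w: "w \<noteq> 0" "norm w < r ^ k" "norm w < s"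
    using r s by (auto simp: w_def min_def field_simps)
  then obtain y where y: "y \<in> V" "\<psi> y = w" using s(2) by (metis imageE mem_ball_0 subsetD)
  have "y \<noteq> f x" using y w d by auto
  moreover have "k \<le> card {u \<in> N. f u = y}" if fin: "finite {u \<in> N. f u = y}"
  proof -
    have "{z. z ^ k = w} \<subseteq> \<phi> ` {u \<in> N. f u = y}"
    proof
      fix z assume "z \<in> {z. z ^ k = w}"
      then have z: "z ^ k = w" by simp
      then have "norm z ^ k < r ^ k" using w by (metis norm_power)
      then have "norm z < r" using r by (meson less_imp_le power_less_imp_less_base)
      then have "z \<in> \<phi> ` (U \<inter> N)" using r(2) by auto
      then obtain u where u: "u \<in> U" "u \<in> N" "\<phi> u = z" by blast
      then have "\<psi> (f u) = \<psi> y" using p y z by simp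
      then have "f u = y" using inj_onD [OF surface_chart_inj_on [OF d(1)]] d u y by blast
      then show "z \<in> \<phi> ` {u \<in> N. f u = y}" using u by blast
    qed
    from card_mono [OF finite_imageI [OF fin] this] card_image_le [OF fin, of \<phi>]
    have "card {z. z ^ k = w} \<le> card {u \<in> N. f u = y}" by linarith
    then show ?thesis using card_nth_roots [of w k] w k by simp
  qed
  ultimately show ?thesis using that by blast
qed

lemma locally_power_exponent_le:
  assumes "locally_power E B f x k" "locally_power E B f x k'"
  shows "k \<le> k'"
proof -
  obtain N where N: "openin E N" "x \<in> N" "\<forall>y. y \<noteq> f x \<longrightarrow> finite {u \<in> N. f u = y} \<and> card {u \<in> N. f u = y} \<le> k'"
    using locally_power_preimages_le [OF assms(2)] by blast
  obtain y where "y \<noteq> f x" "finite {u \<in> N. f u = y} \<longrightarrow> k \<le> card {u \<in> N. f u = y}"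
    using locally_power_preimages_ge [OF assms(1) N(1,2)] by blast
  then show ?thesis using N(3) le_trans by blast
qed

text \<open>Exponents obtained from any two pairs of charts bound each other, so exhibiting a single
  pair of charts settles the definite description.\<close>

lemma local_degree_eq: "locally_power E B f x k \<Longrightarrow> local_degree E B f x = k"
  unfolding local_degree_def by (meson locally_power_exponent_le antisym the_equality)

section \<open>The pillow\<close>

text \<open>In coordinates \<open>(a, b, c)\<close>, level at most 1 describes the convex body
  \<open>a^2 + c^2 \<le> 1\<close>, \<open>b^2 + c^2 \<le> 1\<close>,
  \<open>\<bar>c\<bar> \<le> a - b\<close>; the summand 1 brings the last condition to the same
  level. The boundary consists of two sheets over the triangle
  \<open>-1 \<le> b \<le> a \<le> 1\<close>, glued along the rim \<open>c = 0\<close>.\<close>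

definition pillow_gauge :: "real \<times> real \<times> real \<Rightarrow> real" where
  "pillow_gauge p = max (norm (fst p, snd (snd p)))
     (max (norm (fst (snd p), snd (snd p))) (\<bar>snd (snd p)\<bar> - fst p + fst (snd p) + 1))"

lemma pillow_gauge_convex:
  assumes t: "0 \<le> t" "t \<le> 1"
  shows "pillow_gauge ((1 - t) *\<^sub>R p + t *\<^sub>R q) \<le> (1 - t) * pillow_gauge p + t * pillow_gauge q"
proof -
  obtain a b c where p: "p = (a, b, c)" by (cases p) auto
  obtain x y z where q: "q = (x, y, z)" by (cases q) auto
  have max3: "max u1 (max u2 u3) \<le> (1 - t) * max a1 (max a2 a3) + t * max b1 (max b2 b3)"
    if "u1 \<le> (1 - t) * a1 + t * b1" "u2 \<le> (1 - t) * a2 + t * b2" "u3 \<le> (1 - t) * a3 + t * b3"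
    for u1 u2 u3 a1 a2 a3 b1 b2 b3 :: real
  proof -
    let ?A = "max a1 (max a2 a3)" and ?B = "max b1 (max b2 b3)"
    have "(1 - t) * a \<le> (1 - t) * ?A" if "a \<in> {a1, a2, a3}" for a
      using t that by (intro mult_left_mono) auto
    moreover have "t * b \<le> t * ?B" if "b \<in> {b1, b2, b3}" for b
      using t that by (intro mult_left_mono) auto
    ultimately show ?thesis using that by (smt (verit) insertCI)
  qed
  have nrm: "norm ((1 - t) * u + t * v, (1 - t) * u' + t * v') \<le> (1 - t) * norm (u, u') + t * norm (v, v')"
    for u u' v v' :: real
  proof -
    have "norm ((1 - t) *\<^sub>R (u, u') + t *\<^sub>R (v, v')) \<le> norm ((1 - t) *\<^sub>R (u, u')) + norm (t *\<^sub>R (v, v'))"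
      by (rule norm_triangle_ineq)
    then show ?thesis using t unfolding norm_scaleR by simp
  qed
  have "\<bar>(1 - t) * c + t * z\<bar> \<le> (1 - t) * \<bar>c\<bar> + t * \<bar>z\<bar>"
    using abs_triangle_ineq [of "(1 - t) * c" "t * z"] t by (simp add: abs_mult)
  then have lin: "\<bar>(1 - t) * c + t * z\<bar> - ((1 - t) * a + t * x) + ((1 - t) * b + t * y) + 1
      \<le> (1 - t) * (\<bar>c\<bar> - a + b + 1) + t * (\<bar>z\<bar> - x + y + 1)"
    by (simp add: algebra_simps)
  show ?thesis
    unfolding pillow_gauge_def p q using max3 [OF nrm nrm lin] by simp
qed

lemma continuous_on_pillow_gauge: "continuous_on S pillow_gauge"
  unfolding pillow_gauge_def by (intro continuous_intros)

definition pillow :: "(real \<times> real \<times> real) set" where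
  "pillow = {p. pillow_gauge p = 1}"

text \<open>A compact convex body with interior is a ball, and its frontier is a sphere. What has to
  be shown is that the frontier of the sublevel set is the level set; this follows from convexity
  and the point \<open>p0\<close> of level 1/2.\<close>

lemma pillow_homeomorphic_S2: "top_of_set pillow homeomorphic_space S2"
proof -
  define K where "K = {p. pillow_gauge p \<le> 1}"
  define p0 :: "real \<times> real \<times> real" where "p0 = (1 / 2, - 1 / 2, 0)"
  have p0: "pillow_gauge p0 = 1 / 2" by (simp add: pillow_gauge_def p0_def norm_Pair)
  have "continuous_on UNIV pillow_gauge" by (rule continuous_on_pillow_gauge)
  then have cl: "closed K" and op: "open {p. pillow_gauge p < 1}"
    unfolding K_def by (auto intro!: closed_Collect_le open_Collect_less continuous_intros)
  have conv: "convex K"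
    unfolding convex_alt K_def
  proof (intro allI ballI impI CollectI)
    fix p q t assume pq: "p \<in> {p. pillow_gauge p \<le> 1}" "q \<in> {p. pillow_gauge p \<le> 1}" "0 \<le> t \<and> t \<le> (1 :: real)"
    then have "(1 - t) * pillow_gauge p \<le> (1 - t) * 1" "t * pillow_gauge q \<le> t * 1"
      using mult_left_le [of "pillow_gauge p" "1 - t"] mult_left_le [of "pillow_gauge q" t] by auto
    then show "pillow_gauge ((1 - t) *\<^sub>R p + t *\<^sub>R q) \<le> 1"
      using pillow_gauge_convex [of t p q] pq by auto
  qed
  have "norm p \<le> 3" if "p \<in> K" for p
  proof -
    have "norm (fst p, snd (snd p)) \<le> 1" "norm (fst (snd p), snd (snd p)) \<le> 1"
      using that by (auto simp: K_def pillow_gauge_def)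
    then have "\<bar>fst p\<bar> \<le> 1" "\<bar>fst (snd p)\<bar> \<le> 1" "\<bar>snd (snd p)\<bar> \<le> 1"
      using norm_fst_le [of "fst p" "snd (snd p)"] norm_fst_le [of "fst (snd p)" "snd (snd p)"]
        norm_snd_le [of "snd (snd p)" "fst p"] by auto
    then show ?thesis
      using norm_Pair_le [of "fst p" "snd p"] norm_Pair_le [of "fst (snd p)" "snd (snd p)"] by simp
  qed
  then have "bounded K" by (meson boundedI)
  then have comp: "compact K" using cl compact_eq_bounded_closed by blast
  have int: "interior K = {p. pillow_gauge p < 1}"
  proof
    show "{p. pillow_gauge p < 1} \<subseteq> interior K"
      by (rule interior_maximal [OF _ op]) (auto simp: K_def)
    show "interior K \<subseteq> {p. pillow_gauge p < 1}"
    proof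
      fix p assume "p \<in> interior K"
      then obtain e where e: "e > 0" "ball p e \<subseteq> K" by (meson mem_interior)
      define n where "n = norm (p - p0)"
      have n: "n \<ge> 0" by (simp add: n_def)
      \<comment> \<open>The point \<open>q\<close> defined next lies slightly beyond
        \<open>p\<close> on the ray from \<open>p0\<close>, still inside the ball around
        \<open>p\<close>; the summand 1 covers \<open>p = p0\<close>. As \<open>p\<close> is
        strictly between \<open>p0\<close> and \<open>q\<close>, convexity puts its level below
        1.\<close>
      define s where "s = e / (2 * (n + 1))"
      have s: "s > 0" using e n by (simp add: s_def)
      define q where "q = p + s *\<^sub>R (p - p0)"
      have "n / (2 * (n + 1)) < 1" using n by simp
      then have "e * (n / (2 * (n + 1))) < e * 1" using e by (intro mult_strict_left_mono)
      then have "s * norm (p - p0) < e" by (simp add: s_def n_def [symmetric])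
      then have "q \<in> K" using e s by (auto simp: q_def dist_norm)
      then have q: "pillow_gauge q \<le> 1" by (simp add: K_def)
      define t where "t = 1 / (1 + s)"
      have t: "0 \<le> t" "t \<le> 1" "t < 1" "(1 - t) = s / (1 + s)" using s by (auto simp: t_def field_simps)
      have "(1 - t) *\<^sub>R p0 + t *\<^sub>R q = (1 / (1 + s)) *\<^sub>R (s *\<^sub>R p0 + q)"
        unfolding t(4) unfolding t_def by (simp add: scaleR_add_right)
      also have "s *\<^sub>R p0 + q = (1 + s) *\<^sub>R p" by (simp add: q_def algebra_simps)
      finally have "p = (1 - t) *\<^sub>R p0 + t *\<^sub>R q" using s by simp
      then have "pillow_gauge p \<le> (1 - t) * (1 / 2) + t * pillow_gauge q"
        using pillow_gauge_convex [OF t(1,2), of p0 q] p0 by simp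
      also have "\<dots> \<le> (1 - t) * (1 / 2) + t * 1" using q t by (intro add_left_mono mult_left_mono)
      also have "\<dots> < 1" using t by (simp add: field_simps)
      finally show "p \<in> {p. pillow_gauge p < 1}" by simp
    qed
  qed
  have fr: "frontier K = pillow"
    unfolding frontier_def closure_closed [OF cl] int by (auto simp: K_def pillow_def)
  have "p0 \<in> interior K" unfolding int using p0 by simp
  then have "K homeomorphic cball (0 :: real \<times> real \<times> real) 1"
    by (intro homeomorphic_convex_compact_cball [OF conv comp]) auto
  then have "frontier K homeomorphic frontier (cball (0 :: real \<times> real \<times> real) 1)"
    by (intro homeomorphic_frontiers_same_dimension cl) auto
  then have "top_of_set pillow homeomorphic_space top_of_set (sphere (0 :: real \<times> real \<times> real) 1)"
    by (simp add: fr frontier_cball)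
  moreover have "S2 homeomorphic_space top_of_set (sphere (0 :: real \<times> real \<times> real) 1)"
    by (rule S2_homeomorphic_sphere_gen) simp
  ultimately show ?thesis by (meson homeomorphic_space_sym homeomorphic_space_trans)
qed

section \<open>The group of the tiling and its quotient map onto the pillow\<close>

definition gaussian_ints :: "complex set" where
  "gaussian_ints = {z. Re z \<in> \<int> \<and> Im z \<in> \<int>}"

text \<open>The group of all \<open>z \<mapsto> \<i> ^ k * z + a\<close> is the orbifold fundamental group of \<open>S(2,4,4)\<close>.\<close>

definition orbit_equiv :: "complex \<Rightarrow> complex \<Rightarrow> bool" where
  "orbit_equiv z w \<longleftrightarrow> (\<exists>k::nat. \<exists>a\<in>gaussian_ints. w = \<i> ^ k * z + a)"

lemma gaussian_ints_closed:
  "0 \<in> gaussian_ints"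
  "a \<in> gaussian_ints \<Longrightarrow> b \<in> gaussian_ints \<Longrightarrow> a + b \<in> gaussian_ints"
  "a \<in> gaussian_ints \<Longrightarrow> b \<in> gaussian_ints \<Longrightarrow> a - b \<in> gaussian_ints"
  "a \<in> gaussian_ints \<Longrightarrow> b \<in> gaussian_ints \<Longrightarrow> a * b \<in> gaussian_ints"
  "a \<in> gaussian_ints \<Longrightarrow> - a \<in> gaussian_ints"
  "\<i> \<in> gaussian_ints"
  by (auto simp: gaussian_ints_def)

lemma ii_power_gaussian_ints: "\<i> ^ k \<in> gaussian_ints"
  by (induction k) (auto simp: gaussian_ints_closed gaussian_ints_def)

text \<open>Inverts a power of \<open>\<i>\<close> by a power with natural exponent, so that all
  group elements can be written with \<open>k :: nat\<close>.\<close>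

lemma ii_power_inverse: "\<i> ^ (3 * k) * \<i> ^ k = 1"
proof -
  have "\<i> ^ (3 * k) * \<i> ^ k = (\<i> ^ 4) ^ k"
    unfolding power_add [symmetric] power_mult [symmetric] by (simp add: mult.commute)
  then show ?thesis by simp
qed

lemma orbit_equiv_sym:
  assumes "orbit_equiv z w" shows "orbit_equiv w z"
proof -
  obtain k a where a: "a \<in> gaussian_ints" "w = \<i> ^ k * z + a" using assms by (auto simp: orbit_equiv_def)
  have "z = \<i> ^ (3 * k) * w + - (\<i> ^ (3 * k) * a)"
    unfolding a(2) by (simp add: distrib_left mult.assoc [symmetric] ii_power_inverse)
  then show ?thesis
    unfolding orbit_equiv_def using a by (blast intro: gaussian_ints_closed ii_power_gaussian_ints)
qed

lemma orbit_equiv_trans: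
  assumes "orbit_equiv z w" "orbit_equiv w u" shows "orbit_equiv z u"
proof -
  obtain k a where a: "a \<in> gaussian_ints" "w = \<i> ^ k * z + a" using assms by (auto simp: orbit_equiv_def)
  obtain l b where b: "b \<in> gaussian_ints" "u = \<i> ^ l * w + b" using assms by (auto simp: orbit_equiv_def)
  have "u = \<i> ^ (l + k) * z + (\<i> ^ l * a + b)" unfolding a(2) b(2) by (simp add: algebra_simps power_add)
  then show ?thesis
    unfolding orbit_equiv_def using a b by (blast intro: gaussian_ints_closed ii_power_gaussian_ints)
qed

text \<open>This is \<open>sgn a * sgn b * min \<bar>a\<bar> \<bar>b\<bar>\<close>. It has the signs
  of a product, but an absolute value that fits a body cut out by several inequalities, and the
  formula is visibly continuous.\<close>

definition signed_min :: "real \<Rightarrow> real \<Rightarrow> real" where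
  "signed_min a b = (\<bar>a + b\<bar> - \<bar>a - b\<bar>) / 2"

lemma abs_signed_min: "\<bar>signed_min a b\<bar> = min \<bar>a\<bar> \<bar>b\<bar>"
  by (auto simp: signed_min_def)

lemma signed_min_minus: "signed_min (- a) b = - signed_min a b" "signed_min a (- b) = - signed_min a b"
  by (simp_all add: signed_min_def abs_if)

lemma signed_min_commute: "signed_min a b = signed_min b a"
  by (simp add: signed_min_def abs_minus_commute add.commute)

lemma signed_min_nonneg: "a \<ge> 0 \<Longrightarrow> b \<ge> 0 \<Longrightarrow> signed_min a b = min a b"
  by (auto simp: signed_min_def)

definition tcos :: "real \<Rightarrow> real" where "tcos x = cos (2 * pi * x)"
definition tsin :: "real \<Rightarrow> real" where "tsin x = sin (2 * pi * x)"

text \<open>The first two coordinates are invariant under the reflection group of the triangle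
  \<open>0, 1/2, (1 + \<i>)/2\<close>; the third one changes sign under each reflection, and its absolute value
  is determined by the first two.\<close>

definition tile_map :: "complex \<Rightarrow> real \<times> real \<times> real" where
  "tile_map z = (max (tcos (Re z)) (tcos (Im z)), min (tcos (Re z)) (tcos (Im z)),
     signed_min (signed_min (tsin (Re z)) (tsin (Im z))) (tcos (Re z) - tcos (Im z)))"

lemma trig_Ints:
  assumes "n \<in> \<int>"
  shows "tcos (x + n) = tcos x" "tsin (x + n) = tsin x"
  using assms sin_cos_eq_iff [of "2 * pi * (x + n)" "2 * pi * x"]
  by (auto elim!: Ints_cases simp: tcos_def tsin_def algebra_simps)

lemma trig_minus: "tcos (- x) = tcos x" "tsin (- x) = - tsin x"
  by (simp_all add: tcos_def tsin_def)

lemma trig_squares: "(tsin x)\<^sup>2 + (tcos x)\<^sup>2 = 1"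
  by (simp add: tcos_def tsin_def)

lemma trig_eqD:
  assumes "tcos x = tcos y" "tsin x = tsin y" shows "x - y \<in> \<int>"
proof -
  obtain n :: int where "2 * pi * x = 2 * pi * y + 2 * pi * n"
    using assms sin_cos_eq_iff [of "2 * pi * x" "2 * pi * y"] by (auto simp: tcos_def tsin_def)
  then have "2 * pi * (x - y) = 2 * pi * n" by (simp add: algebra_simps)
  then show ?thesis by simp
qed

lemma tcos_eqD:
  assumes "tcos x = tcos y"
  shows "tsin x = tsin y \<or> tsin x = - tsin y"
  using trig_squares [of x] trig_squares [of y] assms by (metis add_right_cancel power2_eq_iff)

text \<open>The rotation swaps the coordinates and negates one sine. The difference of the cosines
  changes its sign as well, and in the third coordinate the two signs cancel.\<close>

lemma tile_map_rotate: "tile_map (\<i> * z) = tile_map z"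
proof -
  have "signed_min (signed_min (- s) t) (e - c) = signed_min (signed_min t s) (c - e)" for s t c e
    using signed_min_minus signed_min_commute by (metis minus_diff_eq minus_minus)
  then show ?thesis by (simp add: tile_map_def trig_minus max.commute min.commute)
qed

lemma tile_map_rotate_power: "tile_map (\<i> ^ k * z) = tile_map z"
  by (induction k) (simp_all add: tile_map_rotate mult.assoc)

lemma tile_map_translate: "a \<in> gaussian_ints \<Longrightarrow> tile_map (z + a) = tile_map z"
  by (simp add: tile_map_def trig_Ints gaussian_ints_def)

lemma tile_map_eq_if: "orbit_equiv z w \<Longrightarrow> tile_map z = tile_map w"
  by (auto simp: orbit_equiv_def tile_map_translate tile_map_rotate_power)

lemma orbit_equivI: "w - z \<in> gaussian_ints \<Longrightarrow> orbit_equiv z w" "w + z \<in> gaussian_ints \<Longrightarrow> orbit_equiv z w"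
  "w - \<i> * z \<in> gaussian_ints \<Longrightarrow> orbit_equiv z w" "w + \<i> * z \<in> gaussian_ints \<Longrightarrow> orbit_equiv z w"
proof -
  have *: "w - \<i> ^ k * z \<in> gaussian_ints \<Longrightarrow> orbit_equiv z w" for k
    unfolding orbit_equiv_def by (intro exI bexI [of _ "w - \<i> ^ k * z"]) auto
  show "w - z \<in> gaussian_ints \<Longrightarrow> orbit_equiv z w" "w + z \<in> gaussian_ints \<Longrightarrow> orbit_equiv z w"
  "w - \<i> * z \<in> gaussian_ints \<Longrightarrow> orbit_equiv z w" "w + \<i> * z \<in> gaussian_ints \<Longrightarrow> orbit_equiv z w"
    using * [of 0] * [of 1] * [of 2] * [of 3] by (simp_all add: power3_eq_cube)
qed

text \<open>Equal cosines leave only the signs of the two sines open. If both signs agree or both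
  differ, \<open>w\<close> is \<open>z\<close> or \<open>- z\<close> modulo translations. Otherwise
  the third coordinate is its own negative and vanishes, so the point lies on a mirror: where
  \<open>tcos x = tcos y\<close> a quarter turn relates \<open>z\<close> and \<open>w\<close>, and
  elsewhere the sign of the vanishing sine is free.\<close>

lemma orbit_equiv_if_tile_map_aligned:
  assumes t: "tile_map z = tile_map w" and c: "tcos (Re w) = tcos (Re z)" "tcos (Im w) = tcos (Im z)"
  shows "orbit_equiv z w"
proof -
  define x y x' y' where xy: "x = Re z" "y = Im z" "x' = Re w" "y' = Im w"
  note c' = c [folded xy]
  have g: "u \<in> gaussian_ints \<longleftrightarrow> Re u \<in> \<int> \<and> Im u \<in> \<int>" for u by (simp add: gaussian_ints_def)
  have neg: "a + b \<in> \<int>" if "tcos a = tcos b" "tsin a = - tsin b" for a b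
    using trig_eqD [of a "- b"] that by (simp add: trig_minus)
  show ?thesis
  proof (cases "(tsin x' = tsin x \<and> tsin y' = tsin y) \<or> (tsin x' = - tsin x \<and> tsin y' = - tsin y)")
    case True
    then show ?thesis
    proof
      assume "tsin x' = tsin x \<and> tsin y' = tsin y"
      then show ?thesis using trig_eqD c' by (intro orbit_equivI(1)) (auto simp: g xy)
    next
      assume "tsin x' = - tsin x \<and> tsin y' = - tsin y"
      then show ?thesis using neg c' by (intro orbit_equivI(2)) (auto simp: g xy)
    qed
  next
    case False
    have "tsin x' = tsin x \<or> tsin x' = - tsin x" "tsin y' = tsin y \<or> tsin y' = - tsin y"
      using tcos_eqD c' by auto
    then have opp: "(tsin x' = - tsin x \<and> tsin y' = tsin y) \<or> (tsin x' = tsin x \<and> tsin y' = - tsin y)"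
      using False by auto
    let ?m = "signed_min (signed_min (tsin x) (tsin y)) (tcos x - tcos y)"
    have "signed_min (signed_min (tsin x') (tsin y')) (tcos x' - tcos y') = - ?m"
      using opp by (auto simp: c' signed_min_minus)
    then have "?m = 0" using t by (simp add: tile_map_def xy)
    then have "min (min \<bar>tsin x\<bar> \<bar>tsin y\<bar>) \<bar>tcos x - tcos y\<bar> = 0"
      using abs_signed_min by (metis abs_zero)
    then have "tsin x = 0 \<or> tsin y = 0 \<or> tcos x = tcos y" by (auto simp: min_def split: if_splits)
    then have eq: "tcos x = tcos y" using False opp by auto
    then have xy_sin: "tsin x = tsin y \<or> tsin x = - tsin y" using tcos_eqD by auto
    from xy_sin opp consider "tsin x' = tsin y" "tsin y' = - tsin x" | "tsin x' = - tsin y" "tsin y' = tsin x"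
      by auto
    then show ?thesis
    proof cases
      case 1
      then show ?thesis using trig_eqD [of x' y] neg [of y' x] c' eq
        by (intro orbit_equivI(4)) (auto simp: g xy)
    next
      case 2
      then show ?thesis using trig_eqD [of y' x] neg [of x' y] c' eq
        by (intro orbit_equivI(3)) (auto simp: g xy)
    qed
  qed
qed

text \<open>Maximum and minimum determine the two cosines up to order; if they are interchanged,
  \<open>z\<close> is first turned by \<open>\<i>\<close>.\<close>

lemma tile_map_eq_iff: "tile_map z = tile_map w \<longleftrightarrow> orbit_equiv z w"
proof
  assume t: "tile_map z = tile_map w"
  have "(tcos (Re w) = tcos (Re z) \<and> tcos (Im w) = tcos (Im z)) \<or> (tcos (Re w) = tcos (Im z) \<and> tcos (Im w) = tcos (Re z))"
    using t by (auto simp: tile_map_def max_def min_def split: if_splits)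
  then show "orbit_equiv z w"
  proof
    assume "tcos (Re w) = tcos (Im z) \<and> tcos (Im w) = tcos (Re z)"
    then have "orbit_equiv (\<i> * z) w"
      using t by (intro orbit_equiv_if_tile_map_aligned) (auto simp: tile_map_rotate trig_minus)
    moreover have "orbit_equiv z (\<i> * z)" by (intro orbit_equivI(3)) (simp add: gaussian_ints_closed)
    ultimately show ?thesis using orbit_equiv_trans by blast
  qed (use t orbit_equiv_if_tile_map_aligned in blast)
qed (rule tile_map_eq_if)

text \<open>Over each point \<open>(c, e)\<close> of the triangle the body is a vertical segment
  symmetric about height 0, and the level set consists of its ends.\<close>

lemma pillow_gauge_eq_1_iff:
  assumes c: "\<bar>c\<bar> \<le> 1" "\<bar>e\<bar> \<le> 1" "e \<le> c"
  shows "pillow_gauge (c, e, w) = 1 \<longleftrightarrow> \<bar>w\<bar> = min (min (sqrt (1 - c\<^sup>2)) (sqrt (1 - e\<^sup>2))) (c - e)"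
proof -
  have n: "norm (a, w) \<le> 1 \<longleftrightarrow> \<bar>w\<bar> \<le> sqrt (1 - a\<^sup>2)" "norm (a, w) < 1 \<longleftrightarrow> \<bar>w\<bar> < sqrt (1 - a\<^sup>2)" for a
  proof -
    show "norm (a, w) \<le> 1 \<longleftrightarrow> \<bar>w\<bar> \<le> sqrt (1 - a\<^sup>2)"
      by (simp add: norm_Pair real_le_rsqrt real_sqrt_le_1_iff le_diff_eq abs_le_square_iff add.commute flip: real_sqrt_abs)
    show "norm (a, w) < 1 \<longleftrightarrow> \<bar>w\<bar> < sqrt (1 - a\<^sup>2)"
      by (simp add: norm_Pair less_diff_eq add.commute flip: real_sqrt_abs)
  qed
  have "pillow_gauge (c, e, w) = 1 \<longleftrightarrow> pillow_gauge (c, e, w) \<le> 1 \<and> \<not> pillow_gauge (c, e, w) < 1"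
    by linarith
  also have "\<dots> \<longleftrightarrow> \<bar>w\<bar> \<le> min (min (sqrt (1 - c\<^sup>2)) (sqrt (1 - e\<^sup>2))) (c - e) \<and>
      \<not> \<bar>w\<bar> < min (min (sqrt (1 - c\<^sup>2)) (sqrt (1 - e\<^sup>2))) (c - e)"
    unfolding pillow_gauge_def by (auto simp: n)
  finally show ?thesis by linarith
qed

lemma tile_map_pillow: "tile_map z \<in> pillow"
proof -
  define x y where xy: "x = Re z" "y = Im z"
  have s: "\<bar>tsin a\<bar> = sqrt (1 - (tcos a)\<^sup>2)" for a
    using trig_squares [of a] by (metis add_diff_cancel_right' real_sqrt_abs)
  have b: "\<bar>tcos a\<bar> \<le> 1" for a by (simp add: tcos_def)
  have "pillow_gauge (tile_map z) = 1"
  proof (cases "tcos y \<le> tcos x")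
    case True
    then show ?thesis
      unfolding tile_map_def xy [symmetric]
      by (simp add: pillow_gauge_eq_1_iff b abs_signed_min s max_absorb1 min_absorb2)
  next
    case False
    then show ?thesis
      unfolding tile_map_def xy [symmetric]
      by (simp add: pillow_gauge_eq_1_iff b abs_signed_min s max_absorb2 min_absorb1 min.commute)
  qed
  then show ?thesis by (simp add: pillow_def)
qed

lemma pillow_subset_tile_map: "pillow \<subseteq> range tile_map"
proof
  fix p assume "p \<in> pillow"
  obtain c e w where p: "p = (c, e, w)" by (cases p) auto
  then have g: "pillow_gauge (c, e, w) = 1" using \<open>p \<in> pillow\<close> by (simp add: pillow_def)
  then have "norm (c, w) \<le> 1" "norm (e, w) \<le> 1" "\<bar>w\<bar> - c + e + 1 \<le> 1"
    by (auto simp: pillow_gauge_def)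
  then have ce: "\<bar>c\<bar> \<le> 1" "\<bar>e\<bar> \<le> 1" "e \<le> c"
    using norm_fst_le [of c w] norm_fst_le [of e w] by auto
  define x y where "x = arccos c / (2 * pi)" "y = arccos e / (2 * pi)"
  have c: "tcos x = c" "tcos y = e" "tsin x = sqrt (1 - c\<^sup>2)" "tsin y = sqrt (1 - e\<^sup>2)"
    using ce by (auto simp: x_y_def tcos_def tsin_def sin_arccos abs_le_iff)
  let ?h = "min (min (sqrt (1 - c\<^sup>2)) (sqrt (1 - e\<^sup>2))) (c - e)"
  have h: "\<bar>w\<bar> = ?h" using pillow_gauge_eq_1_iff [OF ce] g by simp
  have "0 \<le> sqrt (1 - c\<^sup>2)" "0 \<le> sqrt (1 - e\<^sup>2)"
    using ce by (auto simp: abs_square_le_1)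
  then have sm: "signed_min (signed_min (tsin x) (tsin y)) (tcos x - tcos y) = ?h"
    using ce by (simp add: c signed_min_nonneg)
  \<comment> \<open>\<open>arccos\<close> provides a point of one triangle of the tiling; reflecting
    it by \<open>x \<mapsto> - x\<close> reaches the opposite sheet.\<close>
  have "tile_map (Complex x y) = (c, e, ?h)" "tile_map (Complex (- x) y) = (c, e, - ?h)"
    using sm ce by (auto simp: tile_map_def c trig_minus signed_min_minus)
  moreover have "w = ?h \<or> w = - ?h" using h by linarith
  ultimately show "p \<in> range tile_map" unfolding p by (metis rangeI)
qed

lemma range_tile_map: "range tile_map = pillow"
  using tile_map_pillow pillow_subset_tile_map by blast

lemma continuous_on_tile_map: "continuous_on S tile_map"
  unfolding tile_map_def signed_min_def tcos_def tsin_def by (intro continuous_intros) auto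

lemma orbit_equiv_unit_square: "\<exists>w \<in> cbox 0 (1 + \<i>). orbit_equiv z w"
proof -
  let ?w = "Complex (frac (Re z)) (frac (Im z))"
  have "?w \<in> cbox 0 (1 + \<i>)"
    by (simp add: cbox_Complex_eq in_cbox_complex_iff frac_lt_1 less_imp_le)
  moreover have "orbit_equiv z ?w"
    by (intro orbit_equivI(1)) (simp add: gaussian_ints_def frac_def)
  ultimately show ?thesis by blast
qed

text \<open>The abstract properties of the quotient map from the plane by the group of the tiling.
  The later arguments use only these, so source and target may be arbitrary spheres.\<close>

definition pillow_cover :: "'a topology \<Rightarrow> (complex \<Rightarrow> 'a) \<Rightarrow> bool" where
  "pillow_cover E P \<longleftrightarrow> range P = topspace E \<and> continuous_map euclidean E P \<and> open_map euclidean E P \<and>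
     (\<forall>z w. P z = P w \<longleftrightarrow> orbit_equiv z w)"

text \<open>Openness is the point. The saturation \<open>S\<close> of an open set is open, and the
  unit square meets every orbit. So the complement of the image is the image of the compact set
  \<open>cbox 0 (1 + \<i>) - S\<close>, hence closed.\<close>

lemma pillow_cover_tile_map: "pillow_cover (top_of_set pillow) tile_map"
proof -
  have "openin (top_of_set pillow) (tile_map ` U)" if U: "open U" for U
  proof -
    define S where "S = {z. \<exists>u\<in>U. orbit_equiv u z}"
    have "S = (\<Union>k. \<Union>a\<in>gaussian_ints. (\<lambda>u. a + u) ` (\<lambda>u. \<i> ^ k * u) ` U)"
      by (auto simp: S_def orbit_equiv_def add.commute image_iff)
    moreover have "open ((\<lambda>u. a + u) ` (\<lambda>u. \<i> ^ k * u) ` U)" for a k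
    proof -
      have "open ((\<lambda>u. \<i> ^ k * u) ` U)"
      proof -
        have "(\<lambda>u. \<i> ^ k * u) ` U = (\<lambda>v. v / \<i> ^ k) -` U" 
          by (force simp: image_iff field_simps)
        moreover have "open ((\<lambda>v. v / \<i> ^ k) -` U)" using U by (intro open_vimage continuous_intros) auto
        ultimately show ?thesis by simp
      qed
      then show ?thesis by (rule open_translation)
    qed
    ultimately have "open S" by auto
    then have "compact (cbox 0 (1 + \<i>) \<inter> - S)"
      by (intro compact_Int_closed compact_cbox) auto
    then have "compact (tile_map ` (cbox 0 (1 + \<i>) \<inter> - S))"
      by (intro compact_continuous_image continuous_on_tile_map)
    then have cl: "closed (tile_map ` (cbox 0 (1 + \<i>) \<inter> - S))" by (rule compact_imp_closed)
    have "tile_map ` U = pillow \<inter> - (tile_map ` (cbox 0 (1 + \<i>) \<inter> - S))"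
    proof (intro equalityI subsetI)
      fix p assume "p \<in> tile_map ` U"
      then show "p \<in> pillow \<inter> - (tile_map ` (cbox 0 (1 + \<i>) \<inter> - S))"
        by (auto simp: tile_map_pillow tile_map_eq_iff S_def)
    next
      fix p assume p: "p \<in> pillow \<inter> - (tile_map ` (cbox 0 (1 + \<i>) \<inter> - S))"
      then obtain z where "p = tile_map z" using range_tile_map by blast
      then obtain w where w: "w \<in> cbox 0 (1 + \<i>)" "p = tile_map w"
        using orbit_equiv_unit_square [of z] tile_map_eq_iff by metis
      then have "w \<in> S" using p by auto
      then show "p \<in> tile_map ` U" using w tile_map_eq_iff by (auto simp: S_def image_iff) metis
    qed
    then show ?thesis using cl by (metis open_Compl openin_open_Int)
  qed
  then show ?thesis
    unfolding pillow_cover_def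
    by (auto simp: range_tile_map open_map_def tile_map_eq_iff continuous_map_in_subtopology continuous_on_tile_map tile_map_pillow)
qed

lemma pillow_cover_exists:
  assumes "E homeomorphic_space S2"
  obtains P where "pillow_cover E P"
proof -
  have "top_of_set pillow homeomorphic_space E"
    using assms pillow_homeomorphic_S2 by (meson homeomorphic_space_sym homeomorphic_space_trans)
  then obtain h where h: "homeomorphic_map (top_of_set pillow) E h"
    by (auto simp: homeomorphic_space homeomorphic_map_maps)
  note t = pillow_cover_tile_map [unfolded pillow_cover_def]
  have "range (h \<circ> tile_map) = topspace E"
    using homeomorphic_imp_surjective_map [OF h] t by (metis image_comp)
  moreover have "continuous_map euclidean E (h \<circ> tile_map)"
    using t homeomorphic_imp_continuous_map [OF h] continuous_map_compose by blast
  moreover have "open_map euclidean E (h \<circ> tile_map)"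
    using t homeomorphic_imp_open_map [OF h] open_map_compose by blast
  moreover have "(h \<circ> tile_map) z = (h \<circ> tile_map) w \<longleftrightarrow> orbit_equiv z w" for z w
    using homeomorphic_imp_injective_map [OF h] tile_map_pillow tile_map_eq_iff by (auto simp: inj_on_eq_iff)
  ultimately show ?thesis using that [of "h \<circ> tile_map"] by (simp add: pillow_cover_def)
qed

text \<open>\<open>h\<close> and \<open>P\<close> identify the same points of \<open>U\<close>, so
  \<open>h\<close> descends to an injective \<open>\<phi>\<close>. It is continuous because
  \<open>h\<close> is continuous and \<open>P\<close> open, and it is open because \<open>P\<close>
  is continuous and \<open>h\<close> open.\<close>

lemma surface_chart_of_quotient:
  fixes P :: "complex \<Rightarrow> 'a" and h :: "complex \<Rightarrow> complex"
  assumes P: "continuous_map euclidean E P" "open_map euclidean E P"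
    and U: "open U" and h: "continuous_on U h" "\<And>W. open W \<Longrightarrow> W \<subseteq> U \<Longrightarrow> open (h ` W)"
    and eq: "\<And>z w. z \<in> U \<Longrightarrow> w \<in> U \<Longrightarrow> P z = P w \<longleftrightarrow> h z = h w"
  obtains \<phi> where "surface_chart E (P ` U) \<phi>" "\<And>z. z \<in> U \<Longrightarrow> \<phi> (P z) = h z"
proof -
  define \<phi> where "\<phi> e = h (SOME z. z \<in> U \<and> P z = e)" for e
  have \<phi>: "\<phi> (P z) = h z" if "z \<in> U" for z
  proof -
    have "\<exists>w. w \<in> U \<and> P w = P z" using that by blast
    then have "(SOME w. w \<in> U \<and> P w = P z) \<in> U \<and> P (SOME w. w \<in> U \<and> P w = P z) = P z" by (rule someI_ex)
    then show ?thesis unfolding \<phi>_def using eq that by blast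
  qed
  have oPU: "openin E (P ` U)" using P(2) U by (simp add: open_map_def)
  then have PU: "topspace (subtopology E (P ` U)) = P ` U" using openin_subset by fastforce
  have im: "\<phi> ` P ` U = h ` U" using \<phi> by (force simp: image_image)
  have "homeomorphic_map (subtopology E (P ` U)) (top_of_set (h ` U)) \<phi>"
  proof (rule bijective_open_imp_homeomorphic_map)
    show "inj_on \<phi> (topspace (subtopology E (P ` U)))"
      unfolding PU using \<phi> eq by (intro inj_onI) (elim imageE, simp)
    show "\<phi> ` topspace (subtopology E (P ` U)) = topspace (top_of_set (h ` U))"
      unfolding PU using im by simp
    show "continuous_map (subtopology E (P ` U)) (top_of_set (h ` U)) \<phi>"
      unfolding continuous_map_in_subtopology
    proof (intro conjI)
      show "continuous_map (subtopology E (P ` U)) euclidean \<phi>"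
        unfolding continuous_map_def PU
      proof (intro conjI allI impI)
        fix T :: "complex set" assume "openin euclidean T"
        then have "open T" by simp
        then have "open (U \<inter> h -` T)" using continuous_open_preimage [OF h(1) U] by blast
        then have "openin E (P ` (U \<inter> h -` T))" using P(2) by (simp add: open_map_def)
        moreover have "{x \<in> P ` U. \<phi> x \<in> T} = P ` (U \<inter> h -` T)" using \<phi> by auto
        ultimately show "openin (subtopology E (P ` U)) {x \<in> P ` U. \<phi> x \<in> T}"
          using oPU by (simp add: openin_open_subtopology) blast
      qed auto
      show "\<phi> \<in> topspace (subtopology E (P ` U)) \<rightarrow> h ` U" unfolding PU using im by blast
    qed
    show "open_map (subtopology E (P ` U)) (top_of_set (h ` U)) \<phi>"
      unfolding open_map_def
    proof (intro allI impI)
      fix W assume "openin (subtopology E (P ` U)) W"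
      then have W: "openin E W" "W \<subseteq> P ` U" using oPU by (auto simp: openin_open_subtopology)
      have "openin euclidean {z \<in> topspace euclidean. P z \<in> W}"
        using P(1) W(1) openin_continuous_map_preimage by blast
      then have "open (U \<inter> P -` W)" using U by (simp add: open_Int vimage_def)
      then have "open (h ` (U \<inter> P -` W))" by (intro h) auto
      moreover have "\<phi> ` W = h ` (U \<inter> P -` W)"
      proof (intro equalityI subsetI)
        fix c assume "c \<in> \<phi> ` W"
        then obtain e where e: "e \<in> W" "c = \<phi> e" by blast
        then obtain z where "z \<in> U" "e = P z" using W by blast
        then show "c \<in> h ` (U \<inter> P -` W)" using e \<phi> by auto
      qed (use \<phi> in force)
      ultimately show "openin (top_of_set (h ` U)) (\<phi> ` W)"
        by (simp add: open_subset) (metis Int_lower1 image_mono open_subset)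
    qed
  qed
  moreover have "open (h ` U)" using h(2) U by blast
  ultimately have "surface_chart E (P ` U) \<phi>" unfolding surface_chart_def im using oPU by blast
  then show ?thesis using \<phi> that by blast
qed

text \<open>The order of the stabilizer of \<open>z\<close> in the group generated by \<open>\<int>[\<i>]\<close> and \<open>\<i>\<close>.\<close>

definition cone_order :: "complex \<Rightarrow> nat" where
  "cone_order z = (if (\<i> - 1) * z \<in> gaussian_ints then 4 else if 2 * z \<in> gaussian_ints then 2 else 1)"

lemma ii_gaussian_ints_iff: "\<i> * z \<in> gaussian_ints \<longleftrightarrow> z \<in> gaussian_ints"
  by (auto simp: gaussian_ints_def)

lemma minus_gaussian_ints_iff: "- z \<in> gaussian_ints \<longleftrightarrow> z \<in> gaussian_ints"
  by (auto simp: gaussian_ints_def)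

lemma ii_power_gaussian_ints_iff: "\<i> ^ k * z \<in> gaussian_ints \<longleftrightarrow> z \<in> gaussian_ints"
  by (induction k) (simp_all add: ii_gaussian_ints_iff mult.assoc)

lemma gaussian_ints_2: "2 \<in> gaussian_ints" "1 \<in> gaussian_ints" "1 + \<i> \<in> gaussian_ints" "\<i> - 1 \<in> gaussian_ints"
  by (auto simp: gaussian_ints_def)

lemma cone_order_cases: "cone_order z = 1 \<or> cone_order z = 2 \<or> cone_order z = 4"
  by (simp add: cone_order_def)

lemma cone_order_4_imp: "(\<i> - 1) * z \<in> gaussian_ints \<Longrightarrow> 2 * z \<in> gaussian_ints"
proof -
  assume z: "(\<i> - 1) * z \<in> gaussian_ints"
  have "- (1 + \<i>) \<in> gaussian_ints" by (simp add: gaussian_ints_def)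
  then have "(- (1 + \<i>)) * ((\<i> - 1) * z) \<in> gaussian_ints"
    using z by (rule gaussian_ints_closed(4))
  moreover have "(- (1 + \<i>)) * (\<i> - 1) = 2" by (simp add: algebra_simps)
  ultimately show ?thesis by (simp only: mult.assoc [symmetric])
qed

lemma ii_power_mod_4: "\<i> ^ k = \<i> ^ (k mod 4)"
proof -
  have "\<i> ^ k = (\<i> ^ 4) ^ (k div 4) * \<i> ^ (k mod 4)"
    by (metis div_mult_mod_eq mult.commute power_add power_mult)
  then show ?thesis by simp
qed

text \<open>The left side says that some group element with linear part \<open>\<i> ^ k\<close>
  fixes \<open>z\<close>. So the linear parts of the stabilizer are exactly the roots of unity of
  order dividing \<open>cone_order z\<close>.\<close>

lemma stabilizer_iff:
  "\<i> ^ k * z - z \<in> gaussian_ints \<longleftrightarrow> (\<i> ^ k) ^ cone_order z = 1"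
proof -
  have i3: "\<i> ^ 3 = - \<i>" by (simp add: power3_eq_cube)
  have 3: "- \<i> * z - z \<in> gaussian_ints \<longleftrightarrow> (\<i> - 1) * z \<in> gaussian_ints"
  proof -
    have "\<i> * ((\<i> - 1) * z) = - \<i> * z - z" by (simp add: algebra_simps)
    then show ?thesis using ii_gaussian_ints_iff [of "(\<i> - 1) * z"] by simp
  qed
  have 2: "- z - z \<in> gaussian_ints \<longleftrightarrow> 2 * z \<in> gaussian_ints"
    using minus_gaussian_ints_iff [of "2 * z"] by (simp add: algebra_simps)
  have 1: "\<i> * z - z \<in> gaussian_ints \<longleftrightarrow> (\<i> - 1) * z \<in> gaussian_ints"
    by (simp add: algebra_simps)
  have "k mod 4 < 4" by simp
  then consider "k mod 4 = 0" | "k mod 4 = 1" | "k mod 4 = 2" | "k mod 4 = 3" by linarith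
  then show ?thesis
    unfolding ii_power_mod_4 [of k]
  proof cases
    case 1
    then show "\<i> ^ (k mod 4) * z - z \<in> gaussian_ints \<longleftrightarrow> (\<i> ^ (k mod 4)) ^ cone_order z = 1"
      by (simp add: gaussian_ints_closed)
  next
    case 2
    then show "\<i> ^ (k mod 4) * z - z \<in> gaussian_ints \<longleftrightarrow> (\<i> ^ (k mod 4)) ^ cone_order z = 1"
      using 1 by (simp add: cone_order_def)
  next
    case 3
    then show "\<i> ^ (k mod 4) * z - z \<in> gaussian_ints \<longleftrightarrow> (\<i> ^ (k mod 4)) ^ cone_order z = 1"
      using 2 cone_order_4_imp [of z] by (simp add: cone_order_def)
  next
    case 4
    then show "\<i> ^ (k mod 4) * z - z \<in> gaussian_ints \<longleftrightarrow> (\<i> ^ (k mod 4)) ^ cone_order z = 1"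
      using 3 by (simp add: cone_order_def i3 power2_eq_square complex_eq_iff)
  qed
qed

lemma cone_order_orbit_equiv:
  assumes "orbit_equiv z w" shows "cone_order z = cone_order w"
proof -
  obtain k a where a: "a \<in> gaussian_ints" "w = \<i> ^ k * z + a" using assms by (auto simp: orbit_equiv_def)
  have *: "c * w \<in> gaussian_ints \<longleftrightarrow> c * z \<in> gaussian_ints" if "c \<in> gaussian_ints" for c
  proof -
    have "c * w = \<i> ^ k * (c * z) + c * a" by (simp add: a algebra_simps)
    moreover have "c * a \<in> gaussian_ints" using that a gaussian_ints_closed by blast
    ultimately show ?thesis
      using ii_power_gaussian_ints_iff gaussian_ints_closed by (metis add_diff_cancel_right')
  qed
  show ?thesis unfolding cone_order_def by (simp add: * gaussian_ints_2)
qed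

text \<open>The conditions defining \<open>cone_order\<close> survive multiplication by
  \<open>l\<close>: stabilizers can only grow. Thus the quotient of the two orders, the future local
  degree, is an exact one.\<close>

lemma cone_order_dvd_mult:
  assumes "l \<in> gaussian_ints" shows "cone_order z dvd cone_order (l * z)"
proof -
  have "c * z \<in> gaussian_ints \<Longrightarrow> c * (l * z) \<in> gaussian_ints" for c
    using assms gaussian_ints_closed(4) by (metis mult.left_commute)
  then show ?thesis using cone_order_4_imp by (auto simp: cone_order_def)
qed

text \<open>A coset of the integers has no element close to 0 except possibly 0 itself; for
  \<open>t\<close> outside \<open>\<int>\<close> its distance from 0 is the minimum of
  \<open>frac t\<close> and \<open>1 - frac t\<close>.\<close>

lemma Ints_translate_discrete:
  fixes t :: real
  obtains \<delta> where "\<delta> > 0" "\<And>n. n \<in> \<int> \<Longrightarrow> \<bar>t + n\<bar> < \<delta> \<Longrightarrow> t + n = 0"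
proof (cases "t \<in> \<int>")
  case True
  have "t + n = 0" if "n \<in> \<int>" "\<bar>t + n\<bar> < 1" for n
    using True that by (metis Ints_add Ints_nonzero_abs_less1)
  then show ?thesis using that [of 1] by simp
next
  case False
  have "\<not> \<bar>t + n\<bar> < min (frac t) (1 - frac t)" if "n \<in> \<int>" for n
  proof
    assume "\<bar>t + n\<bar> < min (frac t) (1 - frac t)"
    moreover obtain m :: int where "n = of_int m" using \<open>n \<in> \<int>\<close> by (auto elim: Ints_cases)
    ultimately have "\<bar>frac t + real_of_int (\<lfloor>t\<rfloor> + m)\<bar> < min (frac t) (1 - frac t)"
      by (simp add: frac_def)
    moreover have "\<lfloor>t\<rfloor> + m \<ge> 0 \<or> \<lfloor>t\<rfloor> + m \<le> -1" by linarith
    then have "real_of_int (\<lfloor>t\<rfloor> + m) \<ge> 0 \<or> real_of_int (\<lfloor>t\<rfloor> + m) \<le> -1" by linarith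
    ultimately show False by (auto simp: abs_less_iff)
  qed
  moreover have "min (frac t) (1 - frac t) > 0"
    using False frac_gt_0_iff frac_lt_1 by simp
  ultimately show ?thesis using that by blast
qed

lemma gaussian_ints_translate_discrete:
  obtains \<delta> where "\<delta> > 0" "\<And>a. a \<in> gaussian_ints \<Longrightarrow> norm (c + a) < \<delta> \<Longrightarrow> c + a = 0"
proof -
  obtain d1 where d1: "d1 > 0" "\<And>n. n \<in> \<int> \<Longrightarrow> \<bar>Re c + n\<bar> < d1 \<Longrightarrow> Re c + n = 0"
    using Ints_translate_discrete [of "Re c"] by metis
  obtain d2 where d2: "d2 > 0" "\<And>n. n \<in> \<int> \<Longrightarrow> \<bar>Im c + n\<bar> < d2 \<Longrightarrow> Im c + n = 0"
    using Ints_translate_discrete [of "Im c"] by metis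
  have "c + a = 0" if "a \<in> gaussian_ints" "norm (c + a) < min d1 d2" for a
    using that abs_Re_le_cmod [of "c + a"] abs_Im_le_cmod [of "c + a"] d1(2) [of "Re a"] d2(2) [of "Im a"]
    by (simp add: gaussian_ints_def complex_eq_iff)
  then show ?thesis using that [of "min d1 d2"] d1 d2 by simp
qed

lemma eq_power_cone_order:
  assumes "u ^ cone_order z = v ^ cone_order z"
  obtains k where "(\<i> ^ k) ^ cone_order z = 1" "u = \<i> ^ k * v"
proof -
  consider "cone_order z = 1" | "cone_order z = 2" | "cone_order z = 4" using cone_order_cases by blast
  then show ?thesis
  proof cases
    case 1
    then show ?thesis using that [of 0] assms by simp
  next
    case 2
    then have "u = v \<or> u = - v" using assms by (simp add: power2_eq_iff)
    then show ?thesis using that [of 0] that [of 2] 2 by auto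
  next
    case 3
    have "(u\<^sup>2)\<^sup>2 = (v\<^sup>2)\<^sup>2" using assms 3 by (simp flip: power_mult)
    then have "u\<^sup>2 = v\<^sup>2 \<or> u\<^sup>2 = - (v\<^sup>2)" by (simp only: power2_eq_iff)
    moreover have "- (v\<^sup>2) = (\<i> * v)\<^sup>2" by (simp add: power_mult_distrib)
    ultimately have "u\<^sup>2 = v\<^sup>2 \<or> u\<^sup>2 = (\<i> * v)\<^sup>2" by metis
    then have "u = v \<or> u = - v \<or> u = \<i> * v \<or> u = - (\<i> * v)" by (simp only: power2_eq_iff) blast
    then show ?thesis
      using that [of 0] that [of 1] that [of 2] that [of 3] 3
      by (auto simp: power3_eq_cube power4_eq_xxxx)
  qed
qed

text \<open>A group element taking one point of a small disc around \<open>z0\<close> to another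
  moves \<open>z0\<close> by less than \<open>2 * r\<close>, hence not at all, because orbits are
  discrete. What remains are the rotations about \<open>z0\<close> of order dividing
  \<open>cone_order z0\<close>, and the power identifies exactly their orbits.\<close>

lemma orbit_equiv_near:
  obtains r where "r > 0"
    "\<And>z w. z \<in> ball z0 r \<Longrightarrow> w \<in> ball z0 r \<Longrightarrow> orbit_equiv z w \<longleftrightarrow> (z - z0) ^ cone_order z0 = (w - z0) ^ cone_order z0"
proof -
  have "\<exists>\<delta>>0. \<forall>a\<in>gaussian_ints. norm ((\<i> ^ k * z0 - z0) + a) < \<delta> \<longrightarrow> (\<i> ^ k * z0 - z0) + a = 0" for k
    using gaussian_ints_translate_discrete [of "\<i> ^ k * z0 - z0"] by metis
  then obtain \<delta> where \<delta>: "\<And>k. \<delta> k > 0" "\<And>k a. a \<in> gaussian_ints \<Longrightarrow> norm ((\<i> ^ k * z0 - z0) + a) < \<delta> k \<Longrightarrow> (\<i> ^ k * z0 - z0) + a = 0"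
    by metis
  \<comment> \<open>Only four linear parts occur, so the gaps \<open>\<delta> k\<close> with
    \<open>k < 4\<close> have a positive minimum; it is halved because two points of the disc
    contribute.\<close>
  define r where "r = Min (\<delta> ` {..<4}) / 2"
  have min: "Min (\<delta> ` {..<4}) \<le> \<delta> k" if "k < 4" for k using that by (intro Min_le) auto
  have "Min (\<delta> ` {..<4}) > 0" using \<delta> by (subst Min_gr_iff) (auto simp: lessThan_empty_iff)
  then have r: "r > 0" by (simp add: r_def)
  have "orbit_equiv z w \<longleftrightarrow> (z - z0) ^ cone_order z0 = (w - z0) ^ cone_order z0"
    if zw: "z \<in> ball z0 r" "w \<in> ball z0 r" for z w
  proof
    assume "orbit_equiv z w"
    then obtain k a where a: "a \<in> gaussian_ints" "w = \<i> ^ k * z + a" by (auto simp: orbit_equiv_def)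
    define j where "j = k mod 4"
    have w: "w = \<i> ^ j * z + a" using a ii_power_mod_4 [of k] by (simp add: j_def)
    have "(\<i> ^ j * z0 - z0) + a = (w - z0) - \<i> ^ j * (z - z0)" by (simp add: w algebra_simps)
    also have "norm \<dots> \<le> norm (w - z0) + norm (\<i> ^ j * (z - z0))" by (rule norm_triangle_ineq4)
    also have "\<dots> = norm (w - z0) + norm (z - z0)" by (simp add: norm_mult norm_power)
    also have "\<dots> < r + r" using zw by (intro add_strict_mono) (auto simp: dist_norm norm_minus_commute)
    also have "r + r \<le> \<delta> j" using min [of j] by (simp add: r_def j_def)
    finally have 0: "(\<i> ^ j * z0 - z0) + a = 0" using \<delta>(2) a(1) by blast
    then have "\<i> ^ j * z0 - z0 = - a" by (simp add: eq_neg_iff_add_eq_0)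
    then have one: "(\<i> ^ j) ^ cone_order z0 = 1"
      using a(1) stabilizer_iff [of j z0] gaussian_ints_closed(5) by simp
    have "w - z0 = \<i> ^ j * (z - z0)" using 0 by (simp add: w algebra_simps)
    then show "(z - z0) ^ cone_order z0 = (w - z0) ^ cone_order z0"
      by (simp add: power_mult_distrib one)
  next
    assume "(z - z0) ^ cone_order z0 = (w - z0) ^ cone_order z0"
    then obtain k where k: "(\<i> ^ k) ^ cone_order z0 = 1" "w - z0 = \<i> ^ k * (z - z0)"
      using eq_power_cone_order [of "w - z0" z0 "z - z0"] by metis
    have "\<i> ^ k * z0 - z0 \<in> gaussian_ints" using k stabilizer_iff by blast
    then have "- (\<i> ^ k * z0 - z0) \<in> gaussian_ints" by (rule gaussian_ints_closed)
    moreover have "w = \<i> ^ k * z + - (\<i> ^ k * z0 - z0)" using k by (simp add: algebra_simps)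
    ultimately show "orbit_equiv z w" unfolding orbit_equiv_def by blast
  qed
  with r show ?thesis using that by blast
qed

lemma cone_order_pos: "cone_order z \<ge> 1"
  using cone_order_cases [of z] by auto

lemma open_image_power:
  fixes \<kappa> :: complex
  assumes "\<kappa> \<noteq> 0" "1 \<le> p" "open W"
  shows "open ((\<lambda>z. \<kappa> * (z - z0) ^ p) ` W)"
proof (rule open_mapping_thm [of _ UNIV])
  show "(\<lambda>z. \<kappa> * (z - z0) ^ p) holomorphic_on UNIV" by (intro holomorphic_intros)
  show "\<not> (\<lambda>z. \<kappa> * (z - z0) ^ p) constant_on UNIV"
  proof
    assume "(\<lambda>z. \<kappa> * (z - z0) ^ p) constant_on UNIV"
    then obtain c where c: "\<And>z. \<kappa> * (z - z0) ^ p = c" by (auto simp: constant_on_def)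
    show False using c [of z0] c [of "z0 + 1"] assms by (simp add: power_0_left)
  qed
qed (use assms in auto)

text \<open>The factor \<open>\<kappa>\<close> serves for normalization: with
  \<open>\<kappa> = l ^ p\<close> in the source, multiplication by \<open>l\<close> becomes an exact
  power. All small radii are offered because the source disc must shrink to fit into the target
  chart.\<close>

lemma pillow_cover_chart:
  assumes P: "pillow_cover E P" and \<kappa>: "\<kappa> \<noteq> 0"
  obtains R where "R > 0" "\<And>r. 0 < r \<Longrightarrow> r \<le> R \<Longrightarrow>
    \<exists>\<phi>. surface_chart E (P ` ball z0 r) \<phi> \<and> (\<forall>z\<in>ball z0 r. \<phi> (P z) = \<kappa> * (z - z0) ^ cone_order z0)"
proof -
  obtain R where R: "R > 0"
    "\<And>z w. z \<in> ball z0 R \<Longrightarrow> w \<in> ball z0 R \<Longrightarrow> orbit_equiv z w \<longleftrightarrow> (z - z0) ^ cone_order z0 = (w - z0) ^ cone_order z0"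
    by (rule orbit_equiv_near [of z0]) blast
  have "\<exists>\<phi>. surface_chart E (P ` ball z0 r) \<phi> \<and> (\<forall>z\<in>ball z0 r. \<phi> (P z) = \<kappa> * (z - z0) ^ cone_order z0)"
    if r: "0 < r" "r \<le> R" for r
  proof -
    have sub: "ball z0 r \<subseteq> ball z0 R" using r by auto
    obtain \<phi> where "surface_chart E (P ` ball z0 r) \<phi>" "\<And>z. z \<in> ball z0 r \<Longrightarrow> \<phi> (P z) = \<kappa> * (z - z0) ^ cone_order z0"
    proof (rule surface_chart_of_quotient [of E P "ball z0 r" "\<lambda>z. \<kappa> * (z - z0) ^ cone_order z0"])
      show "continuous_map euclidean E P" "open_map euclidean E P" using P by (auto simp: pillow_cover_def)
      show "P z = P w \<longleftrightarrow> \<kappa> * (z - z0) ^ cone_order z0 = \<kappa> * (w - z0) ^ cone_order z0"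
        if "z \<in> ball z0 r" "w \<in> ball z0 r" for z w
      proof -
        have "P z = P w \<longleftrightarrow> orbit_equiv z w" using P by (simp add: pillow_cover_def)
        also have "\<dots> \<longleftrightarrow> (z - z0) ^ cone_order z0 = (w - z0) ^ cone_order z0"
          using R(2) that sub by blast
        finally show ?thesis using \<kappa> by simp
      qed
      show "open ((\<lambda>z. \<kappa> * (z - z0) ^ cone_order z0) ` W)" if "open W" for W
        by (rule open_image_power [OF \<kappa> cone_order_pos that])
      show "continuous_on (ball z0 r) (\<lambda>z. \<kappa> * (z - z0) ^ cone_order z0)" by (intro continuous_intros)
    qed auto
    then show ?thesis by blast
  qed
  then show ?thesis using that R(1) by blast
qed

section \<open>Maps between spheres induced by multiplication\<close>

definition multiplication_map :: "(complex \<Rightarrow> 'a) \<Rightarrow> (complex \<Rightarrow> 'b) \<Rightarrow> complex \<Rightarrow> 'a \<Rightarrow> 'b" where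
  "multiplication_map P Q l e = Q (l * (SOME z. P z = e))"

lemma orbit_equiv_mult:
  assumes "l \<in> gaussian_ints" "orbit_equiv z w" shows "orbit_equiv (l * z) (l * w)"
proof -
  obtain k a where a: "a \<in> gaussian_ints" "w = \<i> ^ k * z + a" using assms by (auto simp: orbit_equiv_def)
  have "l * w = \<i> ^ k * (l * z) + l * a" by (simp add: a algebra_simps)
  then show ?thesis unfolding orbit_equiv_def using a assms gaussian_ints_closed by blast
qed

text \<open>Multiplication by a Gaussian integer sends orbits into orbits, so the arbitrary
  representative in the definition does not influence the value.\<close>

lemma multiplication_map_apply:
  assumes P: "pillow_cover E P" and Q: "pillow_cover B Q" and l: "l \<in> gaussian_ints"
  shows "multiplication_map P Q l (P z) = Q (l * z)"
proof -
  have "P (SOME w. P w = P z) = P z" by (rule someI) simp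
  then have "orbit_equiv (SOME w. P w = P z) z" using P by (simp add: pillow_cover_def)
  then show ?thesis
    using orbit_equiv_mult [OF l] Q by (simp add: multiplication_map_def pillow_cover_def)
qed

text \<open>In the coordinates \<open>l^p * (z - z0)^p\<close> and \<open>(w - l * z0)^q\<close> the
  map is the power with exponent \<open>q div p\<close>, as \<open>(l * (z - z0))^q\<close> is that
  power of the first coordinate.\<close>

lemma multiplication_map_locally_power:
  assumes P: "pillow_cover E P" and Q: "pillow_cover B Q" and l: "l \<in> gaussian_ints" "l \<noteq> 0"
  shows "locally_power E B (multiplication_map P Q l) (P z0) (cone_order (l * z0) div cone_order z0)"
proof -
  let ?f = "multiplication_map P Q l"
  define p q where pq: "p = cone_order z0" "q = cone_order (l * z0)"
  have dvd: "p dvd q" unfolding pq by (rule cone_order_dvd_mult [OF l(1)])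
  have p1: "p \<ge> 1" and q1: "q \<ge> 1" using cone_order_pos by (auto simp: pq)
  obtain R where R: "R > 0" "\<And>r. 0 < r \<Longrightarrow> r \<le> R \<Longrightarrow>
      \<exists>\<phi>. surface_chart E (P ` ball z0 r) \<phi> \<and> (\<forall>z\<in>ball z0 r. \<phi> (P z) = l ^ p * (z - z0) ^ p)"
    using pillow_cover_chart [OF P, of "l ^ p" z0] l unfolding pq by (metis power_not_zero)
  obtain S where S: "S > 0" "\<And>r. 0 < r \<Longrightarrow> r \<le> S \<Longrightarrow>
      \<exists>\<psi>. surface_chart B (Q ` ball (l * z0) r) \<psi> \<and> (\<forall>w\<in>ball (l * z0) r. \<psi> (Q w) = 1 * (w - l * z0) ^ q)"
    using pillow_cover_chart [OF Q, of 1 "l * z0"] unfolding pq by (metis zero_neq_one)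
  obtain \<psi> where \<psi>: "surface_chart B (Q ` ball (l * z0) S) \<psi>" "\<And>w. w \<in> ball (l * z0) S \<Longrightarrow> \<psi> (Q w) = (w - l * z0) ^ q"
    using S(2) [of S] S(1) by auto
  define r where "r = min R (S / norm l)"
  have r: "0 < r" "r \<le> R" "r \<le> S / norm l" using R S l by (auto simp: r_def)
  then obtain \<phi> where \<phi>: "surface_chart E (P ` ball z0 r) \<phi>" "\<And>z. z \<in> ball z0 r \<Longrightarrow> \<phi> (P z) = l ^ p * (z - z0) ^ p"
    using R(2) [of r] by blast
  have ball: "l * z \<in> ball (l * z0) S" if "z \<in> ball z0 r" for z
  proof -
    have "norm (z0 - z) < S / norm l" using that r by (simp add: dist_norm)
    then have "norm l * norm (z0 - z) < S" using l by (simp add: field_simps)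
    then show ?thesis by (simp add: dist_norm norm_mult flip: right_diff_distrib)
  qed
  have f: "?f (P z) = Q (l * z)" for z by (rule multiplication_map_apply [OF P Q l(1)])
  show ?thesis
    unfolding locally_power_def pq [symmetric]
  proof (intro conjI exI)
    show "1 \<le> q div p" using dvd p1 q1 by (auto elim!: dvdE)
    show "surface_chart E (P ` ball z0 r) \<phi>" "surface_chart B (Q ` ball (l * z0) S) \<psi>" by fact+
    show "P z0 \<in> P ` ball z0 r" using r by simp
    show "\<phi> (P z0) = 0" using \<phi>(2) [of z0] r p1 by simp
    show "?f (P z0) \<in> Q ` ball (l * z0) S" unfolding f using S by simp
    show "\<psi> (?f (P z0)) = 0" unfolding f using \<psi>(2) [of "l * z0"] S q1 by simp
    show "?f ` P ` ball z0 r \<subseteq> Q ` ball (l * z0) S" using f ball by auto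
    show "\<forall>u\<in>P ` ball z0 r. \<psi> (?f u) = \<phi> u ^ (q div p)"
    proof clarify
      fix z assume z: "z \<in> ball z0 r"
      have "\<psi> (?f (P z)) = (l * (z - z0)) ^ q"
        using \<psi>(2) [OF ball [OF z]] by (simp add: f algebra_simps)
      also have "\<dots> = ((l * (z - z0)) ^ p) ^ (q div p)"
        using dvd by (simp flip: power_mult)
      also have "(l * (z - z0)) ^ p = \<phi> (P z)" using \<phi>(2) [OF z] by (simp add: power_mult_distrib)
      finally show "\<psi> (?f (P z)) = \<phi> (P z) ^ (q div p)" .
    qed
  qed
qed

lemma multiplication_map_branched_cover:
  assumes P: "pillow_cover E P" and Q: "pillow_cover B Q" and l: "l \<in> gaussian_ints" "l \<noteq> 0"
    and E: "closed_orientable_surface E" and B: "closed_orientable_surface B"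
  shows "branched_cover E B (multiplication_map P Q l)"
proof -
  let ?f = "multiplication_map P Q l"
  have f: "?f (P z) = Q (l * z)" for z by (rule multiplication_map_apply [OF P Q l(1)])
  have ran: "topspace E = range P" using P by (simp add: pillow_cover_def)
  have "continuous_map E B ?f"
    unfolding continuous_map_def
  proof (intro conjI allI impI)
    show "?f \<in> topspace E \<rightarrow> topspace B" using f Q unfolding ran by (auto simp: pillow_cover_def)
    fix T assume T: "openin B T"
    have "openin euclidean {w \<in> topspace euclidean. Q w \<in> T}"
      using Q T openin_continuous_map_preimage [of euclidean B Q T] by (simp add: pillow_cover_def)
    then have "open ((\<lambda>z. l * z) -` {w. Q w \<in> T})" by (intro open_vimage continuous_intros) auto
    then have "openin E (P ` ((\<lambda>z. l * z) -` {w. Q w \<in> T}))"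
      using P by (auto simp: pillow_cover_def open_map_def)
    moreover have "{x \<in> topspace E. ?f x \<in> T} = P ` ((\<lambda>z. l * z) -` {w. Q w \<in> T})"
      unfolding ran using f by auto
    ultimately show "openin E {x \<in> topspace E. ?f x \<in> T}" by simp
  qed
  then show ?thesis
    unfolding branched_cover_def ran using E B multiplication_map_locally_power [OF P Q l] by blast
qed

lemma multiplication_map_local_degree:
  assumes "pillow_cover E P" "pillow_cover B Q" "l \<in> gaussian_ints" "l \<noteq> 0"
  shows "local_degree E B (multiplication_map P Q l) (P z) = cone_order (l * z) div cone_order z"
  using multiplication_map_locally_power [OF assms] by (rule local_degree_eq)

section \<open>Counting the points of a fibre with multiplicity\<close>

definition of_gauss :: "int \<times> int \<Rightarrow> complex" where
  "of_gauss p = Complex (of_int (fst p)) (of_int (snd p))"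

lemma of_gauss_diff: "of_gauss (p - q) = of_gauss p - of_gauss q"
  by (simp add: of_gauss_def complex_eq_iff)

lemma gaussian_ints_eq_range: "gaussian_ints = range of_gauss"
proof (intro equalityI subsetI)
  fix z assume "z \<in> gaussian_ints"
  then obtain m n :: int where "Re z = of_int m" "Im z = of_int n" by (auto simp: gaussian_ints_def elim!: Ints_cases)
  then have "z = of_gauss (m, n)" by (simp add: of_gauss_def complex_eq_iff)
  then show "z \<in> range of_gauss" by blast
qed (auto simp: of_gauss_def gaussian_ints_def)

lemma of_gauss_divide_gaussian_int:
  assumes "of_gauss (x, y) \<noteq> 0"
  shows "of_gauss p / of_gauss (x, y) \<in> gaussian_ints \<longleftrightarrow> p \<in> gauss_ideal x y"
proof -
  have inj: "of_gauss p = of_gauss q \<longleftrightarrow> p = q" for p q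
    by (auto simp: of_gauss_def prod_eq_iff)
  have mult: "of_gauss (m, n) * of_gauss (x, y) = of_gauss (m * x - n * y, m * y + n * x)" for m n
    by (simp add: of_gauss_def complex_eq_iff)
  have "of_gauss p / of_gauss (x, y) \<in> gaussian_ints \<longleftrightarrow> (\<exists>q. of_gauss p / of_gauss (x, y) = of_gauss q)"
    unfolding gaussian_ints_eq_range by (simp add: image_iff)
  also have "\<dots> \<longleftrightarrow> (\<exists>m n. of_gauss p = of_gauss (m, n) * of_gauss (x, y))"
    using assms by (simp add: divide_eq_eq)
  also have "\<dots> \<longleftrightarrow> p \<in> gauss_ideal x y" by (simp add: mult inj gauss_ideal_eq)
  finally show ?thesis .
qed

text \<open>A point of the torus \<open>\<complex> / \<int>[\<i>]\<close> is represented by its representative in the unit square.\<close>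

definition torus_rep :: "complex \<Rightarrow> complex" where
  "torus_rep z = Complex (frac (Re z)) (frac (Im z))"

lemma frac_eq_iff: "frac x = frac y \<longleftrightarrow> x - y \<in> \<int>" for x y :: real
proof
  assume "frac x = frac y"
  then have "x - y = of_int (\<lfloor>x\<rfloor> - \<lfloor>y\<rfloor>)" by (simp add: frac_def)
  then show "x - y \<in> \<int>" by (metis Ints_of_int)
next
  assume "x - y \<in> \<int>"
  then obtain n :: int where "x = y + of_int n" by (metis Ints_cases add.commute diff_add_cancel)
  then show "frac x = frac y" by (simp add: frac_def)
qed

lemma torus_rep_eq_iff: "torus_rep z = torus_rep w \<longleftrightarrow> z - w \<in> gaussian_ints"
  by (simp add: torus_rep_def gaussian_ints_def frac_eq_iff)

lemma pillow_cover_torus_rep: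
  assumes "pillow_cover E P" shows "P (torus_rep z) = P z"
proof -
  have "orbit_equiv (torus_rep z) z"
    by (rule orbit_equivI(1)) (simp add: torus_rep_def gaussian_ints_def frac_def)
  then show ?thesis using assms by (simp add: pillow_cover_def)
qed

text \<open>Orbit and stabilizer on the torus: the roots of unity of order dividing
  \<open>cone_order w\<close> act on the class of \<open>z\<close>, and those of order dividing
  \<open>cone_order z\<close> fix it.\<close>

lemma card_torus_rotations:
  assumes dvd: "cone_order z dvd cone_order w"
  shows "card {torus_rep (\<i> ^ k * z) | k. (\<i> ^ k) ^ cone_order w = 1} = cone_order w div cone_order z"
proof -
  have eq: "torus_rep (\<i> ^ k * z) = torus_rep (\<i> ^ l * z) \<longleftrightarrow> (\<i> ^ (k - l)) ^ cone_order z = 1" if "l \<le> k" for k l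
  proof -
    have "\<i> ^ k * z - \<i> ^ l * z = \<i> ^ l * (\<i> ^ (k - l) * z - z)"
      using that by (simp add: algebra_simps flip: power_add)
    then show ?thesis by (simp add: torus_rep_eq_iff ii_power_gaussian_ints_iff stabilizer_iff)
  qed
  define t where "t k = torus_rep (\<i> ^ k * z)" for k
  have "{torus_rep (\<i> ^ k * z) | k. (\<i> ^ k) ^ cone_order w = 1} = t ` {k. k < 4 \<and> (\<i> ^ k) ^ cone_order w = 1}"
  proof (intro equalityI subsetI)
    fix u assume "u \<in> {torus_rep (\<i> ^ k * z) | k. (\<i> ^ k) ^ cone_order w = 1}"
    then obtain k where "u = torus_rep (\<i> ^ k * z)" "(\<i> ^ k) ^ cone_order w = 1" by auto
    then have "u = t (k mod 4)" "(\<i> ^ (k mod 4)) ^ cone_order w = 1" "k mod 4 < 4"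
      using ii_power_mod_4 [of k] by (simp_all add: t_def)
    then show "u \<in> t ` {k. k < 4 \<and> (\<i> ^ k) ^ cone_order w = 1}" by blast
  qed (auto simp: t_def)
  moreover have "{k. k < 4 \<and> (\<i> ^ k) ^ cone_order w = 1} =
      (if cone_order w = 4 then {0, 1, 2, 3} else if cone_order w = 2 then {0, 2} else {0})"
  proof -
    have lt4: "k < 4 \<longleftrightarrow> k = 0 \<or> k = 1 \<or> k = 2 \<or> k = 3" for k :: nat by auto
    have i: "\<i> ^ 3 = - \<i>" "- \<i> \<noteq> 1" "\<i> \<noteq> 1" by (auto simp: power3_eq_cube complex_eq_iff)
    consider "cone_order w = 1" | "cone_order w = 2" | "cone_order w = 4" using cone_order_cases by blast
    then show ?thesis
    proof cases
      case 1
      have "(\<i> ^ k) ^ 1 = 1 \<longleftrightarrow> k = 0" if "k < 4" for k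
        using that i unfolding lt4 by (elim disjE) simp_all
      then show ?thesis unfolding 1 by auto
    next
      case 2
      have "(\<i> ^ k)\<^sup>2 = 1 \<longleftrightarrow> k = 0 \<or> k = 2" if "k < 4" for k
        using that i unfolding lt4 by (elim disjE) simp_all
      then show ?thesis unfolding 2 by auto
    next
      case 3
      have "(\<i> ^ k) ^ 4 = 1" if "k < 4" for k
        using that i unfolding lt4 by (elim disjE) simp_all
      then show ?thesis unfolding 3 using lt4 by auto
    qed
  qed
  moreover have "card (t ` (if cone_order w = 4 then {0, 1, 2, 3} else if cone_order w = 2 then {0, 2} else {0})) =
      cone_order w div cone_order z"
  proof -
    have i: "\<i> ^ 3 = - \<i>" "- \<i> \<noteq> 1" "\<i> \<noteq> 1" "(\<i>::complex) ^ 4 = 1" by (auto simp: power3_eq_cube complex_eq_iff)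
    \<comment> \<open>Two rotations of \<open>z\<close> agree iff their quotient stabilizes
      \<open>z\<close>: an odd number of quarter turns does so only for order 4, a half turn for
      orders 2 and 4.\<close>
    have t10: "t 1 = t 0 \<longleftrightarrow> cone_order z = 4" and t20: "t 2 = t 0 \<longleftrightarrow> cone_order z \<noteq> 1"
      and t30: "t 3 = t 0 \<longleftrightarrow> cone_order z = 4" and t21: "t 2 = t 1 \<longleftrightarrow> cone_order z = 4"
      and t31: "t 3 = t 1 \<longleftrightarrow> cone_order z \<noteq> 1" and t32: "t 3 = t 2 \<longleftrightarrow> cone_order z = 4"
      unfolding t_def using eq [of 0 1] eq [of 0 2] eq [of 0 3] eq [of 1 2] eq [of 1 3] eq [of 2 3] i
        cone_order_cases [of z] by (auto simp: power2_eq_square numeral_3_eq_3)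
    consider "cone_order w = 1" | "cone_order w = 2" | "cone_order w = 4" using cone_order_cases by blast
    then show ?thesis
    proof cases
      case 1
      then show ?thesis using dvd by simp
    next
      case 2
      then have "cone_order z = 1 \<or> cone_order z = 2" using dvd cone_order_cases [of z] by auto
      then show ?thesis using 2 t20 by (auto simp: card_insert_if)
    next
      case 3
      have "card {t 0, t 1, t 2, t 3} = 4 div cone_order z"
      proof -
        consider "cone_order z = 1" | "cone_order z = 2" | "cone_order z = 4" using cone_order_cases by blast
        then show ?thesis
        proof cases
          case 1
          then have "t 1 \<noteq> t 0" "t 2 \<noteq> t 0" "t 3 \<noteq> t 0" "t 2 \<noteq> t 1" "t 3 \<noteq> t 1" "t 3 \<noteq> t 2"
            using t10 t20 t30 t21 t31 t32 by simp_all
          then have "distinct [t 3, t 2, t 1, t 0]" by simp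
          from distinct_card [OF this] show ?thesis using 1 by (simp add: insert_commute)
        next
          case 2
          then have "t 1 \<noteq> t 0" "t 2 = t 0" "t 3 = t 1" using t10 t20 t31 by simp_all
          then have "{t 0, t 1, t 2, t 3} = {t 0, t 1}" by auto
          then show ?thesis using 2 \<open>t 1 \<noteq> t 0\<close> by simp
        next
          case 3
          then have "t 1 = t 0" "t 2 = t 0" "t 3 = t 0" using t10 t20 t30 by simp_all
          then show ?thesis using 3 by simp
        qed
      qed
      with 3 show ?thesis by simp
    qed
  qed
  ultimately show ?thesis by simp
qed

text \<open>The equation \<open>l * u = w\<close> has \<open>x^2 + y^2\<close> solutions on the
  torus, namely \<open>(w + p) / l\<close> for \<open>p\<close> modulo the ideal of
  \<open>l\<close>. They project onto the fibre, and the number of solutions over a point is its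
  local degree.\<close>

lemma multiplication_map_fibre:
  fixes x y :: int
  assumes P: "pillow_cover E P" and Q: "pillow_cover B Q" and l: "l = of_gauss (x, y)" "l \<noteq> 0"
  defines "f \<equiv> multiplication_map P Q l"
  shows "finite (fibre E f (Q w))" "int (\<Sum>e\<in>fibre E f (Q w). local_degree E B f e) = x\<^sup>2 + y\<^sup>2"
    "\<And>z. P z \<in> fibre E f (Q w) \<Longrightarrow> local_degree E B f (P z) = cone_order w div cone_order z"
proof -
  have lg: "l \<in> gaussian_ints" using l gaussian_ints_eq_range by blast
  have f: "f (P z) = Q (l * z)" for z unfolding f_def by (rule multiplication_map_apply [OF P Q lg])
  have Peq: "P z = P z' \<longleftrightarrow> orbit_equiv z z'" and Qeq: "Q z = Q z' \<longleftrightarrow> orbit_equiv z z'" for z z'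
    using P Q by (auto simp: pillow_cover_def)
  define F where "F p = torus_rep ((w + of_gauss p) / l)" for p
  have F_eq: "F p = F q \<longleftrightarrow> p - q \<in> gauss_ideal x y" for p q
  proof -
    have "(w + of_gauss p) / l - (w + of_gauss q) / l = of_gauss (p - q) / of_gauss (x, y)"
      by (simp add: of_gauss_diff l diff_divide_distrib [symmetric])
    then show ?thesis
      using of_gauss_divide_gaussian_int l unfolding F_def torus_rep_eq_iff by simp
  qed
  have xy: "(x, y) \<noteq> (0, 0)" using l by (auto simp: of_gauss_def complex_eq_iff)
  have fin: "finite (range F)" and card: "int (card (range F)) = x\<^sup>2 + y\<^sup>2"
    using card_gauss_ideal_cosets [OF xy F_eq] by auto
  have mem_F: "torus_rep u \<in> range F" if u: "l * u - w \<in> gaussian_ints" for u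
  proof -
    obtain p where "l * u - w = of_gauss p" using u unfolding gaussian_ints_eq_range by (elim rangeE)
    then have "u = (w + of_gauss p) / l" using l(2) by (simp add: field_simps)
    then show ?thesis unfolding F_def by blast
  qed
  have fib: "fibre E f (Q w) = P ` range F"
  proof (intro equalityI subsetI)
    fix e assume "e \<in> fibre E f (Q w)"
    then have "e \<in> range P" "f e = Q w" using P by (auto simp: fibre_def pillow_cover_def)
    then obtain z where z: "e = P z" "Q (l * z) = Q w" using f by auto
    then obtain k a where a: "a \<in> gaussian_ints" "w = \<i> ^ k * (l * z) + a" unfolding Qeq by (auto simp: orbit_equiv_def)
    have "l * (\<i> ^ k * z) - w = - a" by (simp add: a)
    then have "torus_rep (\<i> ^ k * z) \<in> range F" using mem_F a gaussian_ints_closed by metis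
    moreover have "P (torus_rep (\<i> ^ k * z)) = e"
      unfolding pillow_cover_torus_rep [OF P] z Peq
      by (rule orbit_equiv_sym) (auto simp: orbit_equiv_def gaussian_ints_closed intro!: exI [of _ k] bexI [of _ 0])
    ultimately show "e \<in> P ` range F" by blast
  next
    fix e assume "e \<in> P ` range F"
    then obtain p where "e = P (F p)" by blast
    then have e: "e = P ((w + of_gauss p) / l)" unfolding F_def by (simp add: pillow_cover_torus_rep [OF P])
    have "f e = Q (w + of_gauss p)" unfolding e f using l by simp
    also have "\<dots> = Q w" unfolding Qeq
      by (rule orbit_equiv_sym, rule orbit_equivI(1)) (auto simp: gaussian_ints_eq_range)
    finally have "f e = Q w" .
    moreover have "e \<in> topspace E" using P e by (auto simp: pillow_cover_def)
    ultimately show "e \<in> fibre E f (Q w)" by (simp add: fibre_def)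
  qed
  show "finite (fibre E f (Q w))" unfolding fib using fin by simp
  have deg: "local_degree E B f (P z) = cone_order w div cone_order z" if "P z \<in> fibre E f (Q w)" for z
  proof -
    have "orbit_equiv (l * z) w" using that unfolding fibre_def by (simp add: f Qeq)
    then have "cone_order (l * z) = cone_order w" by (rule cone_order_orbit_equiv)
    then show ?thesis
      using multiplication_map_local_degree [OF P Q lg l(2), of z] by (simp add: f_def)
  qed
  then show "\<And>z. P z \<in> fibre E f (Q w) \<Longrightarrow> local_degree E B f (P z) = cone_order w div cone_order z" .
  have cardF: "card {u \<in> range F. P u = e} = local_degree E B f e" if e: "e \<in> P ` range F" for e
  proof -
    obtain z where z: "e = P z" "l * z - w \<in> gaussian_ints"
    proof -
      obtain p where "e = P (F p)" using e by blast
      then have "e = P ((w + of_gauss p) / l)" unfolding F_def by (simp add: pillow_cover_torus_rep [OF P])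
      moreover have "l * ((w + of_gauss p) / l) - w \<in> gaussian_ints" using l(2) by (simp add: gaussian_ints_eq_range)
      ultimately show ?thesis using that by blast
    qed
    have ow: "cone_order (l * z) = cone_order w"
      using z by (intro cone_order_orbit_equiv orbit_equiv_sym [OF orbit_equivI(1)])
    \<comment> \<open>The solutions over \<open>e\<close> are rotations of one solution
      \<open>z\<close>, and a rotation of \<open>z\<close> is again a solution iff it fixes the
      class of \<open>w\<close>.\<close>
    have "{u \<in> range F. P u = e} = {torus_rep (\<i> ^ k * z) | k. (\<i> ^ k) ^ cone_order w = 1}"
    proof (intro equalityI subsetI)
      fix u assume "u \<in> {u \<in> range F. P u = e}"
      then obtain p where u: "u = F p" "P u = P z" using z by auto
      define v where "v = (w + of_gauss p) / l"
      have uv: "u = torus_rep v" by (simp add: u F_def v_def)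
      then have "P z = P v" using u pillow_cover_torus_rep [OF P, of v] by simp
      then obtain k a where a: "a \<in> gaussian_ints" "v = \<i> ^ k * z + a" unfolding Peq by (auto simp: orbit_equiv_def)
      have lv: "l * v - w \<in> gaussian_ints" using l(2) by (simp add: v_def gaussian_ints_eq_range)
      have "\<i> ^ k * w - w = (l * v - w) - l * a - \<i> ^ k * (l * z - w)" by (simp add: a algebra_simps)
      moreover have "\<i> ^ k * (l * z - w) \<in> gaussian_ints" using z ii_power_gaussian_ints_iff by blast
      ultimately have "\<i> ^ k * w - w \<in> gaussian_ints"
        using gaussian_ints_closed lv a(1) lg by metis
      then have "(\<i> ^ k) ^ cone_order w = 1" by (simp add: stabilizer_iff)
      moreover have "u = torus_rep (\<i> ^ k * z)" unfolding uv torus_rep_eq_iff using a by simp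
      ultimately show "u \<in> {torus_rep (\<i> ^ k * z) | k. (\<i> ^ k) ^ cone_order w = 1}" by blast
    next
      fix u assume "u \<in> {torus_rep (\<i> ^ k * z) | k. (\<i> ^ k) ^ cone_order w = 1}"
      then obtain k where k: "u = torus_rep (\<i> ^ k * z)" "(\<i> ^ k) ^ cone_order w = 1" by blast
      have "\<i> ^ k * w - w \<in> gaussian_ints" using k by (simp add: stabilizer_iff)
      moreover have "\<i> ^ k * (l * z - w) \<in> gaussian_ints" using z ii_power_gaussian_ints_iff by blast
      moreover have "l * (\<i> ^ k * z) - w = \<i> ^ k * (l * z - w) + (\<i> ^ k * w - w)" by (simp add: algebra_simps)
      ultimately have "l * (\<i> ^ k * z) - w \<in> gaussian_ints" using gaussian_ints_closed by metis
      then have "u \<in> range F" unfolding k using mem_F by blast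
      moreover have "P u = e"
        unfolding k z pillow_cover_torus_rep [OF P] Peq
        by (rule orbit_equiv_sym) (auto simp: orbit_equiv_def gaussian_ints_closed intro!: exI [of _ k] bexI [of _ 0])
      ultimately show "u \<in> {u \<in> range F. P u = e}" by blast
    qed
    moreover have "cone_order z dvd cone_order w"
      using cone_order_dvd_mult [OF lg, of z] ow by simp
    ultimately have "card {u \<in> range F. P u = e} = cone_order w div cone_order z"
      using card_torus_rotations by simp
    also have "\<dots> = local_degree E B f e" using deg [of z] e unfolding fib z by simp
    finally show ?thesis .
  qed
  have "card (range F) = (\<Sum>e\<in>P ` range F. card {u \<in> range F. P u = e})"
    unfolding card_eq_sum by (rule sum.image_gen [OF fin])
  also have "\<dots> = (\<Sum>e\<in>P ` range F. local_degree E B f e)" by (intro sum.cong refl cardF)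
  finally show "int (\<Sum>e\<in>fibre E f (Q w). local_degree E B f e) = x\<^sup>2 + y\<^sup>2"
    using card fib by simp
qed

section \<open>Multiplication maps\<close>

text \<open>With 0, the points \<open>cone4\<close> and \<open>cone2\<close> are the vertices of the
  triangle of the tiling; they represent the three orbits with nontrivial stabilizer.\<close>

definition cone4 :: complex where "cone4 = (1 + \<i>) / 2"
definition cone2 :: complex where "cone2 = 1 / 2"

lemma minus_half_not_Ints: "(- 1 / 2 :: real) \<notin> \<int>"
proof -
  have "(1 / 2 :: real) \<notin> \<int>"
    using frac_eq_0_iff [of "1/2 :: real"] frac_eq [of "1/2 :: real"] by simp
  then show ?thesis using Ints_minus [of "- 1 / 2 :: real"] by auto
qed

lemma cone_order_cone_points: "cone_order 0 = 4" "cone_order cone4 = 4" "cone_order cone2 = 2"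
  by (auto simp: cone_order_def cone4_def cone2_def gaussian_ints_def minus_half_not_Ints)

lemma orbit_equiv_0_iff: "orbit_equiv 0 z \<longleftrightarrow> z \<in> gaussian_ints"
  by (auto simp: orbit_equiv_def)

lemma not_orbit_equiv_cone4: "\<not> orbit_equiv 0 cone4"
  by (simp add: orbit_equiv_0_iff cone4_def gaussian_ints_def minus_half_not_Ints)

lemma half_integer_cases:
  assumes "2 * x \<in> \<int>" obtains "x \<in> \<int>" | "x - 1 / 2 \<in> (\<int> :: real set)"
proof -
  obtain n :: int where n: "2 * x = of_int n" using assms by (auto elim: Ints_cases)
  show ?thesis
  proof (cases "even n")
    case True
    then obtain m where "n = 2 * m" by blast
    then have "x = of_int m" using n by simp
    then show ?thesis using that by simp
  next
    case False
    then obtain m where "n = 2 * m + 1" by (auto elim: oddE)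
    then have "x - 1 / 2 = of_int m" using n by simp
    then show ?thesis using that by (metis Ints_of_int)
  qed
qed

lemma orbit_equiv_cone_point:
  assumes "cone_order z \<noteq> 1"
  shows "orbit_equiv 0 z \<or> orbit_equiv cone4 z \<or> orbit_equiv cone2 z"
proof -
  have z: "2 * z \<in> gaussian_ints" using assms cone_order_4_imp [of z] by (auto simp: cone_order_def split: if_splits)
  then have "2 * Re z \<in> \<int>" "2 * Im z \<in> \<int>" by (auto simp: gaussian_ints_def)
  then consider "Re z \<in> \<int>" "Im z \<in> \<int>" | "Re z - 1 / 2 \<in> \<int>" "Im z - 1 / 2 \<in> \<int>"
    | "Re z - 1 / 2 \<in> \<int>" "Im z \<in> \<int>" | "Re z \<in> \<int>" "Im z - 1 / 2 \<in> \<int>"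
    by (metis half_integer_cases)
  then show ?thesis
  proof cases
    case 1
    then show ?thesis by (simp add: orbit_equiv_0_iff gaussian_ints_def)
  next
    case 2
    then have "orbit_equiv cone4 z" by (intro orbit_equivI(1)) (simp add: gaussian_ints_def cone4_def)
    then show ?thesis by simp
  next
    case 3
    then have "orbit_equiv cone2 z" by (intro orbit_equivI(1)) (simp add: gaussian_ints_def cone2_def)
    then show ?thesis by simp
  next
    case 4
    \<comment> \<open>\<open>\<i> / 2\<close> is a quarter turn of \<open>1 / 2\<close>, so this is
      the orbit of \<open>cone2\<close> again.\<close>
    then have "orbit_equiv cone2 z" by (intro orbit_equivI(3)) (simp add: gaussian_ints_def cone2_def)
    then show ?thesis by simp
  qed
qed

lemma image_mset_const_off:
  assumes "finite A" "S \<subseteq> A" "\<And>x. x \<in> A - S \<Longrightarrow> g x = c"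
  shows "image_mset g (mset_set A) = replicate_mset (card (A - S)) c + image_mset g (mset_set S)"
proof -
  have fin: "finite S" "finite (A - S)" using assms finite_subset by auto
  have "mset_set A = mset_set (A - S) + mset_set S"
    using assms(2) fin by (metis Diff_disjoint Diff_partition Int_commute Un_commute mset_set_Union)
  moreover have "image_mset g (mset_set (A - S)) = image_mset (\<lambda>_. c) (mset_set (A - S))"
    using assms fin by (intro image_mset_cong) auto
  ultimately show ?thesis by (simp add: image_mset_const_eq)
qed

text \<open>The cover is multiplication by \<open>x + y \<i>\<close>. Over \<open>Q w\<close> all
  local degrees equal \<open>cone_order w\<close> except at the three cone points of the source.
  Parity decides where these go: each keeps its orbit, or \<open>cone4\<close> goes to 0 and
  \<open>cone2\<close> to \<open>cone4\<close>, or all go to 0. The remaining multiplicities are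
  forced by the degree.\<close>

theorem realizable_if_sum_two_squares:
  fixes E :: "'a topology" and B :: "'b topology" and x y :: nat
  assumes E: "E homeomorphic_space S2" and B: "B homeomorphic_space S2"
    and k: "1 \<le> k" and shape: "cand_shape k d R" and d: "d = x\<^sup>2 + y\<^sup>2"
  shows "realizable E B d R"
proof -
  obtain P where P: "pillow_cover E P" using pillow_cover_exists [OF E] .
  obtain Q where Q: "pillow_cover B Q" using pillow_cover_exists [OF B] .
  have surf: "closed_orientable_surface E" "closed_orientable_surface B"
    using E B closed_orientable_surface_if_S2 by auto
  define l where "l = of_gauss (int x, int y)"
  have "d > 0" using shape k by (auto simp: cand_shape_def)
  then have l0: "l \<noteq> 0" using d by (auto simp: l_def of_gauss_def complex_eq_iff)
  have lg: "l \<in> gaussian_ints" unfolding gaussian_ints_eq_range l_def by blast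
  define f where "f = multiplication_map P Q l"
  have f: "f (P z) = Q (l * z)" for z unfolding f_def by (rule multiplication_map_apply [OF P Q lg])
  have Peq: "P z = P z' \<longleftrightarrow> orbit_equiv z z'" and Qeq: "Q z = Q z' \<longleftrightarrow> orbit_equiv z z'" for z z'
    using P Q by (auto simp: pillow_cover_def)
  have ran: "topspace E = range P" "topspace B = range Q" using P Q by (auto simp: pillow_cover_def)
  have fib: "finite (fibre E f (Q w))" "(\<Sum>e\<in>fibre E f (Q w). local_degree E B f e) = d"
    "\<And>z. P z \<in> fibre E f (Q w) \<Longrightarrow> local_degree E B f (P z) = cone_order w div cone_order z" for w
  proof -
    show "finite (fibre E f (Q w))" unfolding f_def by (rule multiplication_map_fibre(1) [OF P Q l_def l0])
    show "local_degree E B f (P z) = cone_order w div cone_order z" if "P z \<in> fibre E f (Q w)" for z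
      using that unfolding f_def by (rule multiplication_map_fibre(3) [OF P Q l_def l0])
    have "int (\<Sum>e\<in>fibre E f (Q w). local_degree E B f e) = int d"
      using multiplication_map_fibre(2) [OF P Q l_def l0, of w] d by (simp add: f_def)
    then show "(\<Sum>e\<in>fibre E f (Q w). local_degree E B f e) = d" by (simp only: of_nat_eq_iff)
  qed
  have memfib: "P z \<in> fibre E f (Q w) \<longleftrightarrow> orbit_equiv (l * z) w" for z w
    by (auto simp: fibre_def ran f Qeq)
  have bc: "branched_cover E B f"
    unfolding f_def by (rule multiplication_map_branched_cover [OF P Q lg l0 surf])
  \<comment> \<open>away from the images of the cone points all local degrees over \<open>Q w\<close> are \<open>cone_order w\<close>\<close>
  define C where "C = {P 0, P cone4, P cone2}"
  have off: "local_degree E B f e = cone_order w" if "e \<in> fibre E f (Q w) - C" for e w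
  proof -
    have "e \<in> range P" using that by (simp add: fibre_def ran)
    then obtain z where z: "e = P z" by (rule rangeE)
    have "cone_order z = 1"
    proof (rule ccontr)
      assume "cone_order z \<noteq> 1"
      then have "P z \<in> C" using orbit_equiv_cone_point [of z] by (auto simp: C_def Peq [symmetric])
      then show False using that z by simp
    qed
    then show ?thesis using fib(3) [of z w] that z by simp
  qed
  have degs: "\<exists>m. local_degrees E B f (Q w) = replicate_mset m (cone_order w) + image_mset (local_degree E B f) (mset_set (C \<inter> fibre E f (Q w)))
      \<and> m * cone_order w + (\<Sum>e\<in>C \<inter> fibre E f (Q w). local_degree E B f e) = d" for w
  proof -
    let ?F = "fibre E f (Q w)"
    have "local_degrees E B f (Q w) = replicate_mset (card (?F - (C \<inter> ?F))) (cone_order w) + image_mset (local_degree E B f) (mset_set (C \<inter> ?F))"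
      unfolding local_degrees_def by (rule image_mset_const_off) (use fib(1) off in auto)
    moreover have "sum_mset (local_degrees E B f (Q w)) = d"
      unfolding local_degrees_def using fib(2) [of w] by (simp add: sum_unfold_sum_mset)
    ultimately show ?thesis by (metis sum_mset.union sum_mset_replicate_mset sum_unfold_sum_mset of_nat_id)
  qed
  have one: "local_degree E B f e = 1" if "cone_order w = 1" "e \<in> fibre E f (Q w)" for e w
  proof -
    have "e \<in> range P" using that by (simp add: fibre_def ran)
    then obtain z where z: "e = P z" by (rule rangeE)
    have "cone_order z dvd 1"
      using cone_order_dvd_mult [OF lg, of z] cone_order_orbit_equiv [of "l * z" w] that memfib z by simp
    then show ?thesis using fib(3) [of z w] that z by simp
  qed
  have br_sub: "branching_points E B f \<subseteq> {Q 0, Q cone4, Q cone2}"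
  proof
    fix b assume b: "b \<in> branching_points E B f"
    then obtain w where w: "b = Q w" by (auto simp: branching_points_def ran)
    have "cone_order w \<noteq> 1" using b one by (auto simp: branching_points_def w)
    then show "b \<in> {Q 0, Q cone4, Q cone2}" using orbit_equiv_cone_point [of w] by (auto simp: w Qeq [symmetric])
  qed
  have dist: "P 0 \<noteq> P cone4" "P 0 \<noteq> P cone2" "P cone4 \<noteq> P cone2" "Q 0 \<noteq> Q cone4" "Q 0 \<noteq> Q cone2" "Q cone4 \<noteq> Q cone2"
    unfolding Peq Qeq using not_orbit_equiv_cone4 cone_order_orbit_equiv [of 0 cone2] cone_order_orbit_equiv [of cone4 cone2]
    by (auto simp: cone_order_cone_points)
  have deg_ge: "\<exists>e\<in>fibre E f b. 1 < local_degree E B f e" if a: "a \<in># local_degrees E B f b" "1 < a" for a b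
  proof -
    obtain e where "e \<in># mset_set (fibre E f b)" "a = local_degree E B f e"
      using a(1) unfolding local_degrees_def by auto
    then show ?thesis using a(2) by (cases "finite (fibre E f b)") auto
  qed
  \<comment> \<open>Every partition of the shape has a part above 1, so the three candidate points
    really branch.\<close>
  have main: "realizable E B d R"
    if D: "R = {# local_degrees E B f (Q cone2), local_degrees E B f (Q 0), local_degrees E B f (Q cone4) #}"
  proof -
    have "\<forall>p\<in>#R. \<exists>a\<in>#p. 1 < a" using shape_induced_orders(1) [OF k shape] by blast
    then have "Q w \<in> branching_points E B f" if "w \<in> {0, cone4, cone2}" for w
      using that deg_ge unfolding D branching_points_def ran by auto
    then have br: "branching_points E B f = {Q 0, Q cone4, Q cone2}" using br_sub by blast
    have "has_degree E B f d"
      unfolding has_degree_def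
    proof
      fix b assume b: "b \<in> topspace B - branching_points E B f"
      then obtain w where w: "b = Q w" by (auto simp: ran)
      have "cone_order w = 1"
      proof (rule ccontr)
        assume "cone_order w \<noteq> 1"
        then have "Q w \<in> {Q 0, Q cone4, Q cone2}"
          using orbit_equiv_cone_point [of w] by (auto simp: Qeq [symmetric])
        then show False using b by (simp add: br w)
      qed
      then show "finite (fibre E f b) \<and> card (fibre E f b) = d"
        using fib(1) [of w] fib(2) [of w] one [of w] unfolding w by simp
    qed
    moreover have "size R = 3" unfolding D by simp
    moreover have "image_mset (local_degrees E B f) (mset_set (branching_points E B f)) = R"
      unfolding br D using dist by (simp add: add_mset_commute)
    ultimately show ?thesis
      unfolding realizable_def using bc dist by (intro exI [of _ f]) (simp add: br)
  qed
  have f0: "P 0 \<in> fibre E f (Q w) \<longleftrightarrow> Q 0 = Q w" for w by (simp add: memfib Qeq)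
  have f4: "P cone4 \<in> fibre E f (Q w) \<longleftrightarrow> Q (l * cone4) = Q w" for w by (simp add: memfib Qeq)
  have f2: "P cone2 \<in> fibre E f (Q w) \<longleftrightarrow> Q (l * cone2) = Q w" for w by (simp add: memfib Qeq)
  have lc: "l * cone4 = Complex ((real x - real y) / 2) ((real x + real y) / 2)" "l * cone2 = Complex (real x / 2) (real y / 2)"
    by (simp_all add: l_def of_gauss_def cone4_def cone2_def complex_eq_iff field_simps)
  have int_even: "real_of_int n / 2 \<in> \<int>" if "even n" for n using that by (auto elim!: evenE)
  have int_odd: "real_of_int n / 2 - 1 / 2 \<in> \<int>" if "odd n" for n using that by (auto elim!: oddE simp: add_divide_distrib)
  have half_even: "real n / 2 \<in> \<int>" if "even n" for n using int_even [of "int n"] that by simp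
  have half_odd: "real n / 2 - 1 / 2 \<in> \<int>" if "odd n" for n using int_odd [of "int n"] that by simp
  define D where "D w = local_degrees E B f (Q w)" for w
  define S where "S w = C \<inter> fibre E f (Q w)" for w
  have DS: "\<exists>m. D w = replicate_mset m (cone_order w) + image_mset (local_degree E B f) (mset_set (S w))
      \<and> m * cone_order w + (\<Sum>e\<in>S w. local_degree E B f e) = d" for w
    unfolding D_def S_def by (rule degs)
  have ld: "local_degree E B f (P z) = cone_order w div cone_order z" if "P z \<in> S w" for z w
    using fib(3) that by (simp add: S_def)
  have Smem: "S w = {e \<in> {P 0}. Q 0 = Q w} \<union> {e \<in> {P cone4}. Q (l * cone4) = Q w} \<union> {e \<in> {P cone2}. Q (l * cone2) = Q w}" for w
    unfolding S_def C_def using f0 f4 f2 by auto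
  \<comment> \<open>In each case the residue of \<open>d\<close> modulo 4 selects one of the three
    shapes.\<close>
  consider (odd) "even x \<noteq> even y" | (both_odd) "odd x" "odd y" | (both_even) "even x" "even y" by blast
  then have "R = {# D cone2, D 0, D cone4 #}"
  proof cases
    case odd
    then have "odd d" by (simp add: d)
    then have sh: "d = 4 * k + 1" "R = {# replicate_mset (2 * k) 2 + {#1#}, replicate_mset k 4 + {#1#}, replicate_mset k 4 + {#1#} #}"
      using shape by (auto simp: cand_shape_def)
    have "Q (l * cone4) = Q cone4"
      unfolding Qeq lc using odd int_odd [of "int x - int y"] half_odd [of "x + y"]
      by (intro orbit_equiv_sym [OF orbit_equivI(1)]) (auto simp: gaussian_ints_def cone4_def)
    moreover have "Q (l * cone2) = Q cone2"
    proof (cases "even x")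
      case True
      then show ?thesis
        unfolding Qeq lc using odd half_even [of x] half_odd [of y]
        by (intro orbit_equiv_sym [OF orbit_equivI(3)]) (auto simp: gaussian_ints_def cone2_def)
    next
      case False
      then show ?thesis
        unfolding Qeq lc using odd half_odd [of x] half_even [of y]
        by (intro orbit_equiv_sym [OF orbit_equivI(1)]) (auto simp: gaussian_ints_def cone2_def)
    qed
    ultimately have S: "S 0 = {P 0}" "S cone4 = {P cone4}" "S cone2 = {P cone2}"
      unfolding Smem using dist by auto
    obtain m0 where m0: "D 0 = replicate_mset m0 4 + {#1#}" "m0 * 4 + 1 = d"
      using DS [of 0] ld [of 0 0] by (auto simp: S cone_order_cone_points)
    obtain m4 where m4: "D cone4 = replicate_mset m4 4 + {#1#}" "m4 * 4 + 1 = d"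
      using DS [of cone4] ld [of cone4 cone4] by (auto simp: S cone_order_cone_points)
    obtain m2 where m2: "D cone2 = replicate_mset m2 2 + {#1#}" "m2 * 2 + 1 = d"
      using DS [of cone2] ld [of cone2 cone2] by (auto simp: S cone_order_cone_points)
    have ms: "m0 = k" "m4 = k" "m2 = 2 * k" using m0 m4 m2 sh by simp_all
    show ?thesis unfolding sh(2) m0(1) m4(1) m2(1) ms by simp
  next
    case both_odd
    then obtain u v where uv: "x = 2 * u + 1" "y = 2 * v + 1" by (auto elim!: oddE)
    have "d = 4 * (u\<^sup>2 + u + v\<^sup>2 + v) + 2" by (simp add: d uv power2_eq_square algebra_simps)
    then obtain n where "d = 4 * n + 2" by blast
    then have "d \<noteq> 4 * k + 1" "d \<noteq> 4 * k + 4" by presburger+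
    then have sh: "d = 4 * k + 2" "R = {# replicate_mset (2 * k + 1) 2, replicate_mset k 4 + {#2#}, replicate_mset k 4 + {#1, 1#} #}"
      using shape by (auto simp: cand_shape_def)
    have "Q (l * cone4) = Q 0"
      unfolding Qeq lc using both_odd int_even [of "int x - int y"] half_even [of "x + y"]
      by (intro orbit_equiv_sym [OF orbit_equivI(1)]) (auto simp: gaussian_ints_def)
    moreover have "Q (l * cone2) = Q cone4"
      unfolding Qeq lc using both_odd half_odd [of x] half_odd [of y]
      by (intro orbit_equiv_sym [OF orbit_equivI(1)]) (auto simp: gaussian_ints_def cone4_def)
    ultimately have S: "S 0 = {P 0, P cone4}" "S cone4 = {P cone2}" "S cone2 = {}"
      unfolding Smem using dist by auto
    obtain m0 where m0: "D 0 = replicate_mset m0 4 + {#1, 1#}" "m0 * 4 + 2 = d"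
      using DS [of 0] ld [of 0 0] ld [of cone4 0] dist by (auto simp: S cone_order_cone_points)
    obtain m4 where m4: "D cone4 = replicate_mset m4 4 + {#2#}" "m4 * 4 + 2 = d"
      using DS [of cone4] ld [of cone2 cone4] by (auto simp: S cone_order_cone_points)
    obtain m2 where m2: "D cone2 = replicate_mset m2 2" "m2 * 2 = d"
      using DS [of cone2] by (auto simp: S cone_order_cone_points)
    have ms: "m0 = k" "m4 = k" "m2 = 2 * k + 1" using m0 m4 m2 sh by simp_all
    show ?thesis unfolding sh(2) m0(1) m4(1) m2(1) ms by (rule arg_cong [OF add_mset_commute])
  next
    case both_even
    then obtain u v where uv: "x = 2 * u" "y = 2 * v" by (auto elim!: evenE)
    have "d = 4 * (u\<^sup>2 + v\<^sup>2)" by (simp add: d uv power2_eq_square algebra_simps)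
    then obtain n where "d = 4 * n" by blast
    then have "d \<noteq> 4 * k + 1" "d \<noteq> 4 * k + 2" by presburger+
    then have sh: "d = 4 * k + 4" "R = {# replicate_mset (2 * k + 2) 2, replicate_mset (k + 1) 4, replicate_mset k 4 + {#2, 1, 1#} #}"
      using shape by (auto simp: cand_shape_def)
    have "Q (l * cone4) = Q 0"
      unfolding Qeq lc using both_even int_even [of "int x - int y"] half_even [of "x + y"]
      by (intro orbit_equiv_sym [OF orbit_equivI(1)]) (auto simp: gaussian_ints_def)
    moreover have "Q (l * cone2) = Q 0"
      unfolding Qeq lc using both_even half_even [of x] half_even [of y]
      by (intro orbit_equiv_sym [OF orbit_equivI(1)]) (auto simp: gaussian_ints_def)
    ultimately have S: "S 0 = {P 0, P cone4, P cone2}" "S cone4 = {}" "S cone2 = {}"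
      unfolding Smem using dist by auto
    obtain m0 where m0: "D 0 = replicate_mset m0 4 + {#2, 1, 1#}" "m0 * 4 + 4 = d"
      using DS [of 0] ld [of 0 0] ld [of cone4 0] ld [of cone2 0] dist
      by (auto simp: S cone_order_cone_points add_mset_commute)
    obtain m4 where m4: "D cone4 = replicate_mset m4 4" "m4 * 4 = d"
      using DS [of cone4] by (auto simp: S cone_order_cone_points)
    obtain m2 where m2: "D cone2 = replicate_mset m2 2" "m2 * 2 = d"
      using DS [of cone2] by (auto simp: S cone_order_cone_points)
    have ms: "m0 = k" "m4 = k + 1" "m2 = 2 * k + 2" using m0 m4 m2 sh by simp_all
    show ?thesis unfolding sh(2) m0(1) m4(1) m2(1) ms by (rule arg_cong [OF add_mset_commute])
  qed
  then show ?thesis unfolding D_def by (rule main)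
qed

section \<open>Coverings of the plane minus two points\<close>

text \<open>For \<open>e = id\<close> this is a section of \<open>p\<close> over \<open>W\<close>;
  for a loop \<open>e\<close> it is a lift of that loop.\<close>

definition lift_of :: "('b :: topological_space) set \<Rightarrow> ('b \<Rightarrow> 'c) \<Rightarrow> ('a :: topological_space \<Rightarrow> 'c) \<Rightarrow> 'a set \<Rightarrow> ('a \<Rightarrow> 'b) \<Rightarrow> bool" where
  "lift_of c p e W g \<longleftrightarrow> continuous_on W g \<and> g ` W \<subseteq> c \<and> (\<forall>w\<in>W. p (g w) = e w)"

lemma lift_of_subset: "lift_of c p e W g \<Longrightarrow> W' \<subseteq> W \<Longrightarrow> lift_of c p e W' g"
  unfolding lift_of_def by (meson continuous_on_subset image_mono subset_eq subset_trans)

definition punctured :: "complex set" where "punctured = - {0, 1}"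
definition upper :: "complex set" where "upper = {z. Im z > 0}"
definition lower :: "complex set" where "lower = {z. Im z < 0}"
text \<open>The plane cut along the real axis with one gate left open: the negative axis here, then
  the interval from 0 to 1, then the axis beyond 1. Each slit domain contains both half planes and a
  single passage between them.\<close>

definition slit1 :: "complex set" where "slit1 = {z. Im z \<noteq> 0 \<or> Re z < 0}"
definition slit2 :: "complex set" where "slit2 = {z. Im z \<noteq> 0 \<or> 0 < Re z \<and> Re z < 1}"
definition slit3 :: "complex set" where "slit3 = {z. Im z \<noteq> 0 \<or> 1 < Re z}"
definition left_half :: "complex set" where "left_half = {z. Re z < 0}"

abbreviation slits :: "complex set set" where "slits \<equiv> {slit1, slit2, slit3}"

text \<open>Each slit domain is star-shaped about a point of its gate, namely -1, 1/2 or 2. Hence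
  coverings have sections over it.\<close>

lemma slits_facts:
  assumes "W \<in> slits"
  shows "W \<subseteq> punctured" "upper \<subseteq> W" "lower \<subseteq> W" "open W" "simply_connected W"
proof -
  show "W \<subseteq> punctured" "upper \<subseteq> W" "lower \<subseteq> W"
    using assms by (auto simp: slit1_def slit2_def slit3_def punctured_def upper_def lower_def)
  have eqs: "slit1 = {z. Im z < 0} \<union> {z. Im z > 0} \<union> {z. Re z < 0}"
    "slit2 = {z. Im z < 0} \<union> {z. Im z > 0} \<union> ({z. Re z > 0} \<inter> {z. Re z < 1})"
    "slit3 = {z. Im z < 0} \<union> {z. Im z > 0} \<union> {z. Re z > 1}"
    by (auto simp: slit1_def slit2_def slit3_def)
  have "open {z. Im z < 0}" "open {z. Im z > 0}" "open {z. Re z < a}" "open {z. Re z > a}" for a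
    by (auto intro!: open_Collect_less continuous_intros)
  then have "open slit1" "open slit2" "open slit3" unfolding eqs by (intro open_Un open_Int; simp)+
  then show "open W" using assms by blast
  have star: "starlike W" if "a \<in> W" "\<And>z t. z \<in> W \<Longrightarrow> 0 \<le> t \<Longrightarrow> t \<le> 1 \<Longrightarrow> (1 - t) *\<^sub>R a + t *\<^sub>R z \<in> W" for W and a :: complex
    unfolding starlike_def using that by (auto simp: closed_segment_def intro!: bexI [of _ a])
  have "starlike slit1"
  proof (rule star [of "- 1"])
    fix z and t :: real assume z: "z \<in> slit1" and t: "0 \<le> t" "t \<le> 1"
    show "(1 - t) *\<^sub>R (- 1) + t *\<^sub>R z \<in> slit1"
    proof (cases "t = 0 \<or> Im z \<noteq> 0")
      case False
      then have "t * Re z < 0" using z t by (auto simp: slit1_def mult_pos_neg)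
      then show ?thesis using t by (simp add: slit1_def)
    qed (auto simp: slit1_def)
  qed (simp add: slit1_def)
  moreover have "starlike slit2"
  proof (rule star [of "1 / 2"])
    fix z and t :: real assume z: "z \<in> slit2" and t: "0 \<le> t" "t \<le> 1"
    show "(1 - t) *\<^sub>R (1 / 2) + t *\<^sub>R z \<in> slit2"
    proof (cases "t = 0 \<or> Im z \<noteq> 0")
      case False
      then have "0 < t * Re z" "t * Re z < t * 1" using z t by (auto simp: slit2_def)
      then show ?thesis using t by (simp add: slit2_def field_simps)
    qed (auto simp: slit2_def)
  qed (simp add: slit2_def)
  moreover have "starlike slit3"
  proof (rule star [of 2])
    fix z and t :: real assume z: "z \<in> slit3" and t: "0 \<le> t" "t \<le> 1"
    show "(1 - t) *\<^sub>R 2 + t *\<^sub>R z \<in> slit3"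
    proof (cases "t = 0 \<or> Im z \<noteq> 0")
      case False
      then have "t * 1 < t * Re z" using z t by (auto simp: slit3_def)
      then show ?thesis using t by (simp add: slit3_def algebra_simps)
    qed (auto simp: slit3_def)
  qed (simp add: slit3_def)
  ultimately have "starlike W" using assms by auto
  then show "simply_connected W" by (intro contractible_imp_simply_connected starlike_imp_contractible)
qed

lemma punctured_slits: "w \<in> punctured \<Longrightarrow> \<exists>W\<in>slits. w \<in> W"
  by (auto simp: punctured_def slit1_def slit2_def slit3_def complex_eq_iff)

lemma slits_real_eq:
  assumes "W \<in> slits" "W' \<in> slits" "w \<in> W" "w \<in> W'" "w \<notin> upper" "w \<notin> lower"
  shows "W = W'"
  using assms by (auto simp: upper_def lower_def slit1_def slit2_def slit3_def)

lemma half_planes: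
  "convex upper" "convex lower" "convex left_half" "connected upper" "connected lower" "connected left_half"
  "open left_half" "open upper" "open lower"
proof -
  show c: "convex upper" "convex lower" "convex left_half"
    by (simp_all add: upper_def lower_def left_half_def convex_halfspace_Im_gt convex_halfspace_Im_lt convex_halfspace_Re_lt)
  show "connected upper" "connected lower" "connected left_half" using c convex_connected by auto
  show "open left_half" "open upper" "open lower"
    unfolding left_half_def upper_def lower_def by (auto intro!: open_Collect_less continuous_intros)
qed

lemma lift_exists:
  fixes p :: "complex \<Rightarrow> complex" and e :: "complex \<Rightarrow> complex"
  assumes cov: "covering_space c p S" and U: "open U" "simply_connected U" and e: "continuous_on U e" "e ` U \<subseteq> S"
    and z: "z \<in> U" "x \<in> c" "p x = e z"
  obtains g where "lift_of c p e U g" "g z = x"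
proof -
  have "locally path_connected U" using U by (simp add: open_imp_locally_path_connected)
  from covering_space_lift_strong [OF cov z(2,1) U(2) this e(1) _ z(3) [symmetric]] obtain g
    where "continuous_on U g" "g \<in> U \<rightarrow> c" "g z = x" "\<And>y. y \<in> U \<Longrightarrow> p (g y) = e y"
    using e(2) by blast
  then show ?thesis using that [of g] by (auto simp: lift_of_def)
qed

lemma section_exists:
  fixes p :: "complex \<Rightarrow> complex"
  assumes cov: "covering_space c p S" and U: "open U" "simply_connected U" "U \<subseteq> S"
    and z: "z \<in> U" "x \<in> c" "p x = z"
  obtains s where "lift_of c p id U s" "s z = x"
  using lift_exists [OF cov U(1,2) _ _ z(1,2), of id] U(3) z(3) by (metis continuous_on_id' id_apply id_def image_id)

lemma lift_unique:
  fixes p :: "complex \<Rightarrow> complex" and e :: "complex \<Rightarrow> complex"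
  assumes cov: "covering_space c p S" and T: "connected T" and e: "continuous_on T e" "e ` T \<subseteq> S"
    and g: "lift_of c p e T g" "lift_of c p e T h" and a: "a \<in> T" "g a = h a" and x: "x \<in> T"
  shows "g x = h x"
proof (rule covering_space_lift_unique [OF cov, of g a h T e])
qed (use assms in \<open>auto simp: lift_of_def\<close>)

text \<open>Let \<open>p\<close> be a covering of \<open>\<complex> - {0, 1}\<close>. Crossing one of the three components of
  \<open>\<real> - {0, 1}\<close> yields a bijection from the fibre over \<open>\<i>\<close> to the fibre over \<open>- \<i>\<close>.\<close>

definition crosses :: "complex set \<Rightarrow> (complex \<Rightarrow> complex) \<Rightarrow> complex set \<Rightarrow> complex \<Rightarrow> complex \<Rightarrow> bool" where
  "crosses c p W x y \<longleftrightarrow> (\<exists>s. lift_of c p id W s \<and> s \<i> = x \<and> s (- \<i>) = y)"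

lemma i_mem: "\<i> \<in> upper" "- \<i> \<in> lower"
  by (simp_all add: upper_def lower_def)

lemma crosses_exists:
  fixes p :: "complex \<Rightarrow> complex"
  assumes cov: "covering_space c p punctured" and W: "W \<in> slits"
  shows "x \<in> c \<Longrightarrow> p x = \<i> \<Longrightarrow> \<exists>y. crosses c p W x y"
    "y \<in> c \<Longrightarrow> p y = - \<i> \<Longrightarrow> \<exists>x. crosses c p W x y"
proof -
  note W' = slits_facts(4,5,1) [OF W]
  have i: "\<i> \<in> W" "- \<i> \<in> W" using slits_facts(2,3) [OF W] i_mem by auto
  show "\<exists>y. crosses c p W x y" if "x \<in> c" "p x = \<i>"
    using section_exists [OF cov W' i(1) that] unfolding crosses_def by metis
  show "\<exists>x. crosses c p W x y" if "y \<in> c" "p y = - \<i>"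
    using section_exists [OF cov W' i(2) that] unfolding crosses_def by metis
qed

lemma crosses_fibre:
  assumes "W \<in> slits" "crosses c p W x y"
  shows "x \<in> c" "p x = \<i>" "y \<in> c" "p y = - \<i>"
  using assms slits_facts(2,3) [OF assms(1)] i_mem unfolding crosses_def lift_of_def by (auto simp: image_subset_iff subset_iff)

lemma section_unique:
  fixes p :: "complex \<Rightarrow> complex"
  assumes cov: "covering_space c p punctured" and T: "connected T" "T \<subseteq> punctured"
    and g: "lift_of c p id T g" "lift_of c p id T h" and a: "a \<in> T" "g a = h a" and x: "x \<in> T"
  shows "g x = h x"
  by (rule lift_unique [where e = id, OF cov T(1) _ _ g a x]) (use T in auto)

lemma slits_connected: "W \<in> slits \<Longrightarrow> connected W"
  using slits_facts(5) simply_connected_imp_connected by blast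

lemma crosses_unique:
  fixes p :: "complex \<Rightarrow> complex"
  assumes cov: "covering_space c p punctured" and W: "W \<in> slits"
  shows "crosses c p W x y \<Longrightarrow> crosses c p W x y' \<Longrightarrow> y = y'"
    "crosses c p W x y \<Longrightarrow> crosses c p W x' y \<Longrightarrow> x = x'"
proof -
  have i: "\<i> \<in> W" "- \<i> \<in> W" using slits_facts(2,3) [OF W] i_mem by auto
  note u = section_unique [OF cov slits_connected [OF W] slits_facts(1) [OF W]]
  show "y = y'" if "crosses c p W x y" "crosses c p W x y'"
    using that u [OF _ _ i(1) _ i(2)] unfolding crosses_def by metis
  show "x = x'" if "crosses c p W x y" "crosses c p W x' y"
    using that u [OF _ _ i(2) _ i(1)] unfolding crosses_def by metis
qed

text \<open>A loop around a puncture that crosses the real axis first in \<open>W\<close> and then in \<open>W'\<close> is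
  parametrized by \<open>e\<close> on the left half plane, with period \<open>2 * pi * \<i>\<close>.\<close>

definition vertex_loop :: "(complex \<Rightarrow> complex) \<Rightarrow> complex set \<Rightarrow> complex set \<Rightarrow> bool" where
  "vertex_loop e W W' \<longleftrightarrow> W \<in> slits \<and> W' \<in> slits \<and> continuous_on left_half e \<and> e ` left_half \<subseteq> punctured \<and>
     (\<forall>w. e (w + 2 * pi * \<i>) = e w) \<and>
     (\<forall>w\<in>left_half. 0 < Im w \<and> Im w < 2 * pi \<longrightarrow> e w \<in> W) \<and>
     (\<forall>w\<in>left_half. pi < Im w \<and> Im w < 3 * pi \<longrightarrow> e w \<in> W') \<and>
     e (Complex (- 1) (pi / 2)) \<in> upper \<and> e (Complex (- 1) (3 * pi / 2)) \<in> lower"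

text \<open>The monodromy of a loop, as a relation on the fibre over \<open>\<i>\<close>: down
  through the gate of \<open>W\<close> and back up through the gate of \<open>W'\<close>.\<close>

definition rotates :: "complex set \<Rightarrow> (complex \<Rightarrow> complex) \<Rightarrow> complex set \<Rightarrow> complex set \<Rightarrow> complex \<Rightarrow> complex \<Rightarrow> bool" where
  "rotates c p W W' x x' \<longleftrightarrow> (\<exists>y. crosses c p W x y \<and> crosses c p W' x' y)"

text \<open>A lift of the loop is labelled by a point \<open>x\<close> of the fibre over
  \<open>\<i>\<close>. The loop need not pass through \<open>\<i>\<close>, so the label is
  transported by a section over the upper half plane.\<close>

definition lift_at :: "complex set \<Rightarrow> (complex \<Rightarrow> complex) \<Rightarrow> (complex \<Rightarrow> complex) \<Rightarrow> (complex \<Rightarrow> complex) \<Rightarrow> complex \<Rightarrow> bool" where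
  "lift_at c p e g x \<longleftrightarrow> lift_of c p e left_half g \<and>
     (\<exists>s. lift_of c p id upper s \<and> s \<i> = x \<and> s (e (Complex (- 1) (pi / 2))) = g (Complex (- 1) (pi / 2)))"

lemma strip_convex: "convex (left_half \<inter> {w. a < Im w \<and> Im w < b})"
proof -
  have "{w. a < Im w \<and> Im w < b} = {w. a < Im w} \<inter> {w. Im w < b}" by auto
  then show ?thesis
    using half_planes(3) by (simp add: convex_Int convex_halfspace_Im_gt convex_halfspace_Im_lt)
qed

lemma lift_of_comp:
  assumes "lift_of c p id W s" "continuous_on A e" "e ` A \<subseteq> W"
  shows "lift_of c p e A (s \<circ> e)"
  unfolding lift_of_def
proof (intro conjI ballI)
  show "continuous_on A (s \<circ> e)"
    using assms by (intro continuous_on_compose) (auto simp: lift_of_def intro: continuous_on_subset)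
  show "(s \<circ> e) ` A \<subseteq> c" using assms by (auto simp: lift_of_def)
  show "p ((s \<circ> e) w) = e w" if "w \<in> A" for w using assms that by (auto simp: lift_of_def)
qed

text \<open>The lift follows the section over \<open>W\<close> while
  \<open>0 < Im w < 2 * pi\<close> and the one over \<open>W'\<close> while
  \<open>pi < Im w < 3 * pi\<close>. Being equal at \<open>- \<i>\<close>, the two sections agree on
  the lower half plane. So after one period the label \<open>x\<close> has become
  \<open>x'\<close>.\<close>

lemma lift_at_rotate:
  fixes p :: "complex \<Rightarrow> complex"
  assumes cov: "covering_space c p punctured" and e: "vertex_loop e W W'"
    and g: "lift_at c p e g x" and rot: "rotates c p W W' x x'"
  shows "lift_at c p e (\<lambda>w. g (w + 2 * pi * \<i>)) x'"
proof -
  let ?w0 = "Complex (- 1) (pi / 2)" and ?w1 = "Complex (- 1) (3 * pi / 2)"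
  note e' = e [unfolded vertex_loop_def]
  have W: "W \<in> slits" "W' \<in> slits" using e' by blast+
  have gl: "lift_of c p e left_half g" using g by (simp add: lift_at_def)
  have e0: "e ?w0 \<in> upper" and e1: "e ?w1 \<in> lower" using e' by blast+
  have sub: "e ` A \<subseteq> punctured" if "A \<subseteq> left_half" for A using e' that by blast
  have cont: "continuous_on A e" if "A \<subseteq> left_half" for A using e' that continuous_on_subset by blast
  obtain y s1 s2 where s1: "lift_of c p id W s1" "s1 \<i> = x" "s1 (- \<i>) = y"
    and s2: "lift_of c p id W' s2" "s2 \<i> = x'" "s2 (- \<i>) = y"
    using rot unfolding rotates_def crosses_def by blast
  obtain s where s: "lift_of c p id upper s" "s \<i> = x" "s (e ?w0) = g ?w0"
    using g unfolding lift_at_def by blast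
  have up: "upper \<subseteq> W" "upper \<subseteq> W'" "lower \<subseteq> W" "lower \<subseteq> W'" using slits_facts(2,3) W by simp_all
  have pun: "upper \<subseteq> punctured" "lower \<subseteq> punctured" by (auto simp: upper_def lower_def punctured_def)
  have "s1 (e ?w0) = s (e ?w0)"
    by (rule section_unique [OF cov half_planes(4) pun(1) lift_of_subset [OF s1(1) up(1)] s(1) i_mem(1) _ e0])
      (simp add: s1 s)
  then have 1: "(s1 \<circ> e) ?w0 = g ?w0" using s by simp
  let ?A1 = "left_half \<inter> {w. 0 < Im w \<and> Im w < 2 * pi}" and ?A2 = "left_half \<inter> {w. pi < Im w \<and> Im w < 3 * pi}"
  have A1: "e ` ?A1 \<subseteq> W" and A2: "e ` ?A2 \<subseteq> W'" using e' by blast+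
  have "(s1 \<circ> e) ?w1 = g ?w1"
  proof (rule lift_unique [where g = "s1 \<circ> e" and h = g and x = ?w1 and a = ?w0 and T = ?A1, OF cov convex_connected [OF strip_convex] cont sub])
    show "lift_of c p e ?A1 (s1 \<circ> e)" by (rule lift_of_comp [OF s1(1) cont A1]) simp
    show "lift_of c p e ?A1 g" by (rule lift_of_subset [OF gl]) simp
    show "(s1 \<circ> e) ?w0 = g ?w0" by fact
  qed (auto simp: left_half_def)
  moreover have "s1 (e ?w1) = s2 (e ?w1)"
    by (rule section_unique [OF cov half_planes(5) pun(2) lift_of_subset [OF s1(1) up(3)] lift_of_subset [OF s2(1) up(4)] i_mem(2) _ e1])
      (simp add: s1 s2)
  ultimately have 2: "(s2 \<circ> e) ?w1 = g ?w1" by simp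
  have "(s2 \<circ> e) (?w0 + 2 * pi * \<i>) = g (?w0 + 2 * pi * \<i>)"
  proof (rule lift_unique [where g = "s2 \<circ> e" and h = g and x = "?w0 + 2 * pi * \<i>" and a = ?w1 and T = ?A2,
      OF cov convex_connected [OF strip_convex] cont sub])
    show "lift_of c p e ?A2 (s2 \<circ> e)" by (rule lift_of_comp [OF s2(1) cont A2]) simp
    show "lift_of c p e ?A2 g" by (rule lift_of_subset [OF gl]) simp
    show "(s2 \<circ> e) ?w1 = g ?w1" by fact
  qed (auto simp: left_half_def)
  moreover have "e (?w0 + 2 * pi * \<i>) = e ?w0" using e' by blast
  ultimately have 3: "s2 (e ?w0) = g (?w0 + 2 * pi * \<i>)" by simp
  have "lift_of c p e left_half (\<lambda>w. g (w + 2 * pi * \<i>))"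
    unfolding lift_of_def
  proof (intro conjI ballI)
    have tr: "w + 2 * pi * \<i> \<in> left_half" if "w \<in> left_half" for w using that by (simp add: left_half_def)
    show "continuous_on left_half (\<lambda>w. g (w + 2 * pi * \<i>))"
    proof (rule continuous_on_compose2 [of left_half g])
      show "continuous_on left_half g" using gl by (simp add: lift_of_def)
      show "continuous_on left_half (\<lambda>w. w + 2 * pi * \<i>)" by (intro continuous_intros)
      show "(\<lambda>w. w + 2 * pi * \<i>) ` left_half \<subseteq> left_half" using tr by blast
    qed
    show "(\<lambda>w. g (w + 2 * pi * \<i>)) ` left_half \<subseteq> c" using gl tr by (auto simp: lift_of_def)
    show "p (g (w + 2 * pi * \<i>)) = e w" if "w \<in> left_half" for w
      using gl tr [OF that] e' by (auto simp: lift_of_def)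
  qed
  then show ?thesis
    unfolding lift_at_def using 3 lift_of_subset [OF s2(1) up(2)] s2(2) by blast
qed

lemma lift_at_unique:
  fixes p :: "complex \<Rightarrow> complex"
  assumes cov: "covering_space c p punctured" and e: "vertex_loop e W W'"
    and g: "lift_at c p e g x" "lift_at c p e h x'" and eq: "g (Complex (- 1) (pi / 2)) = h (Complex (- 1) (pi / 2))"
  shows "x = x'"
proof -
  obtain s where s: "lift_of c p id upper s" "s \<i> = x" "s (e (Complex (- 1) (pi / 2))) = g (Complex (- 1) (pi / 2))"
    using g unfolding lift_at_def by blast
  obtain s' where s': "lift_of c p id upper s'" "s' \<i> = x'" "s' (e (Complex (- 1) (pi / 2))) = h (Complex (- 1) (pi / 2))"
    using g unfolding lift_at_def by blast
  have pun: "upper \<subseteq> punctured" by (auto simp: upper_def punctured_def)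
  have e0: "e (Complex (- 1) (pi / 2)) \<in> upper" using e by (simp add: vertex_loop_def)
  have "s \<i> = s' \<i>"
    by (rule section_unique [OF cov half_planes(4) pun s(1) s'(1) e0 _ i_mem(1)]) (simp add: s s' eq)
  then show ?thesis using s s' by simp
qed

definition periodic_lifts :: "complex set \<Rightarrow> (complex \<Rightarrow> complex) \<Rightarrow> (complex \<Rightarrow> complex) \<Rightarrow> nat \<Rightarrow> bool" where
  "periodic_lifts c p e n \<longleftrightarrow>
     (\<forall>g. lift_of c p e left_half g \<longrightarrow> (\<forall>w\<in>left_half. g (w + of_nat n * (2 * pi * \<i>)) = g w))"

lemma upper_open_simply: "open upper" "simply_connected upper" "simply_connected left_half"
  using half_planes convex_imp_simply_connected by blast+

lemma lift_at_exists:
  fixes p :: "complex \<Rightarrow> complex"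
  assumes cov: "covering_space c p punctured" and e: "vertex_loop e W W'" and x: "x \<in> c" "p x = \<i>"
  obtains g where "lift_at c p e g x"
proof -
  note e' = e [unfolded vertex_loop_def]
  let ?w0 = "Complex (- 1) (pi / 2)"
  have pun: "upper \<subseteq> punctured" by (auto simp: upper_def punctured_def)
  obtain s where s: "lift_of c p id upper s" "s \<i> = x"
    by (rule section_exists [OF cov upper_open_simply(1,2) pun i_mem(1) x])
  have e0: "e ?w0 \<in> upper" using e' by blast
  have w0: "?w0 \<in> left_half" by (simp add: left_half_def)
  have "s (e ?w0) \<in> c" "p (s (e ?w0)) = e ?w0" using s(1) e0 by (auto simp: lift_of_def)
  then obtain g where "lift_of c p e left_half g" "g ?w0 = s (e ?w0)"
    using lift_exists [OF cov half_planes(7) upper_open_simply(3) _ _ w0, of e "s (e ?w0)"] e' by metis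
  then show ?thesis using s that [of g] unfolding lift_at_def by metis
qed

lemma lift_at_of_lift:
  fixes p :: "complex \<Rightarrow> complex"
  assumes cov: "covering_space c p punctured" and e: "vertex_loop e W W'" and g: "lift_of c p e left_half g"
  obtains x where "lift_at c p e g x" "x \<in> c" "p x = \<i>"
proof -
  note e' = e [unfolded vertex_loop_def]
  let ?w0 = "Complex (- 1) (pi / 2)"
  have pun: "upper \<subseteq> punctured" by (auto simp: upper_def punctured_def)
  have e0: "e ?w0 \<in> upper" using e' by blast
  have w0: "?w0 \<in> left_half" by (simp add: left_half_def)
  have gw: "g ?w0 \<in> c" "p (g ?w0) = e ?w0" using g w0 by (auto simp: lift_of_def)
  obtain s where s: "lift_of c p id upper s" "s (e ?w0) = g ?w0"
    by (rule section_exists [OF cov upper_open_simply(1,2) pun e0 gw])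
  have "s \<i> \<in> c" "p (s \<i>) = \<i>" using s(1) i_mem by (auto simp: lift_of_def)
  then show ?thesis using that [of "s \<i>"] s g unfolding lift_at_def by blast
qed

text \<open>A lift of period \<open>2 * pi * \<i>\<close> is its own translate, so the monodromy
  fixes its label.\<close>

lemma rotation_fixed_point:
  fixes p :: "complex \<Rightarrow> complex"
  assumes cov: "covering_space c p punctured" and e: "vertex_loop e W W'" and g: "lift_of c p e left_half g"
    and per: "\<And>w. w \<in> left_half \<Longrightarrow> g (w + 2 * pi * \<i>) = g w"
  obtains x where "x \<in> c" "p x = \<i>" "rotates c p W W' x x"
proof -
  obtain x where x: "lift_at c p e g x" "x \<in> c" "p x = \<i>" by (rule lift_at_of_lift [OF cov e g])
  have W: "W \<in> slits" "W' \<in> slits" using e by (auto simp: vertex_loop_def)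
  obtain y where y: "crosses c p W x y" using crosses_exists(1) [OF cov W(1) x(2,3)] by blast
  then obtain x' where "crosses c p W' x' y" using crosses_exists(2) [OF cov W(2)] crosses_fibre(3,4) [OF W(1) y] by blast
  then have rot: "rotates c p W W' x x'" using y by (auto simp: rotates_def)
  have "x' = x"
    by (rule lift_at_unique [OF cov e lift_at_rotate [OF cov e x(1) rot] x(1)]) (rule per, simp add: left_half_def)
  then show ?thesis using that x rot by blast
qed

text \<open>Translating a lift by \<open>m\<close> periods moves its label by \<open>m\<close> steps
  of \<open>\<rho>\<close>; if \<open>n\<close> periods bring the lift back, they bring the label
  back.\<close>

lemma rotation_power:
  fixes p :: "complex \<Rightarrow> complex"
  assumes cov: "covering_space c p punctured" and e: "vertex_loop e W W'" and per: "periodic_lifts c p e n"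
    and rho: "\<And>x. x \<in> c \<Longrightarrow> p x = \<i> \<Longrightarrow> \<rho> x \<in> c \<and> p (\<rho> x) = \<i> \<and> rotates c p W W' x (\<rho> x)"
    and x: "x \<in> c" "p x = \<i>"
  shows "(\<rho> ^^ n) x = x"
proof -
  obtain g where g: "lift_at c p e g x" by (rule lift_at_exists [OF cov e x])
  have "lift_at c p e (\<lambda>w. g (w + of_nat m * (2 * pi * \<i>))) ((\<rho> ^^ m) x) \<and> (\<rho> ^^ m) x \<in> c \<and> p ((\<rho> ^^ m) x) = \<i>" for m
  proof (induction m)
    case 0
    then show ?case using g x by simp
  next
    case (Suc m)
    have "lift_at c p e (\<lambda>w. g (w + 2 * pi * \<i> + of_nat m * (2 * pi * \<i>))) (\<rho> ((\<rho> ^^ m) x))"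
      using Suc rho by (intro lift_at_rotate [OF cov e]) auto
    moreover have "w + 2 * pi * \<i> + of_nat m * (2 * pi * \<i>) = w + of_nat (Suc m) * (2 * pi * \<i>)" for w :: complex
      by (simp add: algebra_simps)
    ultimately have "lift_at c p e (\<lambda>w. g (w + of_nat (Suc m) * (2 * pi * \<i>))) (\<rho> ((\<rho> ^^ m) x))"
      by (simp only:)
    then show ?case using Suc rho unfolding funpow.simps comp_apply by blast
  qed
  from this [of n] show ?thesis
    using per g by (intro lift_at_unique [OF cov e _ g]) (auto simp: periodic_lifts_def lift_at_def left_half_def)
qed

text \<open>Let \<open>\<alpha>\<close> and \<open>\<beta>\<close> be the monodromies around 0 and
  1. Passing gates 1, 2 and then 2, 3 amounts to passing gates 1, 3, so
  \<open>\<beta> \<alpha>\<close> is the monodromy around infinity and its square is trivial.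
  Connectedness of \<open>c\<close> makes the action transitive.\<close>

lemma card_covering_triangle:
  fixes p :: "complex \<Rightarrow> complex"
  assumes cov: "covering_space c p punctured" and c: "open c" "connected c"
    and F: "finite {x \<in> c. p x = \<i>}" "card {x \<in> c. p x = \<i>} = d"
    and e0: "vertex_loop e0 slit1 slit2" and e1: "vertex_loop e1 slit2 slit3" and e2: "vertex_loop e2 slit1 slit3"
    and per: "periodic_lifts c p e0 4" "periodic_lifts c p e1 4" "periodic_lifts c p e2 2"
    and fixed: "lift_of c p e0 left_half g" "\<And>w. w \<in> left_half \<Longrightarrow> g (w + 2 * pi * \<i>) = g w"
  shows "\<exists>x y :: nat. d = x\<^sup>2 + y\<^sup>2"
proof -
  define F where "F = {x \<in> c. p x = \<i>}"
  define G where "G = {y \<in> c. p y = - \<i>}"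
  define \<tau> where "\<tau> W x = (THE y. crosses c p W x y)" for W x
  define \<sigma> where "\<sigma> W y = (THE x. crosses c p W x y)" for W y
  have cr: "crosses c p W x y \<longleftrightarrow> x \<in> F \<and> y = \<tau> W x" and cr': "crosses c p W x y \<longleftrightarrow> y \<in> G \<and> x = \<sigma> W y"
    if W: "W \<in> slits" for W x y
  proof -
    have "crosses c p W x (\<tau> W x)" if "x \<in> F" for x
    proof -
      obtain y where y: "crosses c p W x y" using crosses_exists(1) [OF cov W, of x] \<open>x \<in> F\<close> by (auto simp: F_def)
      show ?thesis
        unfolding \<tau>_def by (rule theI [of _ y]) (rule y, rule crosses_unique(1) [OF cov W _ y])
    qed
    moreover have "x \<in> F" if "crosses c p W x y"
      using crosses_fibre(1,2) [OF W that] by (simp add: F_def)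
    ultimately show "crosses c p W x y \<longleftrightarrow> x \<in> F \<and> y = \<tau> W x"
      using crosses_unique(1) [OF cov W] by metis
    have "crosses c p W (\<sigma> W y) y" if "y \<in> G" for y
    proof -
      obtain x where x: "crosses c p W x y" using crosses_exists(2) [OF cov W, of y] \<open>y \<in> G\<close> by (auto simp: G_def)
      show ?thesis
        unfolding \<sigma>_def by (rule theI [of _ x]) (rule x, rule crosses_unique(2) [OF cov W _ x])
    qed
    moreover have "y \<in> G" if "crosses c p W x y"
      using crosses_fibre(3,4) [OF W that] by (simp add: G_def)
    ultimately show "crosses c p W x y \<longleftrightarrow> y \<in> G \<and> x = \<sigma> W y"
      using crosses_unique(2) [OF cov W] by metis
  qed
  have \<sigma>\<tau>: "x \<in> F \<Longrightarrow> \<tau> W x \<in> G \<and> \<sigma> W (\<tau> W x) = x" "y \<in> G \<Longrightarrow> \<sigma> W y \<in> F \<and> \<tau> W (\<sigma> W y) = y"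
    if "W \<in> slits" for W x y
    using cr [OF that] cr' [OF that] by metis+
  \<comment> \<open>Extended by the identity outside the fibre, to obtain permutations of the whole
    type.\<close>
  define \<rho> where "\<rho> W W' x = (if x \<in> F then \<sigma> W' (\<tau> W x) else x)" for W W' x
  have \<rho>F: "\<rho> W W' x \<in> F" if "W \<in> slits" "W' \<in> slits" "x \<in> F" for W W' x
    using that \<sigma>\<tau> by (simp add: \<rho>_def)
  have \<rho>inv: "\<rho> W' W (\<rho> W W' x) = x" if "W \<in> slits" "W' \<in> slits" for W W' x
    using that \<sigma>\<tau> by (simp add: \<rho>_def)
  have \<rho>comp: "\<rho> slit2 slit3 (\<rho> slit1 slit2 x) = \<rho> slit1 slit3 x" for x
    using \<sigma>\<tau> by (simp add: \<rho>_def)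
  have rot: "rotates c p W W' x (\<rho> W W' x)" if "W \<in> slits" "W' \<in> slits" "x \<in> F" for W W' x
    unfolding rotates_def using that cr cr' \<sigma>\<tau> by (intro exI [of _ "\<tau> W x"]) (simp add: \<rho>_def)
  have rot_unique: "x' = \<rho> W W' x" if "W \<in> slits" "W' \<in> slits" "rotates c p W W' x x'" for W W' x x'
    using that cr cr' \<sigma>\<tau> unfolding rotates_def \<rho>_def by metis
  have pow: "(\<rho> W W' ^^ n) x = x" if e: "vertex_loop e W W'" and n: "periodic_lifts c p e n" for e W W' n x
  proof (cases "x \<in> F")
    case True
    have W: "W \<in> slits" "W' \<in> slits" using e by (auto simp: vertex_loop_def)
    show ?thesis
      by (rule rotation_power [OF cov e n]) (use True \<rho>F [OF W] rot [OF W] in \<open>auto simp: F_def\<close>)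
  next
    case False
    then have "(\<rho> W W' ^^ m) x = x" for m by (induction m) (auto simp: \<rho>_def)
    then show ?thesis .
  qed
  define \<alpha> where "\<alpha> = \<rho> slit1 slit2"
  define \<beta> where "\<beta> = \<rho> slit2 slit3"
  have a4: "\<alpha> (\<alpha> (\<alpha> (\<alpha> x))) = x" and b4: "\<beta> (\<beta> (\<beta> (\<beta> x))) = x" for x
    using pow [OF e0 per(1), of x] pow [OF e1 per(2), of x] by (simp_all add: \<alpha>_def \<beta>_def numeral_eq_Suc)
  have ba: "\<beta> (\<alpha> (\<beta> (\<alpha> x))) = x" for x
    using pow [OF e2 per(3), of x] by (simp add: \<alpha>_def \<beta>_def \<rho>comp numeral_2_eq_2)
  have ab: "\<alpha> (\<beta> (\<alpha> (\<beta> x))) = x" for x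
    by (metis a4 ba)
  obtain x0 where x0: "x0 \<in> F" "\<alpha> x0 = x0"
  proof -
    obtain x where "x \<in> c" "p x = \<i>" "rotates c p slit1 slit2 x x"
      by (rule rotation_fixed_point [OF cov e0 fixed])
    then show ?thesis using that rot_unique by (auto simp: F_def \<alpha>_def)
  qed
  have finF: "finite F" and cardF: "card F = d" using F by (simp_all add: F_def)
  have trans: "O' = F" if O: "O' \<subseteq> F" "O' \<noteq> {}" and ca: "\<And>x. x \<in> O' \<Longrightarrow> \<alpha> x \<in> O'" and cb: "\<And>x. x \<in> O' \<Longrightarrow> \<beta> x \<in> O'" for O'
  proof -
    have \<alpha>_iff: "\<alpha> x \<in> O' \<longleftrightarrow> x \<in> O'" and \<beta>_iff: "\<beta> x \<in> O' \<longleftrightarrow> x \<in> O'" for x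
      using a4 b4 ca cb by metis+
    have "\<sigma> slit2 y \<in> O' \<longleftrightarrow> \<sigma> slit1 y \<in> O'" "\<sigma> slit3 y \<in> O' \<longleftrightarrow> \<sigma> slit2 y \<in> O'" if "y \<in> G" for y
    proof -
      have "\<alpha> (\<sigma> slit1 y) = \<sigma> slit2 y" "\<beta> (\<sigma> slit2 y) = \<sigma> slit3 y"
        using that \<sigma>\<tau>(2) by (simp_all add: \<alpha>_def \<beta>_def \<rho>_def)
      then show "\<sigma> slit2 y \<in> O' \<longleftrightarrow> \<sigma> slit1 y \<in> O'" "\<sigma> slit3 y \<in> O' \<longleftrightarrow> \<sigma> slit2 y \<in> O'"
        using \<alpha>_iff \<beta>_iff by metis+
    qed
    \<comment> \<open>Invariance under both generators means that, on the way up from the lower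
      fibre, the choice of the gate does not affect membership in \<open>O'\<close>.\<close>
    then have \<sigma>_iff: "\<sigma> W y \<in> O' \<longleftrightarrow> \<sigma> W' y \<in> O'" if "y \<in> G" "W \<in> slits" "W' \<in> slits" for y W W'
      using that by (elim insertE) (simp_all, blast?)
    have "\<exists>s. lift_of c p id W s \<and> s \<i> = x" if W: "W \<in> slits" and x: "x \<in> F" for W x
      using cr [OF W, of x "\<tau> W x"] x unfolding crosses_def by blast
    then obtain s where s: "\<And>W x. W \<in> slits \<Longrightarrow> x \<in> F \<Longrightarrow> lift_of c p id W (s W x) \<and> s W x \<i> = x"
      by metis
    have ps: "p (s W x w) = w" "s W x w \<in> c" if "W \<in> slits" "x \<in> F" "w \<in> W" for W x w
      using s [OF that(1,2)] that(3) by (auto simp: lift_of_def)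
    \<comment> \<open>The points reached from \<open>X\<close> along the sections over the slit
      domains. For \<open>O'\<close> and its complement in \<open>F\<close> these sets are open,
      cover \<open>c\<close> and are disjoint, so by connectedness one of them is empty in
      \<open>c\<close>.\<close>
    define A where "A X = (\<Union>W\<in>slits. \<Union>x\<in>X. s W x ` W)" for X
    have memA: "\<exists>W\<in>slits. \<exists>x\<in>X. \<exists>w\<in>W. u = s W x w" if "u \<in> A X" for u X
      using that unfolding A_def by (simp only: UN_iff image_iff)
    have openA: "open (A X)" if "X \<subseteq> F" for X
      unfolding A_def
    proof (intro open_UN ballI)
      fix W x assume W: "W \<in> slits" "x \<in> X"
      then have x: "x \<in> F" using that by blast
      show "open (s W x ` W)"
      proof (rule invariance_of_domain)
        show "continuous_on W (s W x)" using s [OF W(1) x] by (simp add: lift_of_def)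
        show "open W" by (rule slits_facts(4) [OF W(1)])
        show "inj_on (s W x) W" using ps(1) [OF W(1) x] by (rule inj_on_inverseI)
      qed
    qed
    have cover: "c \<subseteq> A O' \<union> A (F - O')"
    proof
      fix u assume u: "u \<in> c"
      then have "p u \<in> punctured" using covering_space_imp_surjective [OF cov] by blast
      then obtain W where W: "W \<in> slits" "p u \<in> W" using punctured_slits by blast
      note W' = slits_facts(4,5,1) [OF W(1)]
      obtain t where t: "lift_of c p id W t" "t (p u) = u"
        by (rule section_exists [OF cov W' W(2) u refl])
      have iW: "\<i> \<in> W" using slits_facts(2) [OF W(1)] i_mem by blast
      have x: "t \<i> \<in> F" using t(1) iW by (auto simp: lift_of_def F_def)
      have "s W (t \<i>) (p u) = t (p u)"
        using s [OF W(1) x] by (intro section_unique [OF cov slits_connected [OF W(1)] W'(3) _ t(1) iW _ W(2)]) auto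
      then have "u \<in> s W (t \<i>) ` W" using t(2) W(2) by (metis imageI)
      moreover have "t \<i> \<in> O' \<or> t \<i> \<in> F - O'" using x by blast
      moreover have "u \<in> A X" if "t \<i> \<in> X" "u \<in> s W (t \<i>) ` W" for X
        unfolding A_def by (rule UN_I [OF W(1)], rule UN_I [where a = "t \<i>"]) (rule that)+
      ultimately show "u \<in> A O' \<union> A (F - O')" by blast
    qed
    have disjoint: "A O' \<inter> A (F - O') = {}"
    proof (rule ccontr)
      assume "A O' \<inter> A (F - O') \<noteq> {}"
      then obtain u where u: "u \<in> A O'" "u \<in> A (F - O')" by blast
      obtain W x w where 1: "W \<in> slits" "x \<in> O'" "w \<in> W" "u = s W x w"
        using memA [OF u(1)] by meson
      obtain W' x' w' where 2: "W' \<in> slits" "x' \<in> F - O'" "w' \<in> W'" "u = s W' x' w'"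
        using memA [OF u(2)] by meson
      note W = 1(1) 2(1) and x = 1(2) 2(2) and w = 1(3) 2(3) 1(4) [symmetric, unfolded 2(4), symmetric]
      have xF: "x \<in> F" "x' \<in> F" using x O by auto
      have ww: "w' = w" using ps(1) [OF W(1) xF(1) w(1)] ps(1) [OF W(2) xF(2) w(2)] w(3) by simp
      note sx = s [OF W(1) xF(1)] and sx' = s [OF W(2) xF(2)]
      have sub: "upper \<subseteq> W" "upper \<subseteq> W'" "lower \<subseteq> W" "lower \<subseteq> W'" using slits_facts(2,3) W by simp_all
      have pun: "upper \<subseteq> punctured" "lower \<subseteq> punctured" by (auto simp: upper_def lower_def punctured_def)
      \<comment> \<open>Sheets meeting over the upper half plane have the same label at
        \<open>\<i>\<close>. Over the lower one they meet at \<open>- \<i>\<close>, where the choice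
        of gate does not matter. Over a real point they belong to the same slit domain.\<close>
      consider "w \<in> upper" | "w \<in> lower" | "w \<notin> upper" "w \<notin> lower" by blast
      then show False
      proof cases
        case 1
        have "s W x \<i> = s W' x' \<i>"
          by (rule section_unique [OF cov half_planes(4) pun(1) lift_of_subset [OF conjunct1 [OF sx] sub(1)]
            lift_of_subset [OF conjunct1 [OF sx'] sub(2)] 1 _ i_mem(1)]) (use w ww in simp)
        then show False using sx sx' x by auto
      next
        case 2
        have "s W x (- \<i>) = s W' x' (- \<i>)"
          by (rule section_unique [OF cov half_planes(5) pun(2) lift_of_subset [OF conjunct1 [OF sx] sub(3)]
            lift_of_subset [OF conjunct1 [OF sx'] sub(4)] 2 _ i_mem(2)]) (use w ww in simp)
        then obtain y where "crosses c p W x y" "crosses c p W' x' y"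
          using sx sx' unfolding crosses_def by metis
        then have "y \<in> G" "x = \<sigma> W y" "x' = \<sigma> W' y" using cr' W by blast+
        then show False using \<sigma>_iff W x by blast
      next
        case 3
        then have WW: "W' = W" using slits_real_eq [OF W(2,1), of w] w ww by simp
        have iW: "\<i> \<in> W" using sub(1) i_mem by blast
        have "s W x \<i> = s W x' \<i>"
          by (rule section_unique [OF cov slits_connected [OF W(1)] slits_facts(1) [OF W(1)] conjunct1 [OF sx]
            conjunct1 [OF sx' [unfolded WW]] w(1) _ iW]) (use w ww WW in simp)
        then show False using sx sx' x WW by auto
      qed
    qed
    obtain x where x: "x \<in> O'" using O by blast
    then have xF: "x \<in> F" using O by blast
    have i1: "\<i> \<in> slit1" by (simp add: slit1_def)
    have inA: "x \<in> A X" if "x \<in> X" "x \<in> F" for x X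
    proof -
      have "s slit1 x \<i> = x" using s [of slit1 x] that by simp
      then have "x \<in> s slit1 x ` slit1" using i1 by (metis imageI)
      then show ?thesis using that by (auto simp: A_def)
    qed
    have "A O' \<inter> c \<noteq> {}" using inA [OF x xF] xF by (auto simp: F_def)
    then have "A (F - O') \<inter> c = {}"
      using connectedD [OF c(2) openA [OF O(1)] openA [of "F - O'"] _ cover] disjoint by blast
    moreover have "x \<in> A (F - O') \<inter> c" if "x \<in> F - O'" for x
      using inA [of x "F - O'"] that by (simp add: F_def)
    ultimately show ?thesis using O by blast
  qed
  have "bij \<alpha>" "bij \<beta>"
    using o_bij [of "\<lambda>x. \<alpha> (\<alpha> (\<alpha> x))" \<alpha>] o_bij [of "\<lambda>x. \<beta> (\<beta> (\<beta> x))" \<beta>] a4 b4 by (simp_all add: fun_eq_iff)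
  then show ?thesis
    by (rule triangle_action_card_sum_two_squares [OF _ _ a4 b4 ab finF cardF x0 _ _ trans])
      (auto simp: \<alpha>_def \<beta>_def \<rho>F)
qed

section \<open>Lifts around branch points\<close>

text \<open>The counterpart of \<open>lift_of\<close> with values in the surface itself, where the
  branch points are still present.\<close>

definition branch_lift :: "'a topology \<Rightarrow> ('a \<Rightarrow> 'b) \<Rightarrow> (complex \<Rightarrow> 'b) \<Rightarrow> complex set \<Rightarrow> (complex \<Rightarrow> 'a) \<Rightarrow> bool" where
  "branch_lift E f e W g \<longleftrightarrow> continuous_map (top_of_set W) E g \<and> (\<forall>w\<in>W. f (g w) = e w)"

lemma locally_power_1_inj:
  assumes "locally_power E B f x 1"
  obtains U where "openin E U" "x \<in> U" "inj_on f U"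
proof -
  obtain U \<phi> V \<psi> where c: "surface_chart E U \<phi>" "x \<in> U" "\<And>u. u \<in> U \<Longrightarrow> \<psi> (f u) = \<phi> u ^ 1"
    using assms unfolding locally_power_def by blast
  have "inj_on f U"
    using surface_chart_inj_on [OF c(1)] c(3) by (metis inj_on_def power_one_right)
  then show ?thesis using c that by (auto simp: surface_chart_def)
qed

text \<open>The points where two lifts agree form a closed set because \<open>E\<close> is
  Hausdorff, and an open set because \<open>f\<close> is injective near points of local degree
  1.\<close>

lemma branch_lift_unique:
  assumes E: "Hausdorff_space E" and W: "connected W"
    and lp: "\<And>x w. w \<in> W \<Longrightarrow> x \<in> topspace E \<Longrightarrow> f x = e w \<Longrightarrow> locally_power E B f x 1"
    and g: "branch_lift E f e W g" "branch_lift E f e W h" and a: "a \<in> W" "g a = h a" and x: "x \<in> W"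
  shows "g x = h x"
proof -
  have cont: "continuous_map (top_of_set W) E g" "continuous_map (top_of_set W) E h"
    and fg: "\<And>w. w \<in> W \<Longrightarrow> f (g w) = e w" "\<And>w. w \<in> W \<Longrightarrow> f (h w) = e w"
    using g by (auto simp: branch_lift_def)
  have top: "g w \<in> topspace E" if "w \<in> W" for w
    using cont(1) that by (auto simp: continuous_map_def)
  define A where "A = {w \<in> W. g w = h w}"
  have cl: "closedin (top_of_set W) A"
    using closedin_continuous_maps_eq [OF E cont] by (simp add: A_def)
  have op: "openin (top_of_set W) A"
  proof (subst openin_subopen, intro ballI)
    fix w assume "w \<in> A"
    then have w: "w \<in> W" "g w = h w" by (auto simp: A_def)
    obtain U where U: "openin E U" "g w \<in> U" "inj_on f U"
      using locally_power_1_inj [OF lp [OF w(1) top [OF w(1)] fg(1) [OF w(1)]]] by metis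
    let ?T = "{v \<in> topspace (top_of_set W). g v \<in> U} \<inter> {v \<in> topspace (top_of_set W). h v \<in> U}"
    have "openin (top_of_set W) ?T"
      using openin_continuous_map_preimage [OF cont(1) U(1)] openin_continuous_map_preimage [OF cont(2) U(1)] by (rule openin_Int)
    moreover have "w \<in> ?T" using w U by simp
    moreover have "?T \<subseteq> A"
    proof
      fix v assume "v \<in> ?T"
      then have v: "v \<in> W" "g v \<in> U" "h v \<in> U" by auto
      then have "g v = h v" using U(3) fg by (metis inj_onD)
      then show "v \<in> A" using v by (simp add: A_def)
    qed
    ultimately show "\<exists>T. openin (top_of_set W) T \<and> w \<in> T \<and> T \<subseteq> A" by blast
  qed
  have "A = {} \<or> A = W" using W op cl by (metis connected_clopen)
  then show ?thesis using a x by (auto simp: A_def)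
qed

definition left_of :: "real \<Rightarrow> complex set" where "left_of M = {w. Re w < M}"

lemma left_of_facts: "convex (left_of M)" "connected (left_of M)" "open (left_of M)" "M \<le> N \<Longrightarrow> left_of M \<subseteq> left_of N"
  "w \<in> left_of M \<Longrightarrow> w + of_nat n * (2 * pi * \<i>) \<in> left_of M" "left_of 0 = left_half"
proof -
  show "convex (left_of M)" by (simp add: left_of_def convex_halfspace_Re_lt)
  then show "connected (left_of M)" by (rule convex_connected)
  show "open (left_of M)" unfolding left_of_def by (intro open_Collect_less continuous_intros)
qed (auto simp: left_of_def left_half_def)

text \<open>The increment of \<open>L\<close> over one period is \<open>2 * pi * \<i>\<close> times
  an integer that depends continuously on \<open>w\<close>. This integer \<open>m\<close> is the
  winding number of one turn of \<open>exp \<circ> L\<close> around 0.\<close>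

lemma log_period_constant:
  assumes L: "continuous_on (left_of M) L" and per: "\<And>w. w \<in> left_of M \<Longrightarrow> exp (L (w + 2 * pi * \<i>)) = exp (L w)"
  obtains m :: int where "\<And>w n. w \<in> left_of M \<Longrightarrow> L (w + of_nat n * (2 * pi * \<i>)) = L w + of_nat n * (2 * of_int m * pi * \<i>)"
proof -
  have sh: "w + 2 * pi * \<i> \<in> left_of M" if "w \<in> left_of M" for w
    using left_of_facts(5) [OF that, of 1] by simp
  define D where "D w = (L (w + 2 * pi * \<i>) - L w) / (2 * pi * \<i>)" for w
  have int: "\<exists>m::int. D w = of_int m" if w: "w \<in> left_of M" for w
  proof -
    obtain m :: int where "L (w + 2 * pi * \<i>) = L w + (of_int (2 * m) * pi) * \<i>"
      using per [OF w] unfolding exp_eq by blast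
    then have "D w = of_int m" by (simp add: D_def)
    then show ?thesis by blast
  qed
  have "continuous_on (left_of M) (\<lambda>w. L (w + 2 * pi * \<i>))"
    by (rule continuous_on_compose2 [OF L]) (use sh in \<open>auto intro!: continuous_intros\<close>)
  then have contD: "continuous_on (left_of M) D"
    unfolding D_def using L by (intro continuous_intros) auto
  have "D constant_on left_of M"
  proof (rule continuous_discrete_range_constant [OF left_of_facts(2) contD])
    fix x assume x: "x \<in> left_of M"
    show "\<exists>e>0. \<forall>y. y \<in> left_of M \<and> D y \<noteq> D x \<longrightarrow> e \<le> norm (D y - D x)"
    proof (intro exI conjI allI impI)
      fix y assume y: "y \<in> left_of M \<and> D y \<noteq> D x"
      obtain i j :: int where "D x = of_int i" "D y = of_int j" using int x y by meson
      then have "norm (D y - D x) = \<bar>real_of_int (j - i)\<bar>" "j \<noteq> i"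
        using y by (auto simp flip: of_int_diff)
      then show "1 \<le> norm (D y - D x)" by linarith
    qed simp
  qed
  then obtain d where d: "\<And>w. w \<in> left_of M \<Longrightarrow> D w = d" by (auto simp: constant_on_def)
  obtain m :: int where m: "\<And>w. w \<in> left_of M \<Longrightarrow> D w = of_int m"
  proof (cases "left_of M = {}")
    case False
    then obtain w where "w \<in> left_of M" by blast
    then obtain m :: int where "d = of_int m" using int d by metis
    then show ?thesis using that d by simp
  qed (use that in auto)
  have step: "L (w + 2 * pi * \<i>) = L w + 2 * of_int m * pi * \<i>" if "w \<in> left_of M" for w
    using m [OF that] by (simp add: D_def field_simps)
  have "L (w + of_nat n * (2 * pi * \<i>)) = L w + of_nat n * (2 * of_int m * pi * \<i>)" if w: "w \<in> left_of M" for w n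
  proof (induction n)
    case (Suc n)
    have "w + of_nat (Suc n) * (2 * pi * \<i>) = (w + of_nat n * (2 * pi * \<i>)) + 2 * pi * \<i>" by (simp add: algebra_simps)
    then have "L (w + of_nat (Suc n) * (2 * pi * \<i>)) = L (w + of_nat n * (2 * pi * \<i>)) + 2 * of_int m * pi * \<i>"
      using step [OF left_of_facts(5) [OF w, of n]] by (simp only:)
    then show ?case unfolding Suc by (simp add: algebra_simps)
  qed simp
  then show ?thesis using that by blast
qed

text \<open>Two properties of a pair of neighbourhoods that are used separately: the first clause
  provides a point of \<open>N\<close> at which a lift of the loop can start, the second gives every
  lift that enters \<open>N\<close> deep enough a period of \<open>n\<close> turns.\<close>

definition lifts_periodic_near :: "'a topology \<Rightarrow> ('a \<Rightarrow> 'b) \<Rightarrow> (complex \<Rightarrow> 'b) \<Rightarrow> nat \<Rightarrow> 'a set \<Rightarrow> 'b set \<Rightarrow> bool" where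
  "lifts_periodic_near E f e n N V \<longleftrightarrow>
     (\<forall>M\<le>0. (\<forall>w\<in>left_of M. e w \<in> V) \<longrightarrow>
      (\<exists>w\<in>left_of M. \<exists>u\<in>N. f u = e w) \<and>
      (\<forall>g w0. branch_lift E f e left_half g \<longrightarrow> w0 \<in> left_of M \<longrightarrow> g w0 \<in> N \<longrightarrow>
        (\<forall>w\<in>left_half. g (w + of_nat n * (2 * pi * \<i>)) = g w)))"

lemma lifts_periodic_nearD:
  assumes "lifts_periodic_near E f e n N V" "M \<le> 0" "\<forall>w\<in>left_of M. e w \<in> V"
  shows "\<exists>w\<in>left_of M. \<exists>u\<in>N. f u = e w"
    "branch_lift E f e left_half g \<Longrightarrow> w0 \<in> left_of M \<Longrightarrow> g w0 \<in> N \<Longrightarrow> w \<in> left_half \<Longrightarrow>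
      g (w + of_nat n * (2 * pi * \<i>)) = g w"
  using assms unfolding lifts_periodic_near_def by blast+

text \<open>Near a point of local degree \<open>k\<close>, the lifts of a loop are \<open>\<phi>\<^sup>-\<^sup>1 (\<zeta> * exp (L / k))\<close>, where \<open>L\<close> is a
  logarithm of the loop in the chart \<open>\<psi>\<close> and \<open>\<zeta>\<close> is a root of unity.\<close>

lemma branch_lift_period_near:
  fixes E :: "'a topology" and B :: "'b topology" and f :: "'a \<Rightarrow> 'b" and e :: "complex \<Rightarrow> 'b"
  assumes E: "Hausdorff_space E" and x: "locally_power E B f x k" "f x = v"
    and e: "continuous_map (top_of_set left_half) B e" "\<And>w. w \<in> left_half \<Longrightarrow> e w \<noteq> v"
      "\<And>w. e (w + 2 * pi * \<i>) = e w"
    and lp: "\<And>u w. w \<in> left_half \<Longrightarrow> u \<in> topspace E \<Longrightarrow> f u = e w \<Longrightarrow> locally_power E B f u 1"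
    and n: "k dvd n"
  obtains N V where "openin E N" "x \<in> N" "openin B V" "v \<in> V" "lifts_periodic_near E f e n N V"
proof -
  obtain U \<phi> V \<psi> where k: "1 \<le> k" and c: "surface_chart E U \<phi>" "x \<in> U" "\<phi> x = 0"
      and d: "surface_chart B V \<psi>" "f x \<in> V" "\<psi> (f x) = 0" "f ` U \<subseteq> V" and pow: "\<And>u. u \<in> U \<Longrightarrow> \<psi> (f u) = \<phi> u ^ k"
    using x(1) unfolding locally_power_def by blast
  have "open (\<phi> ` U)" "0 \<in> \<phi> ` U" using c unfolding surface_chart_def by (auto simp: image_iff)
  then obtain r where r: "r > 0" "ball 0 r \<subseteq> \<phi> ` U" by (meson openE)
  define N where "N = {u \<in> U. \<phi> u \<in> ball 0 r}"
  define V' where "V' = {y \<in> V. \<psi> y \<in> ball 0 (r ^ k)}"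
  have N: "openin E N" "x \<in> N" unfolding N_def using surface_chart_open_preimage [OF c(1), of "ball 0 r"] c r by auto
  have V': "openin B V'" "v \<in> V'" unfolding V'_def using surface_chart_open_preimage [OF d(1), of "ball 0 (r ^ k)"] d r x(2) by auto
  have "(\<exists>w\<in>left_of M. \<exists>u\<in>N. f u = e w) \<and>
      (\<forall>g w0. branch_lift E f e left_half g \<longrightarrow> w0 \<in> left_of M \<longrightarrow> g w0 \<in> N \<longrightarrow>
        (\<forall>w\<in>left_half. g (w + of_nat n * (2 * pi * \<i>)) = g w))"
    if M: "M \<le> 0" and eV: "\<And>w. w \<in> left_of M \<Longrightarrow> e w \<in> V'" for M
  proof -
    let ?H = "left_of M"
    have H: "?H \<subseteq> left_half" using left_of_facts(4) [OF M] left_of_facts(6) by simp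
    define q where "q w = \<psi> (e w)" for w
    have q: "q w \<noteq> 0" "norm (q w) < r ^ k" if "w \<in> ?H" for w
    proof -
      have "e w \<in> V" "e w \<noteq> v" using eV [OF that] e(2) H that by (auto simp: V'_def)
      then show "q w \<noteq> 0" using inj_onD [OF surface_chart_inj_on [OF d(1)], of "e w" "f x"] d x(2) by (auto simp: q_def)
      show "norm (q w) < r ^ k" using eV [OF that] by (simp add: V'_def q_def)
    qed
    have contq: "continuous_on ?H q"
    proof -
      have "continuous_map (top_of_set ?H) B e"
        using e(1) H by (rule continuous_map_from_subtopology_mono)
      moreover have "e \<in> topspace (top_of_set ?H) \<rightarrow> V" using eV by (auto simp: V'_def)
      ultimately have "continuous_map (top_of_set ?H) (subtopology B V) e"
        by (simp add: continuous_map_in_subtopology)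
      moreover have "continuous_map (subtopology B V) (top_of_set (\<psi> ` V)) \<psi>"
        using d(1) homeomorphic_imp_continuous_map unfolding surface_chart_def by blast
      ultimately have "continuous_map (top_of_set ?H) (top_of_set (\<psi> ` V)) (\<psi> \<circ> e)"
        by (rule continuous_map_compose)
      then show ?thesis by (simp add: continuous_map_in_subtopology q_def [abs_def] o_def)
    qed
    \<comment> \<open>In the chart \<open>\<psi>\<close> the loop avoids 0 on a convex domain and so
      has a logarithm; \<open>exp (L / k)\<close> is a continuous \<open>k\<close>-th root of
      it.\<close>
    obtain L where L: "continuous_on ?H L" "\<And>w. w \<in> ?H \<Longrightarrow> q w = exp (L w)"
      using continuous_logarithm_on_contractible [OF contq convex_imp_contractible [OF left_of_facts(1)]] q(1) by blast
    have sh: "w + 2 * pi * \<i> \<in> ?H" if "w \<in> ?H" for w using left_of_facts(5) [OF that, of 1] by simp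
    obtain m :: int where m: "\<And>w n. w \<in> ?H \<Longrightarrow> L (w + of_nat n * (2 * pi * \<i>)) = L w + of_nat n * (2 * of_int m * pi * \<i>)"
    proof (rule log_period_constant [OF L(1)])
      show "exp (L (w + 2 * pi * \<i>)) = exp (L w)" if "w \<in> ?H" for w
        using L(2) [OF that] L(2) [OF sh [OF that]] e(3) by (simp add: q_def)
    qed blast
    have expk: "exp (L w / of_nat k) ^ k = q w" if "w \<in> ?H" for w
      using L(2) [OF that] k by (simp flip: exp_of_nat_mult)
    define h where "h \<zeta> w = inv_into U \<phi> (\<zeta> * exp (L w / of_nat k))" for \<zeta> w
    have inball: "\<zeta> * exp (L w / of_nat k) \<in> ball 0 r" if "w \<in> ?H" "\<zeta> ^ k = 1" for w \<zeta>
    proof -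
      have "norm (\<zeta> * exp (L w / of_nat k)) ^ k = norm (\<zeta> ^ k * exp (L w / of_nat k) ^ k)"
        by (simp add: power_mult_distrib norm_mult norm_power)
      also have "\<dots> < r ^ k" using that q(2) expk by simp
      finally have "norm (\<zeta> * exp (L w / of_nat k)) < r" using r by (meson less_imp_le power_less_imp_less_base)
      then show ?thesis by simp
    qed
    have h: "h \<zeta> w \<in> N" "\<phi> (h \<zeta> w) = \<zeta> * exp (L w / of_nat k)" "f (h \<zeta> w) = e w"
      if "w \<in> ?H" "\<zeta> ^ k = 1" for w \<zeta>
    proof -
      have im: "\<zeta> * exp (L w / of_nat k) \<in> \<phi> ` U" using inball [OF that] r by blast
      have hU: "h \<zeta> w \<in> U" unfolding h_def by (rule inv_into_into [OF im])
      show p: "\<phi> (h \<zeta> w) = \<zeta> * exp (L w / of_nat k)" unfolding h_def by (rule f_inv_into_f [OF im])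
      show "h \<zeta> w \<in> N" using hU p inball [OF that] by (simp add: N_def)
      have "\<psi> (f (h \<zeta> w)) = \<psi> (e w)"
        using pow [OF hU] expk [OF that(1)] that(2) by (simp add: p power_mult_distrib q_def)
      moreover have "f (h \<zeta> w) \<in> V" "e w \<in> V" using d(4) hU eV [OF that(1)] by (auto simp: V'_def)
      ultimately show "f (h \<zeta> w) = e w" using inj_onD [OF surface_chart_inj_on [OF d(1)]] by blast
    qed
    have hlift: "branch_lift E f e ?H (h \<zeta>)" if "\<zeta> ^ k = 1" for \<zeta>
      unfolding branch_lift_def
    proof (intro conjI ballI)
      have "continuous_on ?H (\<lambda>w. \<zeta> * exp (L w / of_nat k))" using L(1) k by (intro continuous_intros) auto
      then have "continuous_map (top_of_set ?H) (top_of_set (\<phi> ` U)) (\<lambda>w. \<zeta> * exp (L w / of_nat k))"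
        using inball that r by (auto simp: continuous_map_in_subtopology)
      from continuous_map_compose [OF this surface_chart_continuous_inverse [OF c(1)]]
      show "continuous_map (top_of_set ?H) E (h \<zeta>)" by (simp add: h_def [abs_def] o_def)
    qed (use h that in blast)
    show ?thesis
    proof (intro conjI allI impI ballI)
      have "of_real (M - 1) \<in> ?H" by (simp add: left_of_def)
      then show "\<exists>w\<in>?H. \<exists>u\<in>N. f u = e w" using h(1,3) [of _ 1] by (meson power_one)
    next
      fix g w0 w assume g: "branch_lift E f e left_half g" and w0: "w0 \<in> ?H" "g w0 \<in> N" and w: "w \<in> left_half"
      have gH: "branch_lift E f e ?H g"
        using g H continuous_map_from_subtopology_mono unfolding branch_lift_def by blast
      \<comment> \<open>The quotient of two \<open>k\<close>-th roots of the same number; it selects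
        the explicit lift that agrees with \<open>g\<close> at \<open>w0\<close>.\<close>
      define \<zeta> where "\<zeta> = \<phi> (g w0) / exp (L w0 / of_nat k)"
      have gU: "g w0 \<in> U" using w0 by (simp add: N_def)
      have "f (g w0) = e w0" using g w0 H by (auto simp: branch_lift_def)
      then have "\<phi> (g w0) ^ k = q w0" using pow [OF gU] by (simp add: q_def)
      then have \<zeta>: "\<zeta> ^ k = 1" using expk [OF w0(1)] q(1) [OF w0(1)] by (simp add: \<zeta>_def power_divide)
      have "\<phi> (h \<zeta> w0) = \<phi> (g w0)" using h(2) [OF w0(1) \<zeta>] by (simp add: \<zeta>_def)
      moreover have "h \<zeta> w0 \<in> U" using h(1) [OF w0(1) \<zeta>] by (simp add: N_def)
      ultimately have eq0: "h \<zeta> w0 = g w0" using inj_onD [OF surface_chart_inj_on [OF c(1)]] gU by blast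
      have gh: "g w = h \<zeta> w" if "w \<in> ?H" for w
        by (rule branch_lift_unique [OF E left_of_facts(2) _ gH hlift [OF \<zeta>] w0(1) eq0 [symmetric] that])
          (use lp H in blast)
      define s where "s = of_nat n * (2 * pi * \<i>)"
      have s0: "w0 + s \<in> ?H" unfolding s_def by (rule left_of_facts(5) [OF w0(1)])
      \<comment> \<open>After \<open>n = k * j\<close> turns the logarithm has grown by
        \<open>2 * pi * \<i> * m * k * j\<close>, hence its quotient by \<open>k\<close> has grown
        by a multiple of \<open>2 * pi * \<i>\<close>.\<close>
      obtain j where j: "n = k * j" using n by blast
      have "L (w0 + s) / of_nat k = L w0 / of_nat k + of_nat j * (2 * of_int m * pi * \<i>)"
        using m [OF w0(1), of n] k by (simp add: s_def j add_divide_distrib)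
      then have "exp (L (w0 + s) / of_nat k) = exp (L w0 / of_nat k) * exp (of_nat j * (2 * of_int m * pi * \<i>))"
        by (simp add: exp_add)
      also have "exp (of_nat j * (2 * of_int m * pi * \<i>)) = 1"
        unfolding exp_eq_1 by (auto intro!: exI [of _ "int j * m"])
      finally have "h \<zeta> (w0 + s) = h \<zeta> w0" by (simp add: h_def)
      then have eq: "g (w0 + s) = g w0" using gh w0(1) s0 by simp
      have sl: "w + s \<in> left_half" if "w \<in> left_half" for w using that by (simp add: left_half_def s_def)
      have es: "e (w + of_nat i * (2 * pi * \<i>)) = e w" for w i
      proof (induction i)
        case (Suc i)
        have "w + of_nat (Suc i) * (2 * pi * \<i>) = (w + of_nat i * (2 * pi * \<i>)) + 2 * pi * \<i>" by (simp add: algebra_simps)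
        then show ?case using Suc e(3) by (simp only:)
      qed simp
      \<comment> \<open>Periodicity at the single point \<open>w0\<close> spreads to the whole half
        plane by uniqueness of lifts.\<close>
      have "branch_lift E f e left_half (\<lambda>w. g (w + s))"
        unfolding branch_lift_def
      proof (intro conjI ballI)
        have "continuous_map (top_of_set left_half) (top_of_set left_half) (\<lambda>w. w + s)"
          using sl by (auto simp: continuous_map_in_subtopology intro!: continuous_intros)
        from continuous_map_compose [OF this, of E g] g
        show "continuous_map (top_of_set left_half) E (\<lambda>w. g (w + s))" by (simp add: branch_lift_def o_def)
        show "f (g (w + s)) = e w" if "w \<in> left_half" for w
          using g sl [OF that] es [of w n] by (simp add: branch_lift_def s_def)
      qed
      moreover have "w0 \<in> left_half" using w0(1) H by blast
      ultimately have "g (w + s) = g w"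
        by (intro branch_lift_unique [where f = f and e = e and W = left_half and g = "\<lambda>w. g (w + s)" and h = g and a = w0 and x = w,
            OF E half_planes(6) _ _ g _ eq w]) (use lp in blast)+
      then show "g (w + of_nat n * (2 * pi * \<i>)) = g w" by (simp add: s_def)
    qed
  qed
  then have "lifts_periodic_near E f e n N V'"
    unfolding lifts_periodic_near_def by (intro allI impI) blast
  with N V' show ?thesis by (rule that)
qed

text \<open>Let \<open>N'\<close> be the union of the neighbourhoods \<open>N x\<close> of the
  points over \<open>v\<close>. As \<open>f\<close> is a closed map, everything over a small
  neighbourhood of \<open>v\<close> lies in \<open>N'\<close>. So a lift must enter some
  \<open>N x\<close>, which gives it the period.\<close>

lemma branch_lift_period:
  fixes E :: "'a topology" and B :: "'b topology" and f :: "'a \<Rightarrow> 'b" and e :: "complex \<Rightarrow> 'b"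
  assumes E: "Hausdorff_space E" "compact_space E" and B: "Hausdorff_space B" and f: "continuous_map E B f"
    and fin: "finite (fibre E f v)" and v: "v \<in> topspace B"
    and x: "\<And>x. x \<in> fibre E f v \<Longrightarrow> \<exists>k. locally_power E B f x k \<and> k dvd n"
    and e: "continuous_map (top_of_set left_half) B e" "\<And>w. w \<in> left_half \<Longrightarrow> e w \<noteq> v"
      "\<And>w. e (w + 2 * pi * \<i>) = e w"
    and lim: "\<And>V. openin B V \<Longrightarrow> v \<in> V \<Longrightarrow> \<exists>M. \<forall>w. Re w < M \<longrightarrow> e w \<in> V"
    and lp: "\<And>u w. w \<in> left_half \<Longrightarrow> u \<in> topspace E \<Longrightarrow> f u = e w \<Longrightarrow> locally_power E B f u 1"
    and g: "branch_lift E f e left_half g" and w: "w \<in> left_half"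
  shows "g (w + of_nat n * (2 * pi * \<i>)) = g w"
proof -
  have "\<exists>N V. openin E N \<and> x \<in> N \<and> openin B V \<and> v \<in> V \<and> lifts_periodic_near E f e n N V"
    if x': "x \<in> fibre E f v" for x
  proof -
    obtain k where k: "locally_power E B f x k" "k dvd n" using x [OF x'] by blast
    have "f x = v" using x' by (simp add: fibre_def)
    from branch_lift_period_near [OF E(1) k(1) this e lp k(2)] obtain N V
      where "openin E N" "x \<in> N" "openin B V" "v \<in> V" "lifts_periodic_near E f e n N V" .
    then show ?thesis by (intro exI conjI)
  qed
  then obtain N V where NV: "\<And>x. x \<in> fibre E f v \<Longrightarrow> openin E (N x) \<and> x \<in> N x \<and> openin B (V x) \<and> v \<in> V x \<and>
     lifts_periodic_near E f e n (N x) (V x)"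
    by metis
  define N' where "N' = (\<Union>x\<in>fibre E f v. N x)"
  have "openin E N'" unfolding N'_def using NV by blast
  then have "closedin E (topspace E - N')" by blast
  moreover have "closed_map E B f" using f E B by (simp add: continuous_imp_closed_map)
  ultimately have "closedin B (f ` (topspace E - N'))" by (simp add: closed_map_def)
  then have o1: "openin B (topspace B - f ` (topspace E - N'))" by blast
  have v1: "v \<in> topspace B - f ` (topspace E - N')"
    using v NV by (auto simp: N'_def fibre_def)
  define V' where "V' = (topspace B - f ` (topspace E - N')) \<inter> (topspace B \<inter> \<Inter> (V ` fibre E f v))"
  have "openin B (topspace B \<inter> \<Inter> (V ` fibre E f v))"
    using fin NV by (intro openin_Int_Inter) auto
  then have "openin B V'" unfolding V'_def using o1 by (rule openin_Int [rotated])
  moreover have "v \<in> V'" using v1 NV v by (auto simp: V'_def)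
  ultimately obtain M0 where M0: "\<And>w. Re w < M0 \<Longrightarrow> e w \<in> V'" using lim by blast
  define M where "M = min M0 0"
  define w0 :: complex where "w0 = of_real (M - 1)"
  have w0: "w0 \<in> left_of M" "w0 \<in> left_half" by (auto simp: w0_def left_of_def left_half_def M_def)
  have eV: "e w \<in> V'" if "w \<in> left_of M" for w using M0 that by (simp add: left_of_def M_def)
  have "g w0 \<in> topspace E" "f (g w0) = e w0"
    using g w0 by (auto simp: branch_lift_def continuous_map_def)
  moreover have "e w0 \<notin> f ` (topspace E - N')" using eV [OF w0(1)] by (auto simp: V'_def)
  ultimately have "g w0 \<in> N'" by (metis DiffI imageI)
  then obtain x where "x \<in> fibre E f v" "g w0 \<in> N x" by (auto simp: N'_def)
  moreover have "M \<le> 0" by (simp add: M_def)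
  moreover have "\<forall>w\<in>left_of M. e w \<in> V x" using eV calculation(1) by (auto simp: V'_def)
  moreover have "lifts_periodic_near E f e n (N x) (V x)" using NV calculation(1) by blast
  ultimately show ?thesis using g w0(1) w by (metis lifts_periodic_nearD(2))
qed

section \<open>From branched covers of the sphere to coverings of plane domains\<close>

lemma sphere_minus_point_homeomorphic:
  assumes E: "E homeomorphic_space S2" and a: "a \<in> topspace E"
  obtains \<eta> \<eta>' where "homeomorphic_maps (subtopology E (topspace E - {a})) (euclidean :: complex topology) \<eta> \<eta>'"
proof -
  let ?S = "sphere (0 :: complex \<times> real) 1"
  have "E homeomorphic_space top_of_set ?S"
    using E S2_homeomorphic_sphere homeomorphic_space_trans by blast
  then obtain h h' where h: "homeomorphic_maps E (top_of_set ?S) h h'" by (auto simp: homeomorphic_space_def)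
  have ha: "h a \<in> ?S" using h a unfolding homeomorphic_maps_def continuous_map_def by auto
  have him: "h ` topspace E = ?S" and hinj: "inj_on h (topspace E)"
    using h homeomorphic_maps_map homeomorphic_imp_surjective_map homeomorphic_imp_injective_map by fastforce+
  have "h ` (topspace E \<inter> (topspace E - {a})) = topspace (top_of_set ?S) \<inter> (?S - {h a})"
    using inj_on_image_set_diff [OF hinj, of "topspace E" "{a}"] a him by (simp add: Int_absorb1)
  then have 1: "homeomorphic_maps (subtopology E (topspace E - {a})) (subtopology (top_of_set ?S) (?S - {h a})) h h'"
    by (rule homeomorphic_maps_subtopologies [OF h])
  have "?S - {h a} homeomorphic (UNIV :: complex set)"
    using ha by (intro homeomorphic_punctured_sphere_affine) auto
  then obtain k k' where "homeomorphism (?S - {h a}) (UNIV :: complex set) k k'" by (auto simp: homeomorphic_def)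
  then have "homeomorphic_maps (top_of_set (?S - {h a})) (top_of_set (UNIV :: complex set)) k k'"
    by (simp only: homeomorphic_maps_iff_homeomorphism)
  moreover have "subtopology (top_of_set ?S) (?S - {h a}) = top_of_set (?S - {h a})"
    by (simp add: subtopology_subtopology Int_absorb1)
  ultimately have "homeomorphic_maps (subtopology E (topspace E - {a})) euclidean (k \<circ> h) (h' \<circ> k')"
    using homeomorphic_maps_compose 1 by (metis subtopology_UNIV)
  then show ?thesis by (rule that)
qed

text \<open>The points of a finite fibre have disjoint neighbourhoods on which \<open>p\<close> is
  injective. Properness shrinks the base so that nothing else lies over it, and invariance of domain
  makes the restrictions of \<open>p\<close> homeomorphisms.\<close>

lemma covering_space_proper_local_homeomorphism:
  fixes p :: "complex \<Rightarrow> complex"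
  assumes c: "open c" and S: "open S" and p: "continuous_on c p" "p ` c \<subseteq> S"
    and inj: "\<And>z. z \<in> c \<Longrightarrow> \<exists>N. open N \<and> z \<in> N \<and> N \<subseteq> c \<and> inj_on p N"
    and fin: "\<And>w. w \<in> S \<Longrightarrow> finite {z \<in> c. p z = w} \<and> {z \<in> c. p z = w} \<noteq> {}"
    and proper: "\<And>w N. w \<in> S \<Longrightarrow> open N \<Longrightarrow> {z \<in> c. p z = w} \<subseteq> N \<Longrightarrow>
      \<exists>T. open T \<and> w \<in> T \<and> T \<subseteq> S \<and> {z \<in> c. p z \<in> T} \<subseteq> N"
  shows "covering_space c p S"
proof (rule covering_spaceI [OF p(1)])
  show "p ` c = S" using p(2) fin by blast
  fix w assume w: "w \<in> S"
  define Z where "Z = {z \<in> c. p z = w}"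
  have Z: "finite Z" "Z \<noteq> {}" "Z \<subseteq> c" using fin [OF w] by (auto simp: Z_def)
  obtain N where N: "\<And>z. z \<in> Z \<Longrightarrow> open (N z) \<and> z \<in> N z \<and> N z \<subseteq> c \<and> inj_on p (N z)"
    using inj Z(3) by (metis subsetD)
  obtain r1 where r1: "\<And>z. z \<in> Z \<Longrightarrow> r1 z > 0 \<and> ball z (r1 z) \<subseteq> N z"
  proof -
    have "\<forall>z\<in>Z. \<exists>r>0. ball z r \<subseteq> N z" using N open_contains_ball by blast
    then show ?thesis using that by metis
  qed
  \<comment> \<open>A separation of the finite fibre: discs of radius at most \<open>d / 2\<close>
    around its points are disjoint.\<close>
  obtain d where d: "d > 0" "\<And>z z'. z \<in> Z \<Longrightarrow> z' \<in> Z \<Longrightarrow> z \<noteq> z' \<Longrightarrow> d \<le> dist z z'"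
  proof -
    have "\<exists>d>0. \<forall>z'\<in>Z. z' \<noteq> z \<longrightarrow> d \<le> dist z z'" for z by (rule finite_set_avoid [OF Z(1)])
    then have "\<forall>z. \<exists>d. d > 0 \<and> (\<forall>z'\<in>Z. z' \<noteq> z \<longrightarrow> d \<le> dist z z')" by blast
    then obtain D where "\<forall>z. D z > 0 \<and> (\<forall>z'\<in>Z. z' \<noteq> z \<longrightarrow> D z \<le> dist z z')" by (rule choice [THEN exE])
    then have D: "\<And>z. D z > 0" "\<And>z z'. z' \<in> Z \<Longrightarrow> z' \<noteq> z \<Longrightarrow> D z \<le> dist z z'" by blast+
    have "Min (D ` Z) > 0" "\<And>z. z \<in> Z \<Longrightarrow> Min (D ` Z) \<le> D z" using Z D by auto
    moreover have "Min (D ` Z) \<le> dist z z'" if "z \<in> Z" "z' \<in> Z" "z \<noteq> z'" for z z'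
      using order_trans [OF calculation(2) [OF that(1)] D(2) [OF that(2)]] that(3) by blast
    ultimately show ?thesis using that [of "Min (D ` Z)"] by blast
  qed
  define U where "U z = ball z (min (r1 z) (d / 2))" for z
  have U: "open (U z)" "z \<in> U z" "U z \<subseteq> c" "inj_on p (U z)" if "z \<in> Z" for z
  proof -
    have "U z \<subseteq> N z" using r1 [OF that] by (auto simp: U_def)
    then show "U z \<subseteq> c" "inj_on p (U z)" using N [OF that] inj_on_subset by blast+
    show "open (U z)" "z \<in> U z" using r1 [OF that] d by (auto simp: U_def)
  qed
  have disj: "U z \<inter> U z' = {}" if "z \<in> Z" "z' \<in> Z" "z \<noteq> z'" for z z'
  proof (rule ccontr)
    assume "U z \<inter> U z' \<noteq> {}"
    then obtain u where "dist z u < d / 2" "dist z' u < d / 2" by (auto simp: U_def)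
    then have "dist z z' < d" using dist_triangle_half_r [of u z d z'] by (simp add: dist_commute)
    then show False using d(2) [OF that] by simp
  qed
  have oU: "open (p ` U z)" if "z \<in> Z" for z
    using invariance_of_domain [of "U z" p] U [OF that] continuous_on_subset [OF p(1)] by blast
  obtain T0 where T0: "open T0" "w \<in> T0" "T0 \<subseteq> S" "{z \<in> c. p z \<in> T0} \<subseteq> (\<Union>z\<in>Z. U z)"
  proof -
    have "{z \<in> c. p z = w} \<subseteq> (\<Union>z\<in>Z. U z)" using U(2) by (auto simp: Z_def)
    moreover have "open (\<Union>z\<in>Z. U z)" using U(1) by blast
    ultimately show ?thesis using proper [OF w] that by blast
  qed
  \<comment> \<open>Contained in all the images, so that every sheet is mapped onto
    \<open>T\<close>.\<close>
  define T where "T = T0 \<inter> (\<Inter>z\<in>Z. p ` U z)"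
  have oT: "open T" unfolding T_def using T0(1) Z(1) oU by (intro open_Int open_INT) auto
  have TS: "T \<subseteq> S" using T0 by (auto simp: T_def)
  define sheet where "sheet z = U z \<inter> p -` T" for z
  have osheet: "open (sheet z)" if "z \<in> Z" for z
  proof -
    have "continuous_on (U z) p" using U(3) [OF that] p(1) continuous_on_subset by blast
    then show ?thesis unfolding sheet_def using U(1) [OF that] oT continuous_open_preimage by blast
  qed
  show "\<exists>T. w \<in> T \<and> openin (top_of_set S) T \<and> (\<exists>v. \<Union> v = c \<inter> p -` T \<and> (\<forall>u\<in>v. openin (top_of_set c) u) \<and>
      pairwise disjnt v \<and> (\<forall>u\<in>v. \<exists>q. homeomorphism u T p q))"
  proof (rule exI [of _ T], intro conjI exI [of _ "sheet ` Z"])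
    show "w \<in> T" unfolding T_def using T0(2) U(2) by (auto simp: Z_def image_iff)
    show "openin (top_of_set S) T" using oT TS by (rule open_subset [rotated])
    show "\<Union> (sheet ` Z) = c \<inter> p -` T"
    proof (intro equalityI subsetI)
      fix u assume "u \<in> c \<inter> p -` T"
      then have "u \<in> (\<Union>z\<in>Z. U z)" "p u \<in> T" using T0(4) by (auto simp: T_def)
      then show "u \<in> \<Union> (sheet ` Z)" by (auto simp: sheet_def)
    qed (use U(3) in \<open>auto simp: sheet_def\<close>)
    show "\<forall>u\<in>sheet ` Z. openin (top_of_set c) u"
    proof
      fix u assume "u \<in> sheet ` Z"
      then obtain z where z: "z \<in> Z" "u = sheet z" by blast
      have "sheet z \<subseteq> c" using U(3) [OF z(1)] by (auto simp: sheet_def)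
      then show "openin (top_of_set c) u" unfolding z(2) using osheet [OF z(1)] by (rule open_subset)
    qed
    show "pairwise disjnt (sheet ` Z)"
      using disj by (fastforce simp: pairwise_def disjnt_def sheet_def)
    show "\<forall>u\<in>sheet ` Z. \<exists>q. homeomorphism u T p q"
    proof
      fix u assume "u \<in> sheet ` Z"
      then obtain z where z: "z \<in> Z" "u = sheet z" by blast
      have "continuous_on (sheet z) p" "inj_on p (sheet z)"
        using U(3,4) [OF z(1)] p(1) by (auto simp: sheet_def intro: continuous_on_subset inj_on_subset)
      then obtain q where "homeomorphism (sheet z) (p ` sheet z) p q"
        using invariance_of_domain_homeomorphism [OF osheet [OF z(1)], of p] by auto
      moreover have "T \<subseteq> p ` U z" using z(1) unfolding T_def by blast
      then have "p ` sheet z = T" unfolding sheet_def by blast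
      ultimately show "\<exists>q. homeomorphism u T p q" using z by auto
    qed
  qed
qed

section \<open>Explicit loops around the three punctures\<close>

lemma sin_zero_window:
  "sin y = 0 \<Longrightarrow> 0 < y \<Longrightarrow> y < 2 * pi \<Longrightarrow> y = pi"
  "sin y = 0 \<Longrightarrow> pi < y \<Longrightarrow> y < 3 * pi \<Longrightarrow> y = 2 * pi"
  using sin_eq_0_pi [of "y - pi"] sin_eq_0_pi [of "y - 2 * pi"] by (auto simp: sin_diff)

text \<open>Circles around 0, 1 and infinity, which shrink to these points as \<open>Re w\<close>
  decreases. In \<open>loop2\<close> the radius is inverted but not the angle: its monodromy then is
  that of \<open>loop0\<close> followed by that of \<open>loop1\<close>, not the inverse.\<close>

definition loop0 :: "complex \<Rightarrow> complex" where "loop0 = exp"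
definition loop1 :: "complex \<Rightarrow> complex" where "loop1 w = 1 + exp w"
definition loop2 :: "complex \<Rightarrow> complex" where "loop2 w = exp (Complex (- Re w) (Im w))"

lemma vertex_loops:
  "vertex_loop loop0 slit1 slit2" "vertex_loop loop1 slit2 slit3" "vertex_loop loop2 slit1 slit3"
proof -
  have neg: "exp (Re w) < 1" "norm (exp w) < 1" if "w \<in> left_half" for w
    using that by (simp_all add: left_half_def)
  have pos: "exp (- Re w) > 1" if "w \<in> left_half" for w using that by (simp add: left_half_def)
  have per: "exp (w + 2 * pi * \<i>) = exp w" for w by (simp add: exp_add)
  have "3 * pi / 2 = pi / 2 + pi" by simp
  then have s32: "sin (3 * pi / 2) = - 1" using sin_periodic_pi [of "pi / 2"] by (simp only: sin_pi_half)
  show "vertex_loop loop0 slit1 slit2"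
    unfolding vertex_loop_def
  proof (intro conjI ballI impI allI)
    show "loop0 ` left_half \<subseteq> punctured"
    proof clarify
      fix w assume "w \<in> left_half"
      then have "exp w \<noteq> 1" using neg(2) by (metis less_irrefl norm_one)
      then show "loop0 w \<in> punctured" by (simp add: loop0_def punctured_def)
    qed
    show "loop0 (w + 2 * pi * \<i>) = loop0 w" for w unfolding loop0_def by (rule per)
    show "loop0 w \<in> slit1" if "w \<in> left_half" "0 < Im w \<and> Im w < 2 * pi" for w
      using that sin_zero_window(1) [of "Im w"] by (auto simp: loop0_def slit1_def Im_exp Re_exp)
    show "loop0 w \<in> slit2" if "w \<in> left_half" "pi < Im w \<and> Im w < 3 * pi" for w
      using that sin_zero_window(2) [of "Im w"] neg(1) by (auto simp: loop0_def slit2_def Im_exp Re_exp)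
  qed (auto simp: loop0_def upper_def lower_def Im_exp s32 intro!: continuous_intros)
  show "vertex_loop loop1 slit2 slit3"
    unfolding vertex_loop_def
  proof (intro conjI ballI impI allI)
    show "loop1 ` left_half \<subseteq> punctured"
    proof clarify
      fix w assume "w \<in> left_half"
      then have "exp w \<noteq> -1" using neg(2) by (metis less_irrefl norm_one norm_minus_cancel)
      then have "1 + exp w \<noteq> 0" by (metis add.inverse_unique)
      then show "loop1 w \<in> punctured" by (simp add: loop1_def punctured_def)
    qed
    show "loop1 (w + 2 * pi * \<i>) = loop1 w" for w unfolding loop1_def per ..
    show "loop1 w \<in> slit2" if "w \<in> left_half" "0 < Im w \<and> Im w < 2 * pi" for w
      using that sin_zero_window(1) [of "Im w"] neg(1) by (auto simp: loop1_def slit2_def Im_exp Re_exp)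
    show "loop1 w \<in> slit3" if "w \<in> left_half" "pi < Im w \<and> Im w < 3 * pi" for w
      using that sin_zero_window(2) [of "Im w"] by (auto simp: loop1_def slit3_def Im_exp Re_exp)
  qed (auto simp: loop1_def upper_def lower_def Im_exp s32 intro!: continuous_intros)
  show "vertex_loop loop2 slit1 slit3"
    unfolding vertex_loop_def
  proof (intro conjI ballI impI allI)
    show "loop2 ` left_half \<subseteq> punctured"
    proof clarify
      fix w assume w: "w \<in> left_half"
      have "norm (loop2 w) > 1" using pos [OF w] by (simp add: loop2_def)
      then have "loop2 w \<noteq> 1" by force
      then show "loop2 w \<in> punctured" by (simp add: punctured_def loop2_def)
    qed
    show "loop2 (w + 2 * pi * \<i>) = loop2 w" for w
      using per [of "Complex (- Re w) (Im w)"] by (simp add: loop2_def complex_eq_iff Re_exp Im_exp)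
    show "loop2 w \<in> slit1" if "w \<in> left_half" "0 < Im w \<and> Im w < 2 * pi" for w
      using that sin_zero_window(1) [of "Im w"] by (auto simp: loop2_def slit1_def Im_exp Re_exp)
    show "loop2 w \<in> slit3" if "w \<in> left_half" "pi < Im w \<and> Im w < 3 * pi" for w
      using that sin_zero_window(2) [of "Im w"] pos by (auto simp: loop2_def slit3_def Im_exp Re_exp)
    show "continuous_on left_half loop2"
      unfolding loop2_def Complex_eq by (intro continuous_intros)
  qed (auto simp: loop2_def upper_def lower_def Im_exp s32)
qed

lemma loop_limits:
  "\<epsilon> > 0 \<Longrightarrow> Re w < ln \<epsilon> \<Longrightarrow> norm (loop0 w) < \<epsilon>"
  "\<epsilon> > 0 \<Longrightarrow> Re w < ln \<epsilon> \<Longrightarrow> norm (loop1 w - 1) < \<epsilon>"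
  "\<epsilon> > 0 \<Longrightarrow> Re w < - ln \<epsilon> \<Longrightarrow> norm (loop2 w) > \<epsilon>"
proof -
  have 1: "exp (Re w) < \<epsilon>" if "\<epsilon> > 0" "Re w < ln \<epsilon>"
    using exp_less_mono [OF that(2)] that(1) by simp
  show "norm (loop0 w) < \<epsilon>" "norm (loop1 w - 1) < \<epsilon>" if "\<epsilon> > 0" "Re w < ln \<epsilon>"
    using 1 [OF that] by (simp_all add: loop0_def loop1_def)
  have "exp (- Re w) > \<epsilon>" if "\<epsilon> > 0" "Re w < - ln \<epsilon>"
  proof -
    have "ln \<epsilon> < - Re w" using that(2) by linarith
    from exp_less_mono [OF this] show ?thesis using that(1) by simp
  qed
  then show "norm (loop2 w) > \<epsilon>" if "\<epsilon> > 0" "Re w < - ln \<epsilon>" using that by (simp add: loop2_def)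
qed

text \<open>Removing a point over \<open>b2\<close> from \<open>E\<close> and \<open>b2\<close> from
  \<open>B\<close> leaves two planes, and outside the branching fibres the cover becomes a covering
  of \<open>punctured\<close>. Local degrees dividing 4, 4 and 2 bound the orders of the three
  monodromies; the unramified point \<open>x0\<close> yields a closed lift of the loop around
  0.\<close>

theorem degree_sum_two_squares:
  fixes E :: "'a topology" and B :: "'b topology"
  assumes ES: "E homeomorphic_space S2" and BS: "B homeomorphic_space S2"
    and f: "branched_cover E B f" and deg: "has_degree E B f d"
    and br: "branching_points E B f = {b0, b1, b2}" "b0 \<noteq> b1" "b0 \<noteq> b2" "b1 \<noteq> b2"
    and fin: "\<And>b. b \<in> {b0, b1, b2} \<Longrightarrow> finite (fibre E f b)"
    and ord: "\<And>x. x \<in> fibre E f b0 \<Longrightarrow> local_degree E B f x dvd 4" "\<And>x. x \<in> fibre E f b1 \<Longrightarrow> local_degree E B f x dvd 4"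
      "\<And>x. x \<in> fibre E f b2 \<Longrightarrow> local_degree E B f x dvd 2"
    and x0: "x0 \<in> fibre E f b0" "local_degree E B f x0 = 1" and ne: "fibre E f b2 \<noteq> {}" and d: "d > 0"
  shows "\<exists>x y :: nat. d = x\<^sup>2 + y\<^sup>2"
proof -
  define BR where "BR = {b0, b1, b2}"
  have brT: "BR \<subseteq> topspace B" using br(1) unfolding BR_def branching_points_def by blast
  have surf: "Hausdorff_space E" "compact_space E" "Hausdorff_space B" "compact_space B"
    and fc: "continuous_map E B f" and lpk: "\<And>x. x \<in> topspace E \<Longrightarrow> \<exists>k. locally_power E B f x k"
    using f unfolding branched_cover_def closed_orientable_surface_def by blast+
  have fT: "f x \<in> topspace B" if "x \<in> topspace E" for x using fc that by (auto simp: continuous_map_def)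
  have lp: "locally_power E B f x (local_degree E B f x)" if "x \<in> topspace E" for x
    using lpk [OF that] local_degree_eq by metis
  have lp1: "locally_power E B f x 1" if x: "x \<in> topspace E" "f x \<notin> BR" for x
  proof -
    have "\<not> 1 < local_degree E B f x"
    proof
      assume "1 < local_degree E B f x"
      then have "f x \<in> branching_points E B f"
        using x fT unfolding branching_points_def fibre_def by blast
      then show False using x br by (simp add: BR_def)
    qed
    moreover have "1 \<le> local_degree E B f x" using lp [OF x(1)] by (simp add: locally_power_def)
    ultimately have "local_degree E B f x = 1" by simp
    then show ?thesis using lp [OF x(1)] by simp
  qed
  obtain einf where einf: "einf \<in> fibre E f b2" using ne by blast
  then have einfT: "einf \<in> topspace E" "f einf = b2" by (auto simp: fibre_def)
  obtain \<eta> \<eta>' where "homeomorphic_maps (subtopology E (topspace E - {einf})) (euclidean :: complex topology) \<eta> \<eta>'"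
    using sphere_minus_point_homeomorphic [OF ES einfT(1)] by blast
  then have \<eta>: "continuous_map (subtopology E (topspace E - {einf})) euclidean \<eta>"
      and \<eta>'c: "continuous_map euclidean E \<eta>'" and \<eta>'T: "\<And>z. \<eta>' z \<in> topspace E" "\<And>z. \<eta>' z \<noteq> einf"
      and \<eta>\<eta>': "\<And>z. \<eta> (\<eta>' z) = z" and \<eta>'\<eta>: "\<And>x. x \<in> topspace E \<Longrightarrow> x \<noteq> einf \<Longrightarrow> \<eta>' (\<eta> x) = x"
    unfolding homeomorphic_maps_def continuous_map_in_subtopology by auto
  have b2T: "b2 \<in> topspace B" using brT by (simp add: BR_def)
  obtain t t' where t: "homeomorphic_maps (subtopology B (topspace B - {b2})) (euclidean :: complex topology) t t'"
    using sphere_minus_point_homeomorphic [OF BS b2T] by blast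
  \<comment> \<open>An affine change of coordinate that moves \<open>b0\<close> to 0 and
    \<open>b1\<close> to 1.\<close>
  define \<theta> where "\<theta> y = (t y - t b0) / (t b1 - t b0)" for y
  define \<theta>' where "\<theta>' z = t' (t b0 + (t b1 - t b0) * z)" for z
  have tt: "continuous_map (subtopology B (topspace B - {b2})) euclidean t" "continuous_map euclidean B t'"
      "\<And>z. t' z \<in> topspace B" "\<And>z. t' z \<noteq> b2" "\<And>z. t (t' z) = z" "\<And>y. y \<in> topspace B \<Longrightarrow> y \<noteq> b2 \<Longrightarrow> t' (t y) = y"
    using t unfolding homeomorphic_maps_def continuous_map_in_subtopology by auto
  have t01: "t b1 - t b0 \<noteq> 0"
  proof
    assume "t b1 - t b0 = 0"
    then have "t' (t b1) = t' (t b0)" by simp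
    then show False using tt(6) [of b0] tt(6) [of b1] br brT by (simp add: BR_def)
  qed
  have \<theta>c: "continuous_map (subtopology B (topspace B - {b2})) euclidean \<theta>"
  proof -
    have "continuous_map euclidean euclidean (\<lambda>z. (z - t b0) / (t b1 - t b0))"
      using t01 by (auto intro!: continuous_intros)
    from continuous_map_compose [OF tt(1) this] show ?thesis by (simp add: \<theta>_def [abs_def] o_def)
  qed
  have \<theta>'c: "continuous_map euclidean B \<theta>'"
  proof -
    have "continuous_map euclidean euclidean (\<lambda>z. t b0 + (t b1 - t b0) * z)" by (auto intro!: continuous_intros)
    from continuous_map_compose [OF this tt(2)] show ?thesis by (simp add: \<theta>'_def [abs_def] o_def)
  qed
  have \<theta>'T: "\<theta>' z \<in> topspace B" "\<theta>' z \<noteq> b2" and \<theta>\<theta>': "\<theta> (\<theta>' z) = z" for z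
    using tt t01 by (simp_all add: \<theta>_def \<theta>'_def)
  have \<theta>'\<theta>: "\<theta>' (\<theta> y) = y" if "y \<in> topspace B" "y \<noteq> b2" for y
    using tt(6) [OF that] t01 by (simp add: \<theta>_def \<theta>'_def)
  have \<theta>01: "\<theta>' 0 = b0" "\<theta>' 1 = b1" using tt(6) [of b0] tt(6) [of b1] br brT by (simp_all add: \<theta>'_def BR_def)
  have \<theta>'BR: "\<theta>' z \<in> BR \<longleftrightarrow> z \<notin> punctured" for z
  proof -
    have "\<theta>' z = b0 \<longleftrightarrow> z = 0" "\<theta>' z = b1 \<longleftrightarrow> z = 1" using \<theta>01 \<theta>\<theta>' by metis+
    then show ?thesis using \<theta>'T(2) by (auto simp: BR_def punctured_def)
  qed
  define c where "c = {z. f (\<eta>' z) \<notin> BR}"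
  define p where "p z = \<theta> (f (\<eta>' z))" for z
  have \<theta>'p: "\<theta>' (p z) = f (\<eta>' z)" if "z \<in> c" for z
    using that fT [OF \<eta>'T(1)] unfolding p_def c_def by (intro \<theta>'\<theta>) (auto simp: BR_def)
  have pS: "p ` c \<subseteq> punctured"
  proof clarify
    fix z assume z: "z \<in> c"
    then show "p z \<in> punctured" using \<theta>'p [OF z] \<theta>'BR [of "p z"] by (auto simp: c_def)
  qed
  have "- c = \<eta> ` ((fibre E f b0 \<union> fibre E f b1 \<union> fibre E f b2) - {einf})"
  proof (intro equalityI subsetI)
    fix z assume "z \<in> - c"
    then have "\<eta>' z \<in> fibre E f b0 \<union> fibre E f b1 \<union> fibre E f b2" using \<eta>'T by (auto simp: c_def BR_def fibre_def)
    then show "z \<in> \<eta> ` ((fibre E f b0 \<union> fibre E f b1 \<union> fibre E f b2) - {einf})"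
      using \<eta>\<eta>' [of z] \<eta>'T(2) [of z] by (metis DiffI imageI singletonD)
  next
    fix z assume "z \<in> \<eta> ` ((fibre E f b0 \<union> fibre E f b1 \<union> fibre E f b2) - {einf})"
    then obtain x where x: "x \<in> topspace E" "x \<noteq> einf" "f x \<in> BR" "z = \<eta> x" by (auto simp: fibre_def BR_def)
    then show "z \<in> - c" using \<eta>'\<eta> [of x] by (simp add: c_def)
  qed
  then have finc: "finite (- c)" using fin by simp
  have "c = UNIV - (- c)" by auto
  then have c: "open c" "connected c"
    using connected_open_delete_finite [of "UNIV :: complex set" "- c"] finc open_Diff [OF open_UNIV finite_imp_closed [OF finc]]
    by auto
  have \<eta>'cc: "continuous_map (top_of_set c) (subtopology E (topspace E - {einf})) \<eta>'"
    using continuous_map_from_subtopology [OF \<eta>'c, of c] \<eta>'T by (auto simp: continuous_map_in_subtopology)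
  have "continuous_map (top_of_set c) B (f \<circ> \<eta>')"
    using continuous_map_from_subtopology [OF continuous_map_compose [OF \<eta>'c fc], of c] .
  then have "continuous_map (top_of_set c) (subtopology B (topspace B - {b2})) (f \<circ> \<eta>')"
    using fT \<eta>'T by (auto simp: continuous_map_in_subtopology c_def BR_def)
  from continuous_map_compose [OF this \<theta>c] have pc: "continuous_on c p"
    by (simp add: p_def [abs_def] o_def)
  have fib: "{z \<in> c. p z = w} = \<eta> ` fibre E f (\<theta>' w)" and inj\<eta>: "inj_on \<eta> (fibre E f (\<theta>' w))" if w: "w \<in> punctured" for w
  proof -
    have nb: "\<theta>' w \<notin> BR" using \<theta>'BR w by blast
    have xe: "x \<noteq> einf" if "x \<in> fibre E f (\<theta>' w)" for x using that nb einfT by (auto simp: fibre_def BR_def)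
    show "inj_on \<eta> (fibre E f (\<theta>' w))"
      using xe \<eta>'\<eta> by (intro inj_on_inverseI [of _ \<eta>']) (auto simp: fibre_def)
    show "{z \<in> c. p z = w} = \<eta> ` fibre E f (\<theta>' w)"
    proof (intro equalityI subsetI)
      fix z assume "z \<in> {z \<in> c. p z = w}"
      then have "f (\<eta>' z) = \<theta>' w" using \<theta>'p by auto
      then have "\<eta>' z \<in> fibre E f (\<theta>' w)" using \<eta>'T by (simp add: fibre_def)
      then show "z \<in> \<eta> ` fibre E f (\<theta>' w)" using \<eta>\<eta>' [of z] by (metis imageI)
    next
      fix z assume "z \<in> \<eta> ` fibre E f (\<theta>' w)"
      then obtain x where x: "x \<in> fibre E f (\<theta>' w)" "z = \<eta> x" by blast
      then have "\<eta>' z = x" using \<eta>'\<eta> xe by (auto simp: fibre_def)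
      then show "z \<in> {z \<in> c. p z = w}" using x nb \<theta>\<theta>' by (auto simp: c_def p_def fibre_def)
    qed
  qed
  have fibd: "finite (fibre E f (\<theta>' w))" "card (fibre E f (\<theta>' w)) = d" if w: "w \<in> punctured" for w
  proof -
    have "\<theta>' w \<in> topspace B - branching_points E B f" using \<theta>'BR w \<theta>'T br by (auto simp: BR_def)
    then show "finite (fibre E f (\<theta>' w))" "card (fibre E f (\<theta>' w)) = d" using deg by (auto simp: has_degree_def)
  qed
  have opS: "open punctured" unfolding punctured_def by (simp add: open_Compl finite_imp_closed)
  \<comment> \<open>Local injectivity holds because only points of local degree 1 remain, and
    properness because \<open>f\<close> is a closed map.\<close>
  have cov: "covering_space c p punctured"
  proof (rule covering_space_proper_local_homeomorphism [OF c(1) opS pc pS])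
    fix z assume z: "z \<in> c"
    obtain U where U: "openin E U" "\<eta>' z \<in> U" "inj_on f U"
      using locally_power_1_inj [OF lp1 [OF \<eta>'T(1)]] z by (metis (mono_tags) c_def mem_Collect_eq)
    have "openin euclidean {v \<in> topspace euclidean. \<eta>' v \<in> U}"
      by (rule openin_continuous_map_preimage [OF \<eta>'c U(1)])
    then have "open (c \<inter> {v. \<eta>' v \<in> U})" using c(1) by (simp add: open_Int)
    moreover have "inj_on p (c \<inter> {v. \<eta>' v \<in> U})"
    proof (rule inj_onI)
      fix u v assume uv: "u \<in> c \<inter> {v. \<eta>' v \<in> U}" "v \<in> c \<inter> {v. \<eta>' v \<in> U}" "p u = p v"
      then have "f (\<eta>' u) = f (\<eta>' v)" using \<theta>'p by (metis IntD1)
      then have "\<eta>' u = \<eta>' v" using U(3) uv by (auto dest: inj_onD)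
      then show "u = v" using \<eta>\<eta>' by metis
    qed
    ultimately show "\<exists>N. open N \<and> z \<in> N \<and> N \<subseteq> c \<and> inj_on p N"
      using z U(2) by (intro exI [of _ "c \<inter> {v. \<eta>' v \<in> U}"]) auto
  next
    fix w assume w: "w \<in> punctured"
    have "fibre E f (\<theta>' w) \<noteq> {}" using fibd [OF w] d by auto
    then show "finite {z \<in> c. p z = w} \<and> {z \<in> c. p z = w} \<noteq> {}"
      unfolding fib [OF w] using fibd(1) [OF w] by simp
  next
    fix w N assume w: "w \<in> punctured" and N: "open N" "{z \<in> c. p z = w} \<subseteq> N"
    define O' where "O' = {x \<in> topspace E - {einf}. \<eta> x \<in> N}"
    have T: "openin E (topspace E - {einf})" using surf(1) einfT by (simp add: openin_diff closedin_Hausdorff_singleton)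
    have "openin (subtopology E (topspace E - {einf})) {x \<in> topspace (subtopology E (topspace E - {einf})). \<eta> x \<in> N}"
      by (rule openin_continuous_map_preimage [OF \<eta>]) (use N in simp)
    then have "openin E O'" using T unfolding O'_def by (simp add: openin_open_subtopology)
    then have "closedin E (topspace E - O')" by blast
    moreover have "closed_map E B f" using fc surf by (simp add: continuous_imp_closed_map)
    ultimately have "closedin B (f ` (topspace E - O'))" by (simp add: closed_map_def)
    then have oV: "openin B (topspace B - f ` (topspace E - O'))" by blast
    define T' where "T' = punctured \<inter> {v. \<theta>' v \<in> topspace B - f ` (topspace E - O')}"
    have "openin euclidean {v \<in> topspace euclidean. \<theta>' v \<in> topspace B - f ` (topspace E - O')}"
      by (rule openin_continuous_map_preimage [OF \<theta>'c oV])
    then have "open T'" unfolding T'_def using opS by (simp add: open_Int)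
    moreover have "w \<in> T'"
    proof -
      have "x \<in> O'" if x: "x \<in> topspace E" "f x = \<theta>' w" for x
      proof -
        have "x \<in> fibre E f (\<theta>' w)" using x by (simp add: fibre_def)
        then have "\<eta> x \<in> N" using N(2) fib [OF w] by blast
        moreover have "x \<noteq> einf" using x(2) einfT(2) \<theta>'T(2) [of w] by metis
        ultimately show ?thesis using x by (simp add: O'_def)
      qed
      then have "\<theta>' w \<notin> f ` (topspace E - O')" by force
      then show ?thesis using w \<theta>'T by (simp add: T'_def)
    qed
    moreover have "{z \<in> c. p z \<in> T'} \<subseteq> N"
    proof clarify
      fix z assume z: "z \<in> c" "p z \<in> T'"
      then have "f (\<eta>' z) \<notin> f ` (topspace E - O')" using \<theta>'p [OF z(1)] by (auto simp: T'_def)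
      then have "\<eta>' z \<in> O'" using \<eta>'T(1) [of z] by blast
      then show "z \<in> N" using \<eta>\<eta>' by (simp add: O'_def)
    qed
    ultimately show "\<exists>T. open T \<and> w \<in> T \<and> T \<subseteq> punctured \<and> {z \<in> c. p z \<in> T} \<subseteq> N"
      by (intro exI [of _ T']) (auto simp: T'_def)
  qed
  have i: "\<i> \<in> punctured" by (simp add: punctured_def complex_eq_iff)
  have F: "finite {x \<in> c. p x = \<i>}" "card {x \<in> c. p x = \<i>} = d"
    unfolding fib [OF i] using fibd [OF i] card_image [OF inj\<eta> [OF i]] by simp_all
  have eB: "continuous_map (top_of_set left_half) B (\<theta>' \<circ> e)" "\<And>w b. w \<in> left_half \<Longrightarrow> b \<in> BR \<Longrightarrow> (\<theta>' \<circ> e) w \<noteq> b"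
      "\<And>w. (\<theta>' \<circ> e) (w + 2 * pi * \<i>) = (\<theta>' \<circ> e) w"
      "\<And>u w. w \<in> left_half \<Longrightarrow> u \<in> topspace E \<Longrightarrow> f u = (\<theta>' \<circ> e) w \<Longrightarrow> locally_power E B f u 1"
    if e: "vertex_loop e W W'" for e W W'
  proof -
    have e': "continuous_on left_half e" "\<And>w. w \<in> left_half \<Longrightarrow> e w \<in> punctured" "\<And>w. e (w + 2 * pi * \<i>) = e w"
      using e unfolding vertex_loop_def by blast+
    have "continuous_map (top_of_set left_half) euclidean e" using e'(1) by simp
    then show "continuous_map (top_of_set left_half) B (\<theta>' \<circ> e)" using \<theta>'c by (rule continuous_map_compose)
    have nb: "(\<theta>' \<circ> e) w \<notin> BR" if "w \<in> left_half" for w using e'(2) [OF that] \<theta>'BR by simp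
    show "(\<theta>' \<circ> e) w \<noteq> b" if "w \<in> left_half" "b \<in> BR" for w b using nb that by blast
    show "(\<theta>' \<circ> e) (w + 2 * pi * \<i>) = (\<theta>' \<circ> e) w" for w by (simp only: comp_apply e'(3))
    show "locally_power E B f u 1" if "w \<in> left_half" "u \<in> topspace E" "f u = (\<theta>' \<circ> e) w" for u w
      using lp1 [OF that(2)] nb [OF that(1)] that(3) by simp
  qed
  have lift: "branch_lift E f (\<theta>' \<circ> e) left_half (\<eta>' \<circ> g)" if "lift_of c p e left_half g" for e g
  proof -
    have g: "continuous_on left_half g" "\<And>w. w \<in> left_half \<Longrightarrow> g w \<in> c" "\<And>w. w \<in> left_half \<Longrightarrow> p (g w) = e w"
      using that by (auto simp: lift_of_def)
    have "continuous_map (top_of_set left_half) euclidean g" using g(1) by simp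
    then have "continuous_map (top_of_set left_half) E (\<eta>' \<circ> g)" using \<eta>'c by (rule continuous_map_compose)
    moreover have "f ((\<eta>' \<circ> g) w) = (\<theta>' \<circ> e) w" if "w \<in> left_half" for w
      using \<theta>'p [OF g(2) [OF that]] g(3) [OF that] by simp
    ultimately show ?thesis by (simp add: branch_lift_def)
  qed
  have lim_point: "\<exists>M. \<forall>w. Re w < M \<longrightarrow> (\<theta>' \<circ> e) w \<in> V"
    if V: "openin B V" "\<theta>' a \<in> V" and e: "\<And>\<epsilon> w. \<epsilon> > 0 \<Longrightarrow> Re w < ln \<epsilon> \<Longrightarrow> norm (e w - a) < \<epsilon>" for V a e
  proof -
    have "openin euclidean {v \<in> topspace euclidean. \<theta>' v \<in> V}" by (rule openin_continuous_map_preimage [OF \<theta>'c V(1)])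
    then have "open {v. \<theta>' v \<in> V}" by simp
    then obtain \<epsilon> where \<epsilon>: "\<epsilon> > 0" "ball a \<epsilon> \<subseteq> {v. \<theta>' v \<in> V}" using V(2) by (metis mem_Collect_eq openE)
    have "(\<theta>' \<circ> e) w \<in> V" if "Re w < ln \<epsilon>" for w
      using e [OF \<epsilon>(1) that] \<epsilon>(2) by (auto simp: dist_norm norm_minus_commute)
    then show ?thesis by blast
  qed
  have lim0: "\<exists>M. \<forall>w. Re w < M \<longrightarrow> (\<theta>' \<circ> loop0) w \<in> V" if "openin B V" "b0 \<in> V" for V
    by (rule lim_point [of V 0]) (use that \<theta>01 loop_limits(1) in auto)
  have lim1: "\<exists>M. \<forall>w. Re w < M \<longrightarrow> (\<theta>' \<circ> loop1) w \<in> V" if "openin B V" "b1 \<in> V" for V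
    by (rule lim_point [of V 1]) (use that \<theta>01 loop_limits(2) in auto)
  \<comment> \<open>The complement of \<open>V\<close> is compact and misses \<open>b2\<close>, so
    its coordinates are bounded, whereas \<open>loop2\<close> leaves every bounded set.\<close>
  have lim2: "\<exists>M. \<forall>w. Re w < M \<longrightarrow> (\<theta>' \<circ> loop2) w \<in> V" if V: "openin B V" "b2 \<in> V" for V
  proof -
    have "closedin B (topspace B - V)" using V by blast
    then have "compactin B (topspace B - V)" using surf(4) closedin_compact_space by blast
    then have "compactin (subtopology B (topspace B - {b2})) (topspace B - V)"
      using V by (auto simp: compactin_subtopology)
    then have "compactin euclidean (\<theta> ` (topspace B - V))" using \<theta>c by (rule image_compactin)
    then have "bounded (\<theta> ` (topspace B - V))" by (simp add: compact_imp_bounded)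
    then obtain R where R: "\<And>y. y \<in> topspace B - V \<Longrightarrow> norm (\<theta> y) \<le> R" unfolding bounded_iff by auto
    define R' where "R' = max R 1"
    have "(\<theta>' \<circ> loop2) w \<in> V" if "Re w < - ln R'" for w
    proof (rule ccontr)
      assume "(\<theta>' \<circ> loop2) w \<notin> V"
      then have "norm (loop2 w) \<le> R" using R [of "\<theta>' (loop2 w)"] \<theta>'T \<theta>\<theta>' by simp
      moreover have "norm (loop2 w) > R'" by (rule loop_limits(3)) (use that in \<open>auto simp: R'_def\<close>)
      ultimately show False by (simp add: R'_def)
    qed
    then show ?thesis by blast
  qed
  have per: "periodic_lifts c p e n"
    if e: "vertex_loop e W W'" and b: "b \<in> BR" "\<And>x. x \<in> fibre E f b \<Longrightarrow> local_degree E B f x dvd n"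
      and lim: "\<And>V. openin B V \<Longrightarrow> b \<in> V \<Longrightarrow> \<exists>M. \<forall>w. Re w < M \<longrightarrow> (\<theta>' \<circ> e) w \<in> V" for e W W' b n
    unfolding periodic_lifts_def
  proof (intro allI impI ballI)
    fix g w assume g: "lift_of c p e left_half g" and w: "w \<in> left_half"
    have k: "\<exists>k. locally_power E B f x k \<and> k dvd n" if "x \<in> fibre E f b" for x
      using lp [of x] b(2) [OF that] that by (auto simp: fibre_def)
    have "(\<eta>' \<circ> g) (w + of_nat n * (2 * pi * \<i>)) = (\<eta>' \<circ> g) w"
    proof (rule branch_lift_period [OF surf(1-3) fc _ _ k eB(1) [OF e] _ eB(3) [OF e] lim eB(4) [OF e] lift [OF g] w])
      show "finite (fibre E f b)" using fin b(1) by (simp add: BR_def)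
      show "b \<in> topspace B" using brT b(1) by blast
      show "(\<theta>' \<circ> e) v \<noteq> b" if "v \<in> left_half" for v by (rule eB(2) [OF e that b(1)])
    qed
    then show "g (w + of_nat n * (2 * pi * \<i>)) = g w" using \<eta>\<eta>' by (metis comp_apply)
  qed
  have bBR: "b0 \<in> BR" "b1 \<in> BR" "b2 \<in> BR" by (simp_all add: BR_def)
  have per0: "periodic_lifts c p loop0 4" by (rule per [OF vertex_loops(1) bBR(1) ord(1) lim0])
  have per1: "periodic_lifts c p loop1 4" by (rule per [OF vertex_loops(2) bBR(2) ord(2) lim1])
  have per2: "periodic_lifts c p loop2 2" by (rule per [OF vertex_loops(3) bBR(3) ord(3) lim2])
  have x0T: "x0 \<in> topspace E" "f x0 = b0" using x0 by (auto simp: fibre_def)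
  have lpx0: "locally_power E B f x0 1" using lp [OF x0T(1)] x0(2) by simp
  note e0 = eB [OF vertex_loops(1)]
  \<comment> \<open>Local degree 1 at \<open>x0\<close> allows a period of one turn: a lift of
    \<open>loop0\<close> that enters \<open>N\<close> far enough to the left closes up at
    once.\<close>
  obtain N V where NV: "openin E N" "x0 \<in> N" "openin B V" "b0 \<in> V" "lifts_periodic_near E f (\<theta>' \<circ> loop0) 1 N V"
    by (rule branch_lift_period_near [OF surf(1) lpx0 x0T(2) e0(1) e0(2) [OF _ bBR(1)] e0(3,4) one_dvd])
  obtain M0 where M0: "\<And>w. Re w < M0 \<Longrightarrow> (\<theta>' \<circ> loop0) w \<in> V" using lim0 [OF NV(3,4)] by blast
  define M where "M = min M0 0"
  have MV: "\<forall>w\<in>left_of M. (\<theta>' \<circ> loop0) w \<in> V" using M0 by (simp add: left_of_def M_def)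
  have M0': "M \<le> 0" by (simp add: M_def)
  note near = lifts_periodic_nearD [OF NV(5) M0' MV]
  obtain w0 u where w0: "w0 \<in> left_of M" "u \<in> N" "f u = (\<theta>' \<circ> loop0) w0"
    using near(1) by blast
  have w0l: "w0 \<in> left_half" using w0(1) left_of_facts(4) [OF M0'] left_of_facts(6) by blast
  have uT: "u \<in> topspace E" using NV(1) w0(2) openin_subset by blast
  have nb: "f u \<notin> BR" using e0(2) [OF w0l] w0(3) by metis
  then have une: "u \<noteq> einf" using einfT by (auto simp: BR_def)
  have \<eta>u: "\<eta>' (\<eta> u) = u" by (rule \<eta>'\<eta> [OF uT une])
  have cu: "\<eta> u \<in> c" using nb \<eta>u by (simp add: c_def)
  have pu: "p (\<eta> u) = loop0 w0" using w0(3) \<eta>u \<theta>\<theta>' by (simp add: p_def)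
  have e0c: "continuous_on left_half loop0" "loop0 ` left_half \<subseteq> punctured"
    using vertex_loops(1) unfolding vertex_loop_def by blast+
  obtain g where g: "lift_of c p loop0 left_half g" "g w0 = \<eta> u"
    by (rule lift_exists [OF cov half_planes(7) upper_open_simply(3) e0c w0l cu pu])
  have gN: "(\<eta>' \<circ> g) w0 \<in> N" using g(2) \<eta>u w0(2) by simp
  have gper: "g (w + 2 * pi * \<i>) = g w" if "w \<in> left_half" for w
  proof -
    have "\<eta>' (g (w + 2 * pi * \<i>)) = \<eta>' (g w)" using near(2) [OF lift [OF g(1)] w0(1) gN that] by simp
    then show ?thesis using \<eta>\<eta>' by metis
  qed
  show ?thesis
    by (rule card_covering_triangle [OF cov c F vertex_loops per0 per1 per2 g(1) gper])
qed

section \<open>Realizability and sums of two squares\<close>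

lemma local_degrees_entries:
  assumes "local_degrees E B f b = M" "M \<noteq> {#}"
  shows "finite (fibre E f b)" "local_degree E B f ` fibre E f b = set_mset M"
proof -
  \<comment> \<open>\<open>mset_set\<close> of an infinite set is empty, so a nonempty multiset of
    local degrees certifies a finite fibre.\<close>
  show fin: "finite (fibre E f b)"
  proof (rule ccontr)
    assume "infinite (fibre E f b)"
    then show False using assms by (simp add: local_degrees_def)
  qed
  have "set_mset M = set_mset (local_degrees E B f b)" using assms by simp
  then show "local_degree E B f ` fibre E f b = set_mset M" using fin by (simp add: local_degrees_def)
qed

lemma sum_two_squares_if_realizable:
  fixes E :: "'a topology" and B :: "'b topology"
  assumes E: "E homeomorphic_space S2" and B: "B homeomorphic_space S2"
    and k: "1 \<le> k" and shape: "cand_shape k d R" and real: "realizable E B d R"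
  shows "\<exists>x y :: nat. d = x\<^sup>2 + y\<^sup>2"
proof -
  \<comment> \<open>In all three shapes the last partition contains a 1; the branching point that
    carries it becomes \<open>b0\<close>.\<close>
  obtain p2 p1 p0 where R: "R = {#p2, p1, p0#}" and p: "\<forall>a\<in>#p2. a dvd 2" "\<forall>a\<in>#p1. a dvd 4" "\<forall>a\<in>#p0. a dvd 4"
    and ne: "p2 \<noteq> {#}" "p1 \<noteq> {#}" "1 \<in># p0"
  proof -
    have k0: "0 < k" using k by simp
    from shape consider
        "R = {# replicate_mset (2 * k) 2 + {#1#}, replicate_mset k 4 + {#1#}, replicate_mset k 4 + {#1#} #}"
      | "R = {# replicate_mset (2 * k + 1) 2, replicate_mset k 4 + {#2#}, replicate_mset k 4 + {#1, 1#} #}"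
      | "R = {# replicate_mset (2 * k + 2) 2, replicate_mset (k + 1) 4, replicate_mset k 4 + {#2, 1, 1#} #}"
      unfolding cand_shape_def by blast
    then show ?thesis
    proof cases
      case 1
      show ?thesis by (rule that [OF 1]) (simp_all add: k0)
    next
      case 2
      show ?thesis by (rule that [OF 2]) (simp_all add: k0)
    next
      case 3
      show ?thesis by (rule that [OF 3]) (simp_all add: k0)
    qed
  qed
  have p0: "p0 \<noteq> {#}" using ne by auto
  obtain f where f: "branched_cover E B f" "has_degree E B f d" "finite (branching_points E B f)"
    "card (branching_points E B f) = 3" "image_mset (local_degrees E B f) (mset_set (branching_points E B f)) = {#p2, p1, p0#}"
    using real unfolding realizable_def R by auto
  obtain b2 b1 b0 where b: "mset_set (branching_points E B f) = {#b2, b1, b0#}"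
    "local_degrees E B f b2 = p2" "local_degrees E B f b1 = p1" "local_degrees E B f b0 = p0"
    using image_mset_eq_triple [OF f(5)] by blast
  have "set_mset (mset_set (branching_points E B f)) = {b2, b1, b0}" unfolding b(1) by simp
  then have br: "branching_points E B f = {b0, b1, b2}" using f(3) by auto
  then have dist: "b0 \<noteq> b1" "b0 \<noteq> b2" "b1 \<noteq> b2" using f(4) by (auto simp: card_insert_if split: if_splits)
  note e2 = local_degrees_entries [OF b(2) ne(1)] and e1 = local_degrees_entries [OF b(3) ne(2)]
    and e0 = local_degrees_entries [OF b(4) p0]
  obtain x0 where x0: "x0 \<in> fibre E f b0" "local_degree E B f x0 = 1" using e0(2) ne(3) by (metis imageE)
  have fin: "finite (fibre E f b)" if "b \<in> {b0, b1, b2}" for b using that e0(1) e1(1) e2(1) by blast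
  have ord: "x \<in> fibre E f b0 \<Longrightarrow> local_degree E B f x dvd 4" "x \<in> fibre E f b1 \<Longrightarrow> local_degree E B f x dvd 4"
    "x \<in> fibre E f b2 \<Longrightarrow> local_degree E B f x dvd 2" for x
    using e0(2) e1(2) e2(2) p by blast+
  have "fibre E f b2 \<noteq> {}" using e2(2) ne(1) by auto
  moreover have "d > 0" using shape k by (auto simp: cand_shape_def)
  ultimately show ?thesis
    using degree_sum_two_squares [OF E B f(1,2) br dist fin ord x0] by blast
qed

lemma realizable_iff_sum_two_squares:
  fixes E :: "'a topology" and B :: "'b topology"
  assumes "E homeomorphic_space S2" "B homeomorphic_space S2" "1 \<le> k" "cand_shape k d R"
  shows "realizable E B d R \<longleftrightarrow> (\<exists>x y :: nat. d = x\<^sup>2 + y\<^sup>2)"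
  using sum_two_squares_if_realizable [OF assms] realizable_if_sum_two_squares [OF assms] by blast

lemma sum_two_squares_odd:
  assumes "odd d"
  shows "(\<exists>x y :: nat. d = x\<^sup>2 + y\<^sup>2) \<longleftrightarrow> (\<exists>x y :: nat. even x \<noteq> even y \<and> d = x\<^sup>2 + y\<^sup>2)"
proof -
  have "even x \<noteq> even y" if "d = x\<^sup>2 + y\<^sup>2" for x y :: nat using assms that by auto
  then show ?thesis by blast
qed

text \<open>Both directions use \<open>(x + y)^2 + (x - y)^2 = 2 * (x^2 + y^2)\<close>. If the sum
  is even, \<open>x\<close> and \<open>y\<close> have equal parity and are replaced by half their
  sum and half their difference; ordering them keeps the subtraction within the naturals.\<close>

lemma sum_two_squares_double: "(\<exists>x y :: nat. 2 * d = x\<^sup>2 + y\<^sup>2) \<longleftrightarrow> (\<exists>x y :: nat. d = x\<^sup>2 + y\<^sup>2)"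
proof
  assume "\<exists>x y :: nat. 2 * d = x\<^sup>2 + y\<^sup>2"
  then obtain x y :: nat where xy: "2 * d = x\<^sup>2 + y\<^sup>2" "y \<le> x" by (metis add.commute nat_le_linear)
  have "even (x\<^sup>2 + y\<^sup>2)" using xy(1) by (metis dvd_triv_left)
  then have "even (x + y)" "even (x - y)" using xy(2) by auto
  then obtain u v where "x + y = 2 * u" "x - y = 2 * v" unfolding dvd_def by blast
  then have "x = u + v" "y = u - v" "v \<le> u" using xy(2) by simp_all
  then obtain w where w: "u = v + w" "x = 2 * v + w" "y = w" by (metis le_Suc_ex add_diff_cancel_left' mult_2 add.commute add.left_commute)
  have "2 * d = 2 * ((v + w)\<^sup>2 + v\<^sup>2)" unfolding xy(1) w(2,3) by (simp add: power2_eq_square algebra_simps)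
  then have "d = (v + w)\<^sup>2 + v\<^sup>2" by simp
  then show "\<exists>x y :: nat. d = x\<^sup>2 + y\<^sup>2" by blast
next
  assume "\<exists>x y :: nat. d = x\<^sup>2 + y\<^sup>2"
  then obtain x y :: nat where xy: "d = x\<^sup>2 + y\<^sup>2" "y \<le> x" by (metis add.commute nat_le_linear)
  then obtain w where w: "x = y + w" by (metis le_Suc_ex)
  have "2 * d = (y + y + w)\<^sup>2 + w\<^sup>2" unfolding xy(1) w by (simp add: power2_eq_square algebra_simps)
  then show "\<exists>x y :: nat. 2 * d = x\<^sup>2 + y\<^sup>2" by blast
qed

theorem theorem3p3:
  fixes E :: "'a topology" and B :: "'b topology"
  shows
    "(\<forall>d P. candidate_branched_cover E B d P \<and>
            induces_orbifold_cover E B P (S2, {#2, 4, 4#}) (S2, {#2, 4, 4#})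
        \<longleftrightarrow>
        E homeomorphic_space S2 \<and> B homeomorphic_space S2 \<and>
        (\<exists>k::nat. 1 \<le> k \<and>
          (d = 4 * k + 1 \<and>
             P = {# replicate_mset (2 * k) 2 + {#1#},
                    replicate_mset k 4 + {#1#},
                    replicate_mset k 4 + {#1#} #} \<or>
           d = 4 * k + 2 \<and>
             P = {# replicate_mset (2 * k + 1) 2,
                    replicate_mset k 4 + {#2#},
                    replicate_mset k 4 + {#1, 1#} #} \<or>
           d = 4 * k + 4 \<and>
             P = {# replicate_mset (2 * k + 2) 2,
                    replicate_mset (k + 1) 4,
                    replicate_mset k 4 + {#2, 1, 1#} #})))
     \<and>
     (E homeomorphic_space S2 \<and> B homeomorphic_space S2 \<longrightarrow>
       (\<forall>d k::nat. 1 \<le> k \<longrightarrow>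
         (d = 4 * k + 1 \<longrightarrow>
            (realizable E B d {# replicate_mset (2 * k) 2 + {#1#},
                                 replicate_mset k 4 + {#1#},
                                 replicate_mset k 4 + {#1#} #}
             \<longleftrightarrow> (\<exists>x y::nat. even x \<noteq> even y \<and> d = x ^ 2 + y ^ 2))) \<and>
         (d = 4 * k + 2 \<longrightarrow>
            (realizable E B d {# replicate_mset (2 * k + 1) 2,
                                 replicate_mset k 4 + {#2#},
                                 replicate_mset k 4 + {#1, 1#} #}
             \<longleftrightarrow> (\<exists>x y::nat. even x \<noteq> even y \<and> d = 2 * (x ^ 2 + y ^ 2)))) \<and>
         (d = 4 * k + 4 \<longrightarrow>
            (realizable E B d {# replicate_mset (2 * k + 2) 2,
                                 replicate_mset (k + 1) 4,
                                 replicate_mset k 4 + {#2, 1, 1#} #}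
             \<longleftrightarrow> (\<exists>x y::nat. d = 4 * (x ^ 2 + y ^ 2))))))"
proof (intro conjI allI impI)
  fix d P
  show "candidate_branched_cover E B d P \<and>
            induces_orbifold_cover E B P (S2, {#2, 4, 4#}) (S2, {#2, 4, 4#})
        \<longleftrightarrow>
        E homeomorphic_space S2 \<and> B homeomorphic_space S2 \<and>
        (\<exists>k::nat. 1 \<le> k \<and>
          (d = 4 * k + 1 \<and>
             P = {# replicate_mset (2 * k) 2 + {#1#},
                    replicate_mset k 4 + {#1#},
                    replicate_mset k 4 + {#1#} #} \<or>
           d = 4 * k + 2 \<and>
             P = {# replicate_mset (2 * k + 1) 2,
                    replicate_mset k 4 + {#2#},
                    replicate_mset k 4 + {#1, 1#} #} \<or>
           d = 4 * k + 4 \<and>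
             P = {# replicate_mset (2 * k + 2) 2,
                    replicate_mset (k + 1) 4,
                    replicate_mset k 4 + {#2, 1, 1#} #}))"
    unfolding cand_shape_def [symmetric]
  proof (intro iffI; elim conjE exE)
    assume cand: "candidate_branched_cover E B d P"
      and ind: "induces_orbifold_cover E B P (S2, {#2, 4, 4#}) (S2, {#2, 4, 4#})"
    have orders: "E homeomorphic_space S2" "B homeomorphic_space S2" "image_mset part_lcm P = {#2, 4, 4#}"
      "filter_mset (\<lambda>q. q \<noteq> 1) (\<Sum>p\<in>#P. image_mset (\<lambda>a. part_lcm p div a) p) = {#2, 4, 4#}"
      using ind by (simp_all add: induces_orbifold_cover_def orbifold_iso_def induced_base_orbifold_def induced_cover_orbifold_def)
    have "\<forall>p\<in>#P. is_partition d p" using cand by (simp add: candidate_branched_cover_def)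
    from shape_if_induced_orders [OF this orders(3,4)]
    show "E homeomorphic_space S2 \<and> B homeomorphic_space S2 \<and> (\<exists>k. 1 \<le> k \<and> cand_shape k d P)"
      using orders(1,2) by blast
  next
    fix k :: nat
    assume EB: "E homeomorphic_space S2" "B homeomorphic_space S2" and k: "1 \<le> k" "cand_shape k d P"
    note s = shape_induced_orders [OF k]
    have "(\<Sum>p\<in>#P. int (size p)) = int (\<Sum>p\<in>#P. size p)" by (simp add: image_mset.compositionality o_def)
    then have "candidate_branched_cover E B d P"
      unfolding candidate_branched_cover_def
      using s closed_orientable_surface_if_S2 [OF EB(1)] closed_orientable_surface_if_S2 [OF EB(2)]
        euler_char_sphere [OF EB(1)] euler_char_sphere [OF EB(2)] by simp
    moreover have "induces_orbifold_cover E B P (S2, {#2, 4, 4#}) (S2, {#2, 4, 4#})"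
      using EB s by (simp add: induces_orbifold_cover_def orbifold_iso_def induced_base_orbifold_def induced_cover_orbifold_def)
    ultimately show "candidate_branched_cover E B d P \<and> induces_orbifold_cover E B P (S2, {#2, 4, 4#}) (S2, {#2, 4, 4#})"
      by blast
  qed
next
  fix d k :: nat
  assume EB: "E homeomorphic_space S2 \<and> B homeomorphic_space S2" and k: "1 \<le> k"
  note real = realizable_iff_sum_two_squares [OF conjunct1 [OF EB] conjunct2 [OF EB] k]
  {
    assume d: "d = 4 * k + 1"
    then have "odd d" by simp
    then show "realizable E B d {# replicate_mset (2 * k) 2 + {#1#},
                                 replicate_mset k 4 + {#1#},
                                 replicate_mset k 4 + {#1#} #}
             \<longleftrightarrow> (\<exists>x y::nat. even x \<noteq> even y \<and> d = x ^ 2 + y ^ 2)"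
      unfolding sum_two_squares_odd [OF \<open>odd d\<close>, symmetric]
      by (intro real) (simp add: cand_shape_def d)
  }
  {
    assume d: "d = 4 * k + 2"
    \<comment> \<open>Halving keeps the property of being a sum of two squares, and since
      \<open>m\<close> is odd its two summands have different parity.\<close>
    define m where "m = 2 * k + 1"
    have m: "d = 2 * m" "odd m" using d by (simp_all add: m_def)
    have "realizable E B d {# replicate_mset (2 * k + 1) 2,
                                 replicate_mset k 4 + {#2#},
                                 replicate_mset k 4 + {#1, 1#} #}
        \<longleftrightarrow> (\<exists>x y::nat. even x \<noteq> even y \<and> m = x\<^sup>2 + y\<^sup>2)"
      unfolding sum_two_squares_odd [OF m(2), symmetric] sum_two_squares_double [of m, symmetric] m(1) [symmetric]
      by (rule real) (simp add: cand_shape_def d)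
    then show "realizable E B d {# replicate_mset (2 * k + 1) 2,
                                 replicate_mset k 4 + {#2#},
                                 replicate_mset k 4 + {#1, 1#} #}
             \<longleftrightarrow> (\<exists>x y::nat. even x \<noteq> even y \<and> d = 2 * (x ^ 2 + y ^ 2))"
      unfolding m(1) mult_cancel1 by simp
  }
  {
    assume d: "d = 4 * k + 4"
    \<comment> \<open>Two halvings reduce \<open>d = 4 * m\<close> to \<open>m\<close>, whose parity
      is arbitrary.\<close>
    define m where "m = k + 1"
    have m: "d = 2 * (2 * m)" using d by (simp add: m_def)
    have real: "realizable E B d {# replicate_mset (2 * k + 2) 2,
                                 replicate_mset (k + 1) 4,
                                 replicate_mset k 4 + {#2, 1, 1#} #}
        \<longleftrightarrow> (\<exists>x y::nat. m = x\<^sup>2 + y\<^sup>2)"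
      unfolding sum_two_squares_double [of m, symmetric] sum_two_squares_double [of "2 * m", symmetric] m [symmetric]
      by (rule real) (simp add: cand_shape_def d)
    then show "realizable E B d {# replicate_mset (2 * k + 2) 2,
                                 replicate_mset (k + 1) 4,
                                 replicate_mset k 4 + {#2, 1, 1#} #}
             \<longleftrightarrow> (\<exists>x y::nat. d = 4 * (x ^ 2 + y ^ 2))"
    proof -
      have "d = 4 * n \<longleftrightarrow> m = n" for n using m by auto
      then show ?thesis unfolding real by presburger
    qed
  }
qed

end
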